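(* Let $A$, $\Lambda$, $E$, $S$, $r_N$, $\mathcal{V}$, $\mathcal{V}_h$, $R_h(z)$, $S_N^h$, $E_h$, the form $a$, the operators $A_E$, $A_{E_h}$, and $\Lambda_h=\Sigma(A_{E_h})$ be as in the context, let $Q_h$ denote the $\mathcal{H}$-orthogonal projection onto $E_h$, and suppose Assumptions 1, 2, 3 and 4 stated in the context hold. Then there are positive constants $C_0$ and $h_0$ such that for all $h<h_0$, $$\operatorname{dist}(\Lambda,\Lambda_h)\le|(S-I)Q_h|_{a,E_h}^2+C_0\,\|A_E\|\,\operatorname{gap}_{\mathcal{H}}(E,E_h)^2.$$
   Context: Setting. $A:\operatorname{dom}(A)\subseteq\mathcal{H}\to\mathcal{H}$ is a linear, closed, selfadjoint (not necessarily bounded) operator in a complex Hilbert space $\mathcal{H}$, with spectrum $\Sigma(A)\subset\mathbb{R}$ and resolvent $R(z)=(z-A)^{-1}$. $\Lambda\subset\Sigma(A)$ is a finite collection of eigenvalues of finite multiplicity; $E$ is the span of all eigenvectors associated with elements of $\Lambda$; $m=\dim E$, assumed to satisfy $1\le m<\infty$; $\lambda_1,\ldots,\lambda_m$ are the elements of $\Lambda$ counted with multiplicity. $S$ is the spectral projection of $A$ associated with $\Lambda$, i.e. the $\mathcal{H}$-orthogonal projection onto $E$. Filter. $r_N(\xi)=w_N+\sum_{k=0}^{N-1}w_k(z_k-\xi)^{-1}$ with $w_k,z_k\in\mathbb{C}$, $W=\sum_{k=0}^N|w_k|$, and $S_N=r_N(A)=w_N+\sum_{k=0}^{N-1}w_kR(z_k)$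 (the scalar $w_N$ means $w_N$ times the identity). For $y\in\mathbb{R}$, $\gamma,\delta>0$ let $I_\gamma^y=\{x\in\mathbb{R}:|x-y|\le\gamma\}$, $O_{\delta,\gamma}^y=\{x\in\mathbb{R}:|x-y|\ge(1+\delta)\gamma\}$, and $\hat\kappa=\sup_{x\in O_{\delta,\gamma}^y}|r_N(x)|\,/\,\inf_{x\in I_\gamma^y}|r_N(x)|$. Assumption 1. There are $y\in\mathbb{R}$, $\delta>0$, $\gamma>0$ such that $\Lambda\subset I_\gamma^y$ and $\Sigma(A)\setminus\Lambda\subset O_{\delta,\gamma}^y$; and $r_N$ is a rational function of the form $r_N(\xi)=w_N+\sum_{k=0}^{N-1}w_k(z_k-\xi)^{-1}$ with $z_k\notin\overline{\Sigma(A)}$, $W<\infty$, $\hat\kappa<1$. Assumption 2. There is a Hilbert space $\mathcal{V}\subseteq\mathcal{H}$ such that $E\subseteq\mathcal{V}$, there is $C_{\mathcal{V}}>0$ with $\|u\|_{\mathcal{H}}\le C_{\mathcal{V}}\|u\|_{\mathcal{V}}$ for all $u\in\mathcal{V}$, and $\mathcal{V}$ is an invariant subspace of $R(z)$ for $z$ in the resolvent set of $A$. Discretization. For each value of a parameter $h>0$ (tending to $0$), $\mathcal{V}_h$ is a finite-dimensional subspace of $\mathcal{V}$ and $R_h(z):\mathcal{H}\to\mathcal{V}_h$ is a finite-rank approximation of $R(z)$; $S_N^h=w_N+\sum_{k=0}^{N-1}w_kR_h(z_k)$. Assumption 3. The operators $R_h(z_k)$ and $R(z_k)$ are bounded in $\mathcal{V}$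 and $\lim_{h\to0}\|R_h(z_k)-R(z_k)\|_{\mathcal{V}}=0$ for all $k=0,\ldots,N-1$ (operator norm on $\mathcal{V}$). $S_N$ and $S_N^h$ are viewed as bounded operators on $\mathcal{V}$. Let $\mu_i=r_N(\lambda_i)$ and $\mu_*=\sup\{|\mu|:\mu\in\Sigma(S_N)\setminus\{\mu_1,\ldots,\mu_m\}\}$; Assumption 1 gives $\mu_*<|\mu_i|$ and $\mu_i\neq0$ for $i=1,\ldots,m$. Fix a simple rectifiable closed curve $\Theta$ in $\mathbb{C}$ that encloses $\{\mu_1,\ldots,\mu_m\}$, lies strictly outside the circle of radius $\mu_*$ centered at $0$, and encloses no other element of $\Sigma(S_N)$ (nor $0$). For sufficiently small $h$, $\Theta$ lies in the resolvent set of $S_N^h$ and encloses exactly $m$ eigenvalues (with multiplicity) of $S_N^h$; for such $h$ define $P_h=\frac{1}{2\pi i}\oint_\Theta(z-S_N^h)^{-1}\,dz$ and $E_h=\operatorname{ran}P_h$ (so $\dim E_h=m$, and $E_h\subset\mathcal{V}_h$). Form and Ritz values. Let $A=U_A|A|=|A|U_A$ be the polar decomposition of $A$ ($U_A$ selfadjoint and partially isometric, $|A|$ selfadjoint positive semidefinite). The form associated to $A$ is $a(x,y)=(U_A|A|^{1/2}x,|A|^{1/2}y)_{\mathcal{H}}$ for $x,y\in\operatorname{dom}(a)=\operatorname{dom}(|A|^{1/2})$, and $|u|_a=|a(u,u)|^{1/2}$. For a finite-dimensional subspace $F\subset\operatorname{dom}(a)$, $A_F:F\to F$ is defined by $(A_Fx,y)_{\mathcal{H}}=a(x,y)$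 for all $x,y\in F$; its spectrum $\Sigma(A_F)$ is the set of Ritz values of $A$ on $F$. $\Lambda_h=\Sigma(A_{E_h})$. $\|A_E\|$ is the operator norm of $A_E$ on $(E,\|\cdot\|_{\mathcal{H}})$. Assumption 4. $\mathcal{V}_h\subset\operatorname{dom}(a)$. Seminorm: $|(S-I)Q_h|_{a,E_h}=\sup_{0\ne v\in E_h}|(S-I)Q_hv|_a/\|v\|_{\mathcal{H}}$. Gap. For subspaces $M,L$ of $\mathcal{H}$, $\operatorname{gap}_{\mathcal{H}}(M,L)=\max\big[\sup_{x\in M,\|x\|_{\mathcal{H}}=1}\operatorname{dist}_{\mathcal{H}}(x,L),\ \sup_{x\in L,\|x\|_{\mathcal{H}}=1}\operatorname{dist}_{\mathcal{H}}(x,M)\big]$, where $\operatorname{dist}_{\mathcal{H}}(x,L)=\inf_{l\in L}\|x-l\|_{\mathcal{H}}$. Hausdorff distance. For $\Upsilon_1,\Upsilon_2\subset\mathbb{R}$, $\operatorname{dist}(\Upsilon_1,\Upsilon_2)=\max\big[\sup_{\mu_1\in\Upsilon_1}\operatorname{dist}(\mu_1,\Upsilon_2),\ \sup_{\mu_2\in\Upsilon_2}\operatorname{dist}(\mu_2,\Upsilon_1)\big]$ with $\operatorname{dist}(\mu,\Upsilon)=\inf_{\nu\in\Upsilon}|\mu-\nu|$. *)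

theory Defs
  imports "HOL-Complex_Analysis.Complex_Analysis"
begin

text \<open>The inner product is linear in the first argument. The norm axiom subsumes positive
  definiteness.\<close>

class complex_hilbert_space = banach +
  fixes scaleC :: "complex \<Rightarrow> 'a \<Rightarrow> 'a" (infixr \<open>*\<^sub>C\<close> 75)
    and cinner :: "'a \<Rightarrow> 'a \<Rightarrow> complex"
  assumes scaleR_scaleC: "r *\<^sub>R x = complex_of_real r *\<^sub>C x"
    and scaleC_add_right: "c *\<^sub>C (x + y) = c *\<^sub>C x + c *\<^sub>C y"
    and scaleC_add_left: "(c + d) *\<^sub>C x = c *\<^sub>C x + d *\<^sub>C x"
    and scaleC_scaleC: "c *\<^sub>C d *\<^sub>C x = (c * d) *\<^sub>C x"
    and scaleC_one: "1 *\<^sub>C x = x"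
    and cinner_commute: "cinner x y = cnj (cinner y x)"
    and cinner_add_left: "cinner (x + y) u = cinner x u + cinner y u"
    and cinner_scaleC_left: "cinner (c *\<^sub>C x) y = c * cinner x y"
    and cinner_self: "cinner x x = complex_of_real ((norm x)\<^sup>2)"

global_interpretation complex_vector:
  vector_space "scaleC :: complex \<Rightarrow> 'a \<Rightarrow> 'a::complex_hilbert_space"
  by unfold_locales (simp_all add: scaleC_add_right scaleC_add_left scaleC_scaleC scaleC_one)

definition findim_subspace :: "'a::complex_hilbert_space set \<Rightarrow> bool" where
  "findim_subspace F \<longleftrightarrow> (\<exists>B. finite B \<and> F = complex_vector.span B)"

definition orth_proj :: "'a::complex_hilbert_space set \<Rightarrow> 'a \<Rightarrow> 'a" where
  "orth_proj M x = (THE p. p \<in> M \<and> (\<forall>y\<in>M. cinner (x - p) y = 0))"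

definition gap :: "'a::complex_hilbert_space set \<Rightarrow> 'a set \<Rightarrow> real" where
  "gap M L = max (SUP x\<in>{x\<in>M. norm x = 1}. infdist x L) (SUP x\<in>{x\<in>L. norm x = 1}. infdist x M)"

definition hausdorff_distance :: "'a::metric_space set \<Rightarrow> 'a set \<Rightarrow> real" where
  "hausdorff_distance M L = max (SUP x\<in>M. infdist x L) (SUP x\<in>L. infdist x M)"


definition norm_of :: "('a \<Rightarrow> 'a \<Rightarrow> complex) \<Rightarrow> 'a \<Rightarrow> real" where
  "norm_of ip u = sqrt (Re (ip u u))"

definition hilbert_space_on ::
  "'a::complex_hilbert_space set \<Rightarrow> ('a \<Rightarrow> 'a \<Rightarrow> complex) \<Rightarrow> bool" where
  "hilbert_space_on V ip \<longleftrightarrow>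
     complex_vector.subspace V \<and>
     (\<forall>x\<in>V. \<forall>y\<in>V. ip x y = cnj (ip y x)) \<and>
     (\<forall>x\<in>V. \<forall>y\<in>V. \<forall>u\<in>V. ip (x + y) u = ip x u + ip y u) \<and>
     (\<forall>c. \<forall>x\<in>V. \<forall>y\<in>V. ip (c *\<^sub>C x) y = c * ip x y) \<and>
     (\<forall>x\<in>V. x \<noteq> 0 \<longrightarrow> 0 < Re (ip x x)) \<and>
     (\<forall>X. (\<forall>n. X n \<in> V) \<and>
          (\<forall>e>0. \<exists>M. \<forall>m\<ge>M. \<forall>n\<ge>M. norm_of ip (X m - X n) < e) \<longrightarrow>
          (\<exists>l\<in>V. (\<lambda>n::nat. norm_of ip (X n - l)) \<longlonglongrightarrow> 0))"

text \<open>In \<open>op_norm_on\<close> the vector \<open>0\<close> contributes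
  \<open>0 / 0 = 0\<close> to the supremum, as in the library constant \<open>onorm\<close>.\<close>

definition bounded_op_on :: "'a set \<Rightarrow> ('a \<Rightarrow> real) \<Rightarrow> ('a \<Rightarrow> 'a) \<Rightarrow> bool" where
  "bounded_op_on V nrm T \<longleftrightarrow> (\<forall>u\<in>V. T u \<in> V) \<and> (\<exists>B. \<forall>u\<in>V. nrm (T u) \<le> B * nrm u)"

definition op_norm_on :: "'a set \<Rightarrow> ('a \<Rightarrow> real) \<Rightarrow> ('a \<Rightarrow> 'a) \<Rightarrow> real" where
  "op_norm_on V nrm T = (SUP u\<in>V. nrm (T u) / nrm u)"


text \<open>An operator is a function \<open>T\<close> together with its domain \<open>D\<close>; values off the domain are
  irrelevant.  It acts in the space with carrier \<open>X\<close> and norm \<open>nrm\<close>, which is the whole type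
  for \<open>A\<close>, and a subspace for restrictions such as \<open>S_N\<close> on \<open>V\<close>.\<close>

definition resolvent :: "'a::complex_hilbert_space set \<Rightarrow> ('a \<Rightarrow> 'a) \<Rightarrow> complex \<Rightarrow> 'a \<Rightarrow> 'a" where
  "resolvent D T z = the_inv_into D (\<lambda>x. z *\<^sub>C x - T x)"

definition resolvent_set_in ::
  "'a::complex_hilbert_space set \<Rightarrow> ('a \<Rightarrow> real) \<Rightarrow> 'a set \<Rightarrow> ('a \<Rightarrow> 'a) \<Rightarrow> complex set" where
  "resolvent_set_in X nrm D T =
     {z. bij_betw (\<lambda>x. z *\<^sub>C x - T x) D X \<and> (\<exists>B. \<forall>y\<in>X. nrm (resolvent D T z y) \<le> B * nrm y)}"

definition spectrum_in ::
  "'a::complex_hilbert_space set \<Rightarrow> ('a \<Rightarrow> real) \<Rightarrow> 'a set \<Rightarrow> ('a \<Rightarrow> 'a) \<Rightarrow> complex set" where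
  "spectrum_in X nrm D T = - resolvent_set_in X nrm D T"

abbreviation resolvent_set where
  "resolvent_set D T \<equiv> resolvent_set_in UNIV norm D T"

abbreviation spectrum where
  "spectrum D T \<equiv> spectrum_in UNIV norm D T"

definition linear_op :: "'a::complex_hilbert_space set \<Rightarrow> ('a \<Rightarrow> 'a) \<Rightarrow> bool" where
  "linear_op D T \<longleftrightarrow> complex_vector.subspace D \<and>
     (\<forall>x\<in>D. \<forall>y\<in>D. T (x + y) = T x + T y) \<and> (\<forall>c. \<forall>x\<in>D. T (c *\<^sub>C x) = c *\<^sub>C T x)"

definition closed_op :: "'a::complex_hilbert_space set \<Rightarrow> ('a \<Rightarrow> 'a) \<Rightarrow> bool" where
  "closed_op D T \<longleftrightarrow> closed ((\<lambda>x. (x, T x)) ` D)"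

text \<open>The set in the third conjunct is the domain of the adjoint.\<close>

definition selfadjoint_op :: "'a::complex_hilbert_space set \<Rightarrow> ('a \<Rightarrow> 'a) \<Rightarrow> bool" where
  "selfadjoint_op D T \<longleftrightarrow> linear_op D T \<and> closure D = UNIV \<and>
     {y. \<exists>u. \<forall>x\<in>D. cinner (T x) y = cinner x u} = D \<and>
     (\<forall>x\<in>D. \<forall>y\<in>D. cinner (T x) y = cinner x (T y))"

definition possemidef_op :: "'a::complex_hilbert_space set \<Rightarrow> ('a \<Rightarrow> 'a) \<Rightarrow> bool" where
  "possemidef_op D T \<longleftrightarrow> selfadjoint_op D T \<and> (\<forall>x\<in>D. 0 \<le> Re (cinner (T x) x))"

definition eigenspace ::
  "'a::complex_hilbert_space set \<Rightarrow> ('a \<Rightarrow> 'a) \<Rightarrow> complex \<Rightarrow> 'a set" where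
  "eigenspace D T c = {x\<in>D. T x = c *\<^sub>C x}"


definition partial_isometry :: "('a::complex_hilbert_space \<Rightarrow> 'a) \<Rightarrow> bool" where
  "partial_isometry U \<longleftrightarrow> (\<forall>x. (\<forall>y. U y = 0 \<longrightarrow> cinner x y = 0) \<longrightarrow> norm (U x) = norm x)"

text \<open>\<open>A = U |A| = |A| U\<close> with \<open>P = |A|\<close>.  The domain of \<open>U P\<close> is that of \<open>P\<close>, hence \<open>P\<close> has the domain
  of \<open>A\<close>; that of \<open>P U\<close> is the preimage of it under \<open>U\<close>. The usual kernel condition is what makes
  \<open>U\<close> and \<open>P\<close> unique.\<close>

definition polar_decomposition ::
  "'a::complex_hilbert_space set \<Rightarrow> ('a \<Rightarrow> 'a) \<Rightarrow> ('a \<Rightarrow> 'a) \<Rightarrow> ('a \<Rightarrow> 'a) \<Rightarrow> bool" where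
  "polar_decomposition D A U P \<longleftrightarrow>
     selfadjoint_op UNIV U \<and> partial_isometry U \<and> possemidef_op D P \<and>
     {x. U x = 0} = {x\<in>D. P x = 0} \<and>
     (\<forall>x\<in>D. A x = U (P x)) \<and> {x. U x \<in> D} = D \<and> (\<forall>x\<in>D. A x = P (U x))"

text \<open>\<open>T\<close> with domain \<open>D'\<close> is the positive square root of \<open>P\<close> with domain \<open>D\<close>.\<close>

definition sqrt_op ::
  "'a::complex_hilbert_space set \<Rightarrow> ('a \<Rightarrow> 'a) \<Rightarrow> 'a set \<Rightarrow> ('a \<Rightarrow> 'a) \<Rightarrow> bool" where
  "sqrt_op D P D' T \<longleftrightarrow> possemidef_op D' T \<and> {x\<in>D'. T x \<in> D'} = D \<and> (\<forall>x\<in>D. T (T x) = P x)"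

definition form_of ::
  "('a::complex_hilbert_space \<Rightarrow> 'a) \<Rightarrow> ('a \<Rightarrow> 'a) \<Rightarrow> 'a \<Rightarrow> 'a \<Rightarrow> complex" where
  "form_of U T x y = cinner (U (T x)) (T y)"

definition form_seminorm :: "('a \<Rightarrow> 'a \<Rightarrow> complex) \<Rightarrow> 'a \<Rightarrow> real" where
  "form_seminorm a u = sqrt (cmod (a u u))"

definition form_op_seminorm ::
  "('a::complex_hilbert_space \<Rightarrow> 'a \<Rightarrow> complex) \<Rightarrow> 'a set \<Rightarrow> ('a \<Rightarrow> 'a) \<Rightarrow> real" where
  "form_op_seminorm a F B = (SUP v\<in>F - {0}. form_seminorm a (B v) / norm v)"

definition compression ::
  "('a::complex_hilbert_space \<Rightarrow> 'a \<Rightarrow> complex) \<Rightarrow> 'a set \<Rightarrow> 'a \<Rightarrow> 'a" where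
  "compression a F x = (THE u. u \<in> F \<and> (\<forall>y\<in>F. cinner u y = a x y))"

definition ritz_values ::
  "('a::complex_hilbert_space \<Rightarrow> 'a \<Rightarrow> complex) \<Rightarrow> 'a set \<Rightarrow> complex set" where
  "ritz_values a F = spectrum_in F norm F (compression a F)"


definition rat_filter :: "nat \<Rightarrow> (nat \<Rightarrow> complex) \<Rightarrow> (nat \<Rightarrow> complex) \<Rightarrow> complex \<Rightarrow> complex" where
  "rat_filter N w z \<xi> = w N + (\<Sum>k<N. w k * inverse (z k - \<xi>))"

definition filter_op ::
  "nat \<Rightarrow> (nat \<Rightarrow> complex) \<Rightarrow> (nat \<Rightarrow> complex) \<Rightarrow> (complex \<Rightarrow> 'a \<Rightarrow> 'a) \<Rightarrow>
   'a::complex_hilbert_space \<Rightarrow> 'a" where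
  "filter_op N w z R u = w N *\<^sub>C u + (\<Sum>k<N. w k *\<^sub>C R (z k) u)"

definition I_set :: "real \<Rightarrow> real \<Rightarrow> real set" where
  "I_set y \<gamma> = {x. \<bar>x - y\<bar> \<le> \<gamma>}"

definition O_set :: "real \<Rightarrow> real \<Rightarrow> real \<Rightarrow> real set" where
  "O_set y \<delta> \<gamma> = {x. \<bar>x - y\<bar> \<ge> (1 + \<delta>) * \<gamma>}"

text \<open>The supremum and infimum are extended reals, because \<open>r_N\<close> may have poles on the real line.
  The points \<open>z_k\<close> are left out, since division by zero gives \<open>r_N\<close> a spurious finite value there;
  this changes neither bound, as the rational function is continuous into the Riemann sphere and
  the two sets have no isolated points.\<close>

definition filter_sup :: "(complex \<Rightarrow> complex) \<Rightarrow> complex set \<Rightarrow> real set \<Rightarrow> ereal" where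
  "filter_sup r Z X = (SUP x\<in>{x\<in>X. complex_of_real x \<notin> Z}. ereal (cmod (r (complex_of_real x))))"

definition filter_inf :: "(complex \<Rightarrow> complex) \<Rightarrow> complex set \<Rightarrow> real set \<Rightarrow> ereal" where
  "filter_inf r Z X = (INF x\<in>{x\<in>X. complex_of_real x \<notin> Z}. ereal (cmod (r (complex_of_real x))))"

definition kappa_hat ::
  "nat \<Rightarrow> (nat \<Rightarrow> complex) \<Rightarrow> (nat \<Rightarrow> complex) \<Rightarrow> real \<Rightarrow> real \<Rightarrow> real \<Rightarrow> ereal" where
  "kappa_hat N w z y \<delta> \<gamma> =
     filter_sup (rat_filter N w z) (z ` {..<N}) (O_set y \<delta> \<gamma>) /
     filter_inf (rat_filter N w z) (z ` {..<N}) (I_set y \<gamma>)"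

text \<open>The supremum of moduli is \<open>0\<close> over the empty set.\<close>

definition sup_modulus :: "complex set \<Rightarrow> real" where
  "sup_modulus M = Sup (insert 0 (cmod ` M))"


definition rectifiable_path :: "(real \<Rightarrow> complex) \<Rightarrow> bool" where
  "rectifiable_path g \<longleftrightarrow> path g \<and>
     (\<exists>L. \<forall>d. d division_of {0..1} \<longrightarrow> (\<Sum>K\<in>d. cmod (g (Sup K) - g (Inf K))) \<le> L)"

text \<open>Positively oriented parametrization of a simple rectifiable closed curve.\<close>

definition rectifiable_jordan_curve :: "(real \<Rightarrow> complex) \<Rightarrow> bool" where
  "rectifiable_jordan_curve g \<longleftrightarrow>
     simple_path g \<and> pathfinish g = pathstart g \<and> rectifiable_path g \<and>
     (\<forall>p\<in>inside (path_image g). winding_number g p = 1)"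

text \<open>The integral is the limit of Riemann-Stieltjes sums in the
  operator norm of \<open>(V, nrm)\<close>. The library's contour integral is for scalar functions and involves
  the derivative of the path, which a rectifiable path need not have.\<close>

definition has_op_contour_integral ::
  "'a::complex_hilbert_space set \<Rightarrow> ('a \<Rightarrow> real) \<Rightarrow> (complex \<Rightarrow> 'a \<Rightarrow> 'a) \<Rightarrow> ('a \<Rightarrow> 'a) \<Rightarrow>
   (real \<Rightarrow> complex) \<Rightarrow> bool" where
  "has_op_contour_integral V nrm F J g \<longleftrightarrow>
     (\<forall>u\<in>V. J u \<in> V) \<and>
     (\<forall>e>0. \<exists>d>0. \<forall>p. p tagged_division_of {0..1} \<and> (\<lambda>t. ball t d) fine p \<longrightarrow>
        (\<forall>u\<in>V. nrm ((\<Sum>(t, K)\<in>p. (g (Sup K) - g (Inf K)) *\<^sub>C F (g t) u) - J u) \<le> e * nrm u))"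

definition op_contour_integral ::
  "'a::complex_hilbert_space set \<Rightarrow> ('a \<Rightarrow> real) \<Rightarrow> (complex \<Rightarrow> 'a \<Rightarrow> 'a) \<Rightarrow>
   (real \<Rightarrow> complex) \<Rightarrow> 'a \<Rightarrow> 'a" where
  "op_contour_integral V nrm F g u = (THE v. \<exists>J. has_op_contour_integral V nrm F J g \<and> v = J u)"

definition riesz_projection ::
  "'a::complex_hilbert_space set \<Rightarrow> ('a \<Rightarrow> real) \<Rightarrow> ('a \<Rightarrow> 'a) \<Rightarrow> (real \<Rightarrow> complex) \<Rightarrow> 'a \<Rightarrow> 'a" where
  "riesz_projection V nrm T g u =
     (1 / (2 * of_real pi * \<i>)) *\<^sub>C op_contour_integral V nrm (resolvent V T) g u"

end

theory Submission
  imports Defs "HOL-Computational_Algebra.Fundamental_Theorem_Algebra"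
begin

text \<open>The Ritz values on \<open>E\<close> are the elements of \<open>\<Lambda>\<close>, so two finite-dimensional spaces are compared.
  The argument has an analytic part, which says that \<open>S\<close> maps \<open>E\<^sub>h\<close> bijectively onto \<open>E\<close> when \<open>h\<close> is
  small, and an algebraic part, which turns this into the estimate, with \<open>C\<^sub>0 = 1\<close>.

  Algebraic part (\<open>hausdorff_distance_ritz_values\<close>).  As \<open>E\<close> is spanned by eigenvectors, it reduces the
  form: \<open>a(e, d) = (A e, d) = 0\<close> for \<open>e\<close> in \<open>E\<close> and \<open>d\<close> orthogonal to \<open>E\<close>.  Hence
  \<open>a(v, v) = a(S v, S v) + a(v - S v, v - S v)\<close>, and the Rayleigh quotients of \<open>v\<close> and \<open>S v\<close> differ by at
  most \<open>\<Delta> = s\<^sup>2 + \<parallel>A\<^sub>E\<parallel> g\<^sup>2\<close>, where \<open>s\<close> is the seminorm and \<open>g\<close> the gap of the statement.  Suppose that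
  an eigenvalue \<open>\<mu>\<close> of the form on one of the two spaces were farther than \<open>\<Delta>\<close> from all eigenvalues on
  the other one.  Transport an eigenvector for \<open>\<mu>\<close> to the other space by \<open>S\<close> or its inverse, split it
  there into spectral components above and below \<open>\<mu>\<close>, and transport these back.  The form \<open>a - \<mu>\<close> is
  still positive on the one and negative on the other part, although their sum is in its kernel, so both
  parts vanish.

  Analytic part (\<open>approximate_eigenspace\<close>).  Let \<open>P\<close> and \<open>P\<^sub>h\<close> be the contour integrals for \<open>S\<^sub>N\<close> and
  \<open>S\<^sub>N\<^sup>h\<close>.  The Neumann series makes resolvents, and hence these integrals, depend continuously on
  the operator, so \<open>P\<^sub>h\<close> tends to \<open>P\<close> in the operator norm of \<open>V\<close> (\<open>P_perturbation\<close>).  Moreover \<open>P\<close> is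
  the restriction of \<open>S\<close> to \<open>V\<close> (\<open>riesz_projection_eq\<close>): on eigenvectors in \<open>E\<close> the integral is a winding
  number, and on the complement \<open>S\<^sub>N\<close> has the same resolvent as \<open>S\<^sub>N(1 - S)\<close>, which has no spectrum inside
  the curve.  The last fact needs that an eigenvector of \<open>S\<^sub>N\<close> for a value \<open>r(\<lambda>)\<close>, \<open>\<lambda>\<close> in \<open>\<Lambda>\<close>, lies
  in \<open>E\<close> (\<open>filter_eigenvector_in_E\<close>) and that a point of the spectrum there is an eigenvalue; the
  latter is the Fredholm alternative (\<open>fredholm_alternative\<close>), which applies because \<open>S\<^sub>N - w\<^sub>N\<close> is the
  limit of the finite-rank operators \<open>S\<^sub>N\<^sup>h - w\<^sub>N\<close>.  Finally \<open>P\<^sub>h\<close> is idempotent (\<open>P_idempotent\<close>), so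
  that it fixes \<open>E\<^sub>h\<close>, and \<open>v - S v = P\<^sub>h v - P v\<close> is small for \<open>v\<close> in \<open>E\<^sub>h\<close>.

  The curve is merely rectifiable.  Riemann-Stieltjes sums of a holomorphic function along it are compared,
  by local primitives, with the contour integral along one nearby polynomial loop
  (\<open>rs_sum_approximates_contour_integral\<close>).  Operator-valued integrals are treated by pairing the
  resolvent with vectors of \<open>V\<close>; from then on Cauchy's theory of scalar functions applies.\<close>

section \<open>Complex Hilbert spaces\<close>

global_interpretation complex_vector_pair:
  vector_space_pair "scaleC :: complex \<Rightarrow> 'a \<Rightarrow> 'a::complex_hilbert_space"
    "scaleC :: complex \<Rightarrow> 'b \<Rightarrow> 'b::complex_hilbert_space" ..

lemmas scaleC_simps [simp] = complex_vector.scale_zero_left complex_vector.scale_zero_right scaleC_one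
  scaleC_scaleC

lemma cinner_add_right: "cinner x (y + z) = cinner x y + cinner x z"
  by (metis cinner_add_left cinner_commute complex_cnj_add)

lemma cinner_scaleC_right: "cinner x (c *\<^sub>C y) = cnj c * cinner x y"
  by (metis cinner_scaleC_left cinner_commute complex_cnj_mult)

lemma cinner_zero_left [simp]: "cinner 0 x = 0"
  using cinner_scaleC_left[of 0 0 x] by simp

lemma cinner_zero_right [simp]: "cinner x 0 = 0"
  using cinner_scaleC_right[of x 0 0] by simp

lemma scaleC_minus1: "(- 1) *\<^sub>C x = - x"
  by (metis complex_vector.scale_minus_left scaleC_one)

lemma cinner_minus_left [simp]: "cinner (- x) y = - cinner x y"
  by (metis cinner_scaleC_left mult_minus1 scaleC_minus1)

lemma cinner_minus_right [simp]: "cinner x (- y) = - cinner x y"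
  by (metis cinner_commute cinner_minus_left complex_cnj_minus)

lemma cinner_diff_left: "cinner (x - y) z = cinner x z - cinner y z"
  using cinner_add_left[of x "- y" z] by simp

lemma cinner_diff_right: "cinner x (y - z) = cinner x y - cinner x z"
  using cinner_add_right[of x y "- z"] by simp

lemmas cinner_algebra = cinner_add_left cinner_add_right cinner_diff_left cinner_diff_right
  cinner_scaleC_left cinner_scaleC_right

lemma cinner_sum_left: "cinner (sum f I) y = (\<Sum>i\<in>I. cinner (f i) y)"
  by (induction I rule: infinite_finite_induct) (auto simp: cinner_add_left)

lemma cinner_self_eq_0 [simp]: "cinner x x = 0 \<longleftrightarrow> x = 0"
  by (simp add: cinner_self)

lemma Re_cinner_self: "Re (cinner x x) = (norm x)\<^sup>2"
  by (simp add: cinner_self)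

lemma norm_scaleC [simp]: "norm (c *\<^sub>C x) = cmod c * norm x"
proof -
  have "complex_of_real ((norm (c *\<^sub>C x))\<^sup>2) = c * cnj c * complex_of_real ((norm x)\<^sup>2)"
    by (simp only: cinner_self [symmetric] cinner_scaleC_left cinner_scaleC_right mult.assoc)
    (simp add: mult_ac)
  also have "\<dots> = complex_of_real ((cmod c * norm x)\<^sup>2)"
    by (simp only: complex_norm_square [symmetric] power_mult_distrib of_real_mult)
  finally have "(norm (c *\<^sub>C x))\<^sup>2 = (cmod c * norm x)\<^sup>2"
    using of_real_eq_iff by blast
  then show ?thesis by (simp add: power2_eq_iff_nonneg)
qed

lemma norm_add_sq: "(norm (x + y))\<^sup>2 = (norm x)\<^sup>2 + (norm y)\<^sup>2 + 2 * Re (cinner x y)"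
proof -
  have "Re (cinner y x) = Re (cinner x y)"
    by (subst cinner_commute) simp
  then show ?thesis
    unfolding Re_cinner_self[symmetric] by (simp add: cinner_add_left cinner_add_right)
qed

lemma pythagoras: "cinner x y = 0 \<Longrightarrow> (norm (x + y))\<^sup>2 = (norm x)\<^sup>2 + (norm y)\<^sup>2"
  by (simp add: norm_add_sq)

lemma cauchy_schwarz: "cmod (cinner x y) \<le> norm x * norm y"
proof (cases "y = 0")
  case False
  define c where "c = cinner x y / cinner y y"
  have "cinner (x - c *\<^sub>C y) (c *\<^sub>C y) = 0"
    using False by (simp add: c_def cinner_algebra)
  from pythagoras[OF this] have "(norm (c *\<^sub>C y))\<^sup>2 \<le> (norm x)\<^sup>2" by simp
  then have "cmod c * norm y \<le> norm x"
    by (metis norm_scaleC norm_ge_zero power2_le_imp_le)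
  moreover have "cmod c * norm y = cmod (cinner x y) / norm y"
    using False by (simp add: c_def norm_divide cinner_self norm_mult power2_eq_square)
  ultimately show ?thesis
    using False by (simp add: divide_le_eq)
qed simp

section \<open>Finite-dimensional subspaces\<close>

abbreviation complex_linear :: "('a::complex_hilbert_space \<Rightarrow> 'a) \<Rightarrow> bool" where
  "complex_linear \<equiv> Vector_Spaces.linear scaleC scaleC"

definition orthonormal :: "'a::complex_hilbert_space set \<Rightarrow> bool" where
  "orthonormal B \<longleftrightarrow> (\<forall>b\<in>B. \<forall>b'\<in>B. cinner b b' = (if b = b' then 1 else 0))"

lemma orthonormal_insert:
  assumes "orthonormal B" "norm u = 1" "\<And>b. b \<in> B \<Longrightarrow> cinner u b = 0"
  shows "orthonormal (insert u B)"
proof -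
  have "cinner b u = 0" if "b \<in> B" for b
    using assms(3)[OF that] cinner_commute[of b u] by simp
  moreover have "u \<notin> B" using assms(2) assms(3)[of u] by (auto simp: cinner_self)
  ultimately show ?thesis
    using assms by (auto simp: orthonormal_def cinner_self)
qed

lemma cinner_orthonormal_sum:
  assumes "orthonormal B" "finite B" "b \<in> B"
  shows "cinner (\<Sum>b\<in>B. f b *\<^sub>C b) b = f b"
proof -
  have "cinner (\<Sum>b\<in>B. f b *\<^sub>C b) b = (\<Sum>b'\<in>B. if b' = b then f b else 0)"
    unfolding cinner_sum_left
    by (rule sum.cong) (use assms in \<open>auto simp: cinner_scaleC_left orthonormal_def\<close>)
  then show ?thesis using assms by simp
qed

definition basis_proj :: "'a::complex_hilbert_space set \<Rightarrow> 'a \<Rightarrow> 'a" where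
  "basis_proj B x = (\<Sum>b\<in>B. cinner x b *\<^sub>C b)"

lemma basis_proj_in: "basis_proj B x \<in> complex_vector.span B"
  unfolding basis_proj_def
  by (intro complex_vector.span_sum complex_vector.span_scale complex_vector.span_base)

lemma basis_proj_orth:
  assumes "orthonormal B" "finite B" "y \<in> complex_vector.span B"
  shows "cinner (x - basis_proj B x) y = 0"
  using assms(3)
proof (induction rule: complex_vector.span_induct_alt)
  case (step c b y)
  then show ?case
    using cinner_orthonormal_sum[OF assms(1,2) \<open>b \<in> B\<close>, of "cinner x"]
    by (simp add: cinner_algebra basis_proj_def)
qed simp

lemma basis_proj_id:
  assumes "orthonormal B" "finite B" "x \<in> complex_vector.span B"
  shows "basis_proj B x = x"
proof -
  have "x - basis_proj B x \<in> complex_vector.span B"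
    by (intro complex_vector.span_diff assms basis_proj_in)
  from basis_proj_orth[OF assms(1,2) this, of x] show ?thesis by simp
qed

text \<open>Gram--Schmidt.\<close>

lemma ex_orthonormal_basis:
  assumes "findim_subspace F"
  obtains B where "finite B" "orthonormal B" "complex_vector.span B = F"
proof -
  obtain B0 where "finite B0" and F: "F = complex_vector.span B0"
    using assms by (auto simp: findim_subspace_def)
  have "\<exists>B. finite B \<and> orthonormal B \<and> complex_vector.span B = complex_vector.span B0"
    using \<open>finite B0\<close>
  proof (induction B0 rule: finite_induct)
    case empty
    show ?case by (intro exI[of _ "{}"]) (auto simp: orthonormal_def)
  next
    case (insert x B0)
    then obtain B where B: "finite B" "orthonormal B"
      "complex_vector.span B = complex_vector.span B0" by blast
    define v where "v = x - basis_proj B x"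
    have in_span: "basis_proj B x \<in> complex_vector.span B"
      by (rule basis_proj_in)
    show ?case
    proof (cases "v = 0")
      case True
      then have "x \<in> complex_vector.span B0"
        using in_span B(3) by (simp add: v_def)
      then have "complex_vector.span (insert x B0) = complex_vector.span B0"
        by (simp add: complex_vector.span_redundant)
      with B show ?thesis by blast
    next
      case False
      define u where "u = complex_of_real (1 / norm v) *\<^sub>C v"
      have "norm u = 1" using False by (simp add: u_def norm_divide)
      moreover have "cinner u b = 0" if "b \<in> B" for b
        using basis_proj_orth[OF B(2,1) complex_vector.span_base[OF that], of x]
        by (simp add: u_def v_def cinner_scaleC_left)
      ultimately have "orthonormal (insert u B)"
        by (rule orthonormal_insert[OF B(2)])
      moreover have "complex_vector.span (insert u B) = complex_vector.span (insert x B0)"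
      proof (rule antisym)
        have "B \<subseteq> complex_vector.span (insert x B0)"
          by (metis B(3) complex_vector.span_mono complex_vector.span_superset order_trans
              subset_insertI)
        moreover have "u \<in> complex_vector.span (insert x B0)"
          unfolding u_def v_def
          by (intro complex_vector.span_scale complex_vector.span_diff)
            (use in_span B(3) complex_vector.span_mono[of B0 "insert x B0"] in
              \<open>auto intro: complex_vector.span_base\<close>)
        ultimately show "complex_vector.span (insert u B) \<subseteq> complex_vector.span (insert x B0)"
          by (intro complex_vector.span_minimal complex_vector.subspace_span) auto
        have mono: "complex_vector.span B \<subseteq> complex_vector.span (insert u B)"
          by (intro complex_vector.span_mono) auto
        have "x = complex_of_real (norm v) *\<^sub>C u + basis_proj B x"
          using False by (simp add: u_def v_def)
        also have "\<dots> \<in> complex_vector.span (insert u B)"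
          by (intro complex_vector.span_add complex_vector.span_scale)
            (use in_span mono in \<open>auto intro: complex_vector.span_base\<close>)
        finally have "x \<in> complex_vector.span (insert u B)" .
        moreover have "B0 \<subseteq> complex_vector.span (insert u B)"
          using B(3) mono complex_vector.span_superset[of B0] by auto
        ultimately show "complex_vector.span (insert x B0) \<subseteq> complex_vector.span (insert u B)"
          by (intro complex_vector.span_minimal complex_vector.subspace_span) auto
      qed
      ultimately show ?thesis
        using B(1) by (intro exI[of _ "insert u B"]) simp
    qed
  qed
  with F that show thesis by blast
qed

lemma findim_subspaceD: "findim_subspace F \<Longrightarrow> complex_vector.subspace F"
  by (auto simp: findim_subspace_def)

lemma orth_proj_unique:
  assumes "complex_vector.subspace M" "p \<in> M" "\<And>y. y \<in> M \<Longrightarrow> cinner (x - p) y = 0"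
  shows "orth_proj M x = p"
  unfolding orth_proj_def
proof (rule the_equality)
  fix q assume q: "q \<in> M \<and> (\<forall>y\<in>M. cinner (x - q) y = 0)"
  then have "q - p \<in> M" using assms complex_vector.subspace_diff by blast
  then have "cinner (x - p) (q - p) - cinner (x - q) (q - p) = 0"
    using q assms(3) by simp
  then have "cinner (q - p) (q - p) = 0"
    by (simp add: cinner_diff_left)
  then show "q = p" by simp
qed (use assms in auto)

lemma orth_proj_basis:
  assumes "finite B" "orthonormal B"
  shows "orth_proj (complex_vector.span B) x = basis_proj B x"
  by (rule orth_proj_unique) (use assms in \<open>auto intro: basis_proj_in basis_proj_orth\<close>)

lemma
  assumes "findim_subspace F"
  shows orth_proj_in: "orth_proj F x \<in> F"
    and orth_proj_orth: "y \<in> F \<Longrightarrow> cinner (x - orth_proj F x) y = 0"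
    and orth_proj_id: "x \<in> F \<Longrightarrow> orth_proj F x = x"
    and orth_proj_linear: "complex_linear (orth_proj F)"
    and norm_orth_proj_sq: "(norm x)\<^sup>2 = (norm (orth_proj F x))\<^sup>2 + (norm (x - orth_proj F x))\<^sup>2"
    and norm_orth_proj_le: "norm (orth_proj F x) \<le> norm x"
    and infdist_findim: "infdist x F = norm (x - orth_proj F x)"
proof -
  obtain B where B: "finite B" "orthonormal B" and F: "complex_vector.span B = F"
    using ex_orthonormal_basis[OF assms] .
  have eq: "orth_proj F = basis_proj B" using orth_proj_basis[OF B] F by auto
  show inF: "orth_proj F x \<in> F" using basis_proj_in F eq by auto
  show orth: "cinner (x - orth_proj F x) y = 0" if "y \<in> F" for y
    using basis_proj_orth[OF B(2,1)] F eq that by auto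
  show "x \<in> F \<Longrightarrow> orth_proj F x = x"
    using basis_proj_id[OF B(2,1)] F eq by auto
  show "complex_linear (orth_proj F)"
    unfolding eq basis_proj_def
    by (unfold_locales)
      (simp_all add: cinner_algebra scaleC_add_left sum.distrib complex_vector.scale_sum_right
        scaleC_add_right)
  have pyth: "(norm (x - l))\<^sup>2 = (norm (x - orth_proj F x))\<^sup>2 + (norm (orth_proj F x - l))\<^sup>2"
    if "l \<in> F" for l
    using pythagoras[of "x - orth_proj F x" "orth_proj F x - l"]
      orth[of "orth_proj F x - l"] inF that complex_vector.subspace_diff[OF findim_subspaceD[OF
          assms]]
    by simp
  show "(norm x)\<^sup>2 = (norm (orth_proj F x))\<^sup>2 + (norm (x - orth_proj F x))\<^sup>2"
    using pyth[of 0] complex_vector.subspace_0[OF findim_subspaceD[OF assms]] by simp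
  then have "(norm (orth_proj F x))\<^sup>2 \<le> (norm x)\<^sup>2" by simp
  then show "norm (orth_proj F x) \<le> norm x" by (rule power2_le_imp_le) simp
  have "norm (x - orth_proj F x) \<le> dist x l" if "l \<in> F" for l
    unfolding dist_norm by (rule power2_le_imp_le) (simp_all add: pyth[OF that])
  moreover have "F \<noteq> {}" using inF by auto
  ultimately have "norm (x - orth_proj F x) \<le> infdist x F"
    by (simp add: infdist_notempty cINF_greatest)
  moreover have "infdist x F \<le> norm (x - orth_proj F x)"
    using infdist_le[OF inF] by (simp add: dist_norm)
  ultimately show "infdist x F = norm (x - orth_proj F x)" by simp
qed

lemma orth_proj_symmetric:
  assumes "findim_subspace F"
  shows "cinner (orth_proj F x) y = cinner x (orth_proj F y)"
proof -
  have "cinner (x - orth_proj F x) (orth_proj F y) = 0"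
    by (intro orth_proj_orth assms orth_proj_in)
  moreover have "cinner (y - orth_proj F y) (orth_proj F x) = 0"
    by (intro orth_proj_orth assms orth_proj_in)
  then have "cinner (orth_proj F x) (y - orth_proj F y) = 0"
    using cinner_commute[of "orth_proj F x" "y - orth_proj F y"] by simp
  ultimately show ?thesis by (simp add: cinner_algebra)
qed

lemma linear_op_props:
  assumes "linear_op F T"
  shows linear_op_subspace: "complex_vector.subspace F"
    and linear_op_add: "x \<in> F \<Longrightarrow> y \<in> F \<Longrightarrow> T (x + y) = T x + T y"
    and linear_op_scale: "x \<in> F \<Longrightarrow> T (c *\<^sub>C x) = c *\<^sub>C T x"
    and linear_op_zero: "T 0 = 0"
    and linear_op_diff: "x \<in> F \<Longrightarrow> y \<in> F \<Longrightarrow> T (x - y) = T x - T y"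
proof -
  show sub: "complex_vector.subspace F" and add: "\<And>x y. x \<in> F \<Longrightarrow> y \<in> F \<Longrightarrow> T (x + y) = T x + T y"
    and scale: "\<And>c x. x \<in> F \<Longrightarrow> T (c *\<^sub>C x) = c *\<^sub>C T x"
    using assms by (auto simp: linear_op_def)
  show "T 0 = 0" using scale[of 0 0] complex_vector.subspace_0[OF sub] by simp
  show "T (x - y) = T x - T y" if "x \<in> F" "y \<in> F"
    using add[OF that(1), of "(-1) *\<^sub>C y"] scale[OF that(2), of "-1"]
      complex_vector.subspace_scale[OF sub that(2), of "-1"] by (simp add: scaleC_minus1)
qed

lemma linear_op_sum:
  assumes "linear_op F T" "\<And>i. i \<in> I \<Longrightarrow> f i \<in> F"
  shows "T (sum f I) = (\<Sum>i\<in>I. T (f i))"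
  using assms(2)
proof (induction I rule: infinite_finite_induct)
  case (insert i I)
  then show ?case
    using linear_op_add[OF assms(1), of "f i" "sum f I"]
      complex_vector.subspace_sum[OF linear_op_subspace[OF assms(1)], of I f] by auto
qed (use linear_op_zero[OF assms(1)] in auto)

text \<open>Gives operators that are linear only on \<open>F\<close> access to the theory of linear maps on the whole
  space.\<close>

lemma linear_op_extend:
  assumes "findim_subspace F" "linear_op F T"
  shows "complex_linear (\<lambda>x. T (orth_proj F x))"
proof -
  interpret P: Vector_Spaces.linear scaleC scaleC "orth_proj F"
    by (rule orth_proj_linear[OF assms(1)])
  show ?thesis
    by unfold_locales
      (simp_all add: P.add P.scale linear_op_add[OF assms(2)] linear_op_scale[OF assms(2)]
        orth_proj_in[OF assms(1)])
qed

lemma findim_subspace_subset: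
  assumes "findim_subspace F" "complex_vector.subspace M" "M \<subseteq> F"
  shows "findim_subspace M"
proof -
  obtain B0 where "finite B0" and F: "F = complex_vector.span B0"
    using assms by (auto simp: findim_subspace_def)
  obtain B where B: "B \<subseteq> M" "complex_vector.independent B" "M \<subseteq> complex_vector.span B"
    using complex_vector.basis_exists[of M] by metis
  have "finite B"
    using complex_vector.independent_span_bound[OF \<open>finite B0\<close> B(2)] B(1) assms(3) F by auto
  moreover have "M = complex_vector.span B"
    using B complex_vector.span_minimal[OF B(1) assms(2)] by auto
  ultimately show ?thesis by (auto simp: findim_subspace_def)
qed

lemma findim_subspace_image:
  assumes "findim_subspace F" "linear_op F T"
  shows "findim_subspace (T ` F)"
proof -
  obtain B where B: "finite B" and F: "F = complex_vector.span B"
    using assms by (auto simp: findim_subspace_def)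
  interpret T: Vector_Spaces.linear scaleC scaleC "\<lambda>x. T (orth_proj F x)"
    by (rule linear_op_extend[OF assms])
  have "T ` F = (\<lambda>x. T (orth_proj F x)) ` complex_vector.span B"
    unfolding F[symmetric] by (intro image_cong) (auto simp: orth_proj_id[OF assms(1)])
  also have "\<dots> = complex_vector.span ((\<lambda>x. T (orth_proj F x)) ` B)"
    by (simp add: T.span_image)
  finally show ?thesis using B by (auto simp: findim_subspace_def)
qed

lemma inj_on_linear_op:
  assumes "linear_op F T" "\<And>x. x \<in> F \<Longrightarrow> T x = 0 \<Longrightarrow> x = 0"
  shows "inj_on T F"
proof (rule inj_onI)
  fix x y assume "x \<in> F" "y \<in> F" "T x = T y"
  then have "x - y = 0"
    using assms(2)[of "x - y"] linear_op_diff[OF assms(1)] 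
      complex_vector.subspace_diff[OF linear_op_subspace[OF assms(1)]] by simp
  then show "x = y" by simp
qed

text \<open>An injective image of a basis stays independent, so it is no larger than a spanning set of the
  target.  This bounds the dimension of a subspace that is not yet known to have one.\<close>

lemma findim_subspace_inj:
  assumes "linear_op F T" "\<And>x. x \<in> F \<Longrightarrow> T x = 0 \<Longrightarrow> x = 0" "complex_linear T"
    "T ` F \<subseteq> E" "findim_subspace E"
  shows "findim_subspace F"
proof -
  interpret T: Vector_Spaces.linear scaleC scaleC T by (rule assms)
  obtain B0 where "finite B0" and E: "E = complex_vector.span B0"
    using assms by (auto simp: findim_subspace_def)
  have sub: "complex_vector.subspace F" by (rule linear_op_subspace[OF assms(1)])
  obtain B where B: "B \<subseteq> F" "complex_vector.independent B" "F \<subseteq> complex_vector.span B"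
    using complex_vector.basis_exists[of F] by metis
  have F: "F = complex_vector.span B"
    using B complex_vector.span_minimal[OF B(1) sub] by auto
  have inj: "inj_on T (complex_vector.span B)"
    using inj_on_linear_op[OF assms(1,2)] F by simp
  then have "complex_vector.independent (T ` B)"
    using T.independent_inj_on_image B(2) by blast
  then have "finite (T ` B)"
    using complex_vector.independent_span_bound[OF \<open>finite B0\<close>, of "T ` B"] B(1) assms(4) E by auto
  moreover have "inj_on T B"
    by (rule inj_on_subset[OF inj complex_vector.span_superset])
  ultimately have "finite B" using finite_imageD by blast
  with F show ?thesis by (auto simp: findim_subspace_def)
qed

text \<open>An injective map takes a basis \<open>B\<close> to \<open>card B\<close> independent vectors; a vector outside the range
  would be independent of them, one too many for the span of \<open>B\<close>.\<close>

lemma findim_inj_imp_surj: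
  assumes "findim_subspace F" "linear_op F T" "\<And>x. x \<in> F \<Longrightarrow> T x \<in> F"
    "\<And>x. x \<in> F \<Longrightarrow> T x = 0 \<Longrightarrow> x = 0"
  shows "T ` F = F"
proof (rule ccontr)
  assume "T ` F \<noteq> F"
  then obtain y where y: "y \<in> F" "y \<notin> T ` F" using assms(3) by auto
  let ?T = "\<lambda>x. T (orth_proj F x)"
  interpret T: Vector_Spaces.linear scaleC scaleC ?T
    by (rule linear_op_extend[OF assms(1,2)])
  have sub: "complex_vector.subspace F" by (rule findim_subspaceD[OF assms(1)])
  obtain B0 where "finite B0" and F0: "F = complex_vector.span B0"
    using assms by (auto simp: findim_subspace_def)
  obtain B where B: "B \<subseteq> F" "complex_vector.independent B" "F \<subseteq> complex_vector.span B"
    using complex_vector.basis_exists[of F] by metis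
  have F: "F = complex_vector.span B"
    using B complex_vector.span_minimal[OF B(1) sub] by auto
  have "finite B"
    using complex_vector.independent_span_bound[OF \<open>finite B0\<close> B(2)] B(1) F0 by auto
  have inj: "inj_on ?T (complex_vector.span B)"
    unfolding F[symmetric] using inj_on_linear_op[OF assms(2,4)]
    by (simp add: inj_on_def orth_proj_id[OF assms(1)])
  have ind: "complex_vector.independent (?T ` B)"
    using T.independent_inj_on_image B(2) inj by blast
  have img: "?T ` F = T ` F"
    by (intro image_cong) (auto simp: orth_proj_id[OF assms(1)])
  have span: "complex_vector.span (?T ` B) = T ` F"
    using T.span_image[of B] F img by simp
  have card: "card (?T ` B) = card B"
    by (rule card_image[OF inj_on_subset[OF inj complex_vector.span_superset]])
  have "complex_vector.independent (insert y (?T ` B))"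
    using ind y(2) span by (simp add: complex_vector.independent_insert)
  moreover have "insert y (?T ` B) \<subseteq> complex_vector.span B"
    unfolding F[symmetric] using y(1) assms(3) B(1) orth_proj_id[OF assms(1)] by auto
  ultimately have "card (insert y (?T ` B)) \<le> card B"
    using complex_vector.independent_span_bound[OF \<open>finite B\<close>] by simp
  moreover have "y \<notin> ?T ` B"
    using y(2) span complex_vector.span_base[of y "?T ` B"] by auto
  ultimately show False
    using card \<open>finite B\<close> by simp
qed

section \<open>Hermitian forms on finite-dimensional subspaces\<close>

text \<open>The orbit \<open>v, T v, T\<^sup>2 v, \<dots>\<close> is dependent, so some polynomial \<open>p \<noteq> 0\<close> satisfies \<open>p(T) v = 0\<close>.
  Take one of least degree and split off a root, \<open>p = (X - c) q\<close>: then \<open>q(T) v\<close> is an eigenvector, nonzero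
  by minimality.\<close>

lemma ex_eigenvector:
  assumes "findim_subspace F" "linear_op F T" "\<And>x. x \<in> F \<Longrightarrow> T x \<in> F" "F \<noteq> {0}"
  obtains x c where "x \<in> F" "x \<noteq> 0" "T x = c *\<^sub>C x"
proof -
  have sub: "complex_vector.subspace F" by (rule findim_subspaceD[OF assms(1)])
  obtain B0 where "finite B0" and F0: "F = complex_vector.span B0"
    using assms by (auto simp: findim_subspace_def)
  obtain v where v: "v \<in> F" "v \<noteq> 0"
    using assms(4) complex_vector.subspace_0[OF sub] by blast
  define u where "u i = (T ^^ i) v" for i
  have u_in: "u i \<in> F" for i
    by (induction i) (use v assms(3) in \<open>auto simp: u_def\<close>)
  \<comment> \<open>\<open>pv p\<close> is \<open>p(T) v\<close>\<close>
  define pv where "pv p = (\<Sum>i\<le>degree p. coeff p i *\<^sub>C u i)" for p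
  have pv_eq: "pv p = (\<Sum>i\<le>n. coeff p i *\<^sub>C u i)" if "degree p \<le> n" for p n
    unfolding pv_def by (rule sum.mono_neutral_left) (use that in \<open>auto simp: coeff_eq_0\<close>)
  have pv_in: "pv p \<in> F" for p
    unfolding pv_def by (intro complex_vector.subspace_sum sub complex_vector.subspace_scale u_in)
  have pv_pCons: "pv (pCons 0 q) = T (pv q)" for q
  proof -
    have "pv (pCons 0 q) = (\<Sum>i\<le>Suc (degree q). coeff (pCons 0 q) i *\<^sub>C u i)"
      by (rule pv_eq) (simp add: degree_pCons_le)
    also have "\<dots> = (\<Sum>i\<le>degree q. coeff q i *\<^sub>C T (u i))"
      by (subst sum.atMost_Suc_shift) (simp add: u_def)
    also have "\<dots> = (\<Sum>i\<le>degree q. T (coeff q i *\<^sub>C u i))"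
      by (simp add: linear_op_scale[OF assms(2) u_in])
    also have "\<dots> = T (pv q)"
      unfolding pv_def
      by (rule linear_op_sum[OF assms(2), symmetric]) (intro complex_vector.subspace_scale sub u_in)
    finally show ?thesis .
  qed
  have pv_diff: "pv (p - smult c q) = pv p - c *\<^sub>C pv q" for p q c
  proof -
    define n where "n = max (degree p) (degree q)"
    have n: "degree p \<le> n" "degree q \<le> n" by (auto simp: n_def)
    then have "degree (p - smult c q) \<le> n"
      by (meson degree_diff_le degree_smult_le order_trans)
    then show ?thesis
      by (simp add: pv_eq[of _ n] n sum_subtractf complex_vector.scale_sum_right
          complex_vector.scale_left_diff_distrib)
  qed
  have "\<exists>p. p \<noteq> 0 \<and> pv p = 0"
  proof (cases "inj_on u {..card B0}")
    case False
    then obtain i j where ij: "i \<noteq> j" "u i = u j" by (auto simp: inj_on_def)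
    define p where "p = monom (1::complex) i - smult 1 (monom 1 j)"
    have "coeff p i = 1" using ij by (simp add: p_def)
    then have "p \<noteq> 0" by auto
    moreover have "pv (monom 1 k) = u k" for k
      using pv_eq[of "monom 1 k" k] by (simp add: degree_monom_eq if_distrib[of "\<lambda>c. c *\<^sub>C _"] 
          cong: if_cong)
    then have "pv p = 0" unfolding p_def pv_diff using ij by simp
    ultimately show ?thesis by blast
  next
    case True
    have "complex_vector.dependent (u ` {..card B0})"
    proof (rule ccontr)
      assume "complex_vector.independent (u ` {..card B0})"
      from complex_vector.independent_span_bound[OF \<open>finite B0\<close> this]
      have "card (u ` {..card B0}) \<le> card B0" using u_in F0 by auto
      then show False using card_image[OF True] by simp
    qed
    then obtain f w where f: "w \<in> u ` {..card B0}" "f w \<noteq> 0"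
      "(\<Sum>w\<in>u ` {..card B0}. f w *\<^sub>C w) = 0"
      by (subst (asm) complex_vector.dependent_finite) auto
    define p where "p = (\<Sum>i\<le>card B0. monom (f (u i)) i)"
    have coeff: "coeff p i = f (u i)" if "i \<le> card B0" for i
      using that by (simp add: p_def coeff_sum)
    from f(1) obtain k where k: "k \<le> card B0" "w = u k" by auto
    then have "coeff p k \<noteq> 0" using f coeff by auto
    then have "p \<noteq> 0" by auto
    moreover have "degree p \<le> card B0"
      unfolding p_def by (rule degree_sum_le) (auto intro: degree_monom_le order_trans)
    then have "pv p = (\<Sum>i\<le>card B0. f (u i) *\<^sub>C u i)"
      by (simp add: pv_eq coeff)
    then have "pv p = 0"
      using f(3) sum.reindex[OF True, of "\<lambda>w. f w *\<^sub>C w"] by (simp add: o_def)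
    ultimately show ?thesis by blast
  qed
  then obtain p where p: "p \<noteq> 0" "pv p = 0" and least: "\<And>q. q \<noteq> 0 \<Longrightarrow> pv q = 0 \<Longrightarrow> degree p \<le> degree q"
    using ex_has_least_nat[of "\<lambda>p. p \<noteq> 0 \<and> pv p = 0" _ degree] by metis
  have "degree p \<noteq> 0"
  proof
    assume "degree p = 0"
    then have "pv p = coeff p 0 *\<^sub>C v" "coeff p 0 \<noteq> 0"
      using p(1) leading_coeff_0_iff[of p] by (simp_all add: pv_def u_def)
    then show False using p v by simp
  qed
  then obtain c where "poly p c = 0" using alg_closed_imp_poly_has_root[of p] by auto
  then obtain q where q: "p = [:- c, 1:] * q" by (auto simp: poly_eq_0_iff_dvd)
  have "q \<noteq> 0" using p q by auto
  then have "degree p = Suc (degree q)" unfolding q by (subst degree_mult_eq) auto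
  then have "pv q \<noteq> 0" using least[OF \<open>q \<noteq> 0\<close>] by auto
  moreover have "p = pCons 0 q - smult c q" by (simp add: q)
  then have "T (pv q) = c *\<^sub>C pv q"
    using p(2) pv_diff[of "pCons 0 q" c q] pv_pCons[of q] by simp
  ultimately show thesis using that[OF pv_in] by blast
qed

definition hermitian_form_on ::
  "'a::complex_hilbert_space set \<Rightarrow> ('a \<Rightarrow> 'a \<Rightarrow> complex) \<Rightarrow> bool" where
  "hermitian_form_on F a \<longleftrightarrow>
     (\<forall>x\<in>F. \<forall>y\<in>F. \<forall>u\<in>F. a (x + y) u = a x u + a y u) \<and>
     (\<forall>c. \<forall>x\<in>F. \<forall>y\<in>F. a (c *\<^sub>C x) y = c * a x y) \<and>
     (\<forall>x\<in>F. \<forall>y\<in>F. a x y = cnj (a y x))"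

lemma hermitian_form_on_subset:
  "hermitian_form_on F a \<Longrightarrow> F' \<subseteq> F \<Longrightarrow> hermitian_form_on F' a"
  unfolding hermitian_form_on_def by blast

lemma
  assumes "hermitian_form_on F a" "complex_vector.subspace F"
  shows form_add_left: "x \<in> F \<Longrightarrow> y \<in> F \<Longrightarrow> u \<in> F \<Longrightarrow> a (x + y) u = a x u + a y u"
    and form_scale_left: "x \<in> F \<Longrightarrow> y \<in> F \<Longrightarrow> a (c *\<^sub>C x) y = c * a x y"
    and form_commute: "x \<in> F \<Longrightarrow> y \<in> F \<Longrightarrow> a x y = cnj (a y x)"
    and form_add_right: "x \<in> F \<Longrightarrow> y \<in> F \<Longrightarrow> u \<in> F \<Longrightarrow> a u (x + y) = a u x + a u y"
    and form_scale_right: "x \<in> F \<Longrightarrow> y \<in> F \<Longrightarrow> a x (c *\<^sub>C y) = cnj c * a x y"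
    and form_sum_left: "(\<And>i. i \<in> I \<Longrightarrow> f i \<in> F) \<Longrightarrow> u \<in> F \<Longrightarrow> a (sum f I) u = (\<Sum>i\<in>I. a (f i) u)"
    and form_sum_right: "(\<And>i. i \<in> I \<Longrightarrow> f i \<in> F) \<Longrightarrow> u \<in> F \<Longrightarrow> a u (sum f I) = (\<Sum>i\<in>I. a u (f i))"
proof -
  show add: "\<And>x y u. x \<in> F \<Longrightarrow> y \<in> F \<Longrightarrow> u \<in> F \<Longrightarrow> a (x + y) u = a x u + a y u"
    and scale: "\<And>x y c. x \<in> F \<Longrightarrow> y \<in> F \<Longrightarrow> a (c *\<^sub>C x) y = c * a x y"
    and comm: "\<And>x y. x \<in> F \<Longrightarrow> y \<in> F \<Longrightarrow> a x y = cnj (a y x)"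
    using assms(1) unfolding hermitian_form_on_def by blast+
  show "a u (x + y) = a u x + a u y" if "x \<in> F" "y \<in> F" "u \<in> F" for x y u
    using comm[of u "x + y"] comm[of u x] comm[of u y] add[of x y u] that
      complex_vector.subspace_add[OF assms(2)] by simp
  show "a x (c *\<^sub>C y) = cnj c * a x y" if "x \<in> F" "y \<in> F" for x y c
    using comm[of x "c *\<^sub>C y"] comm[of x y] scale[of y x c] that
      complex_vector.subspace_scale[OF assms(2)] by simp
  have zero: "a 0 u = 0" if "u \<in> F" for u
    using scale[of 0 u 0] that complex_vector.subspace_0[OF assms(2)] by simp
  show sum: "a (sum f I) u = (\<Sum>i\<in>I. a (f i) u)" if "\<And>i. i \<in> I \<Longrightarrow> f i \<in> F" "u \<in> F" for f I u
    using that
  proof (induction I rule: infinite_finite_induct)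
    case (insert i I)
    then show ?case
      using add[of "f i" "sum f I" u] complex_vector.subspace_sum[OF assms(2), of I f] by auto
  qed (use zero in auto)
  show "a u (sum f I) = (\<Sum>i\<in>I. a u (f i))" if "\<And>i. i \<in> I \<Longrightarrow> f i \<in> F" "u \<in> F" for f I u
  proof -
    have "a u (sum f I) = cnj (a (sum f I) u)"
      using that by (intro comm complex_vector.subspace_sum[OF assms(2)]) auto
    also have "\<dots> = (\<Sum>i\<in>I. cnj (a (f i) u))"
      by (subst sum) (use that in auto)
    also have "\<dots> = (\<Sum>i\<in>I. a u (f i))"
      using that by (intro sum.cong refl comm[symmetric]) auto
    finally show ?thesis .
  qed
qed

lemma
  assumes F: "findim_subspace F" and a: "hermitian_form_on F a" and x: "x \<in> F"
  shows compression_in: "compression a F x \<in> F"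
    and cinner_compression: "y \<in> F \<Longrightarrow> cinner (compression a F x) y = a x y"
    and compression_unique: "u \<in> F \<Longrightarrow> (\<And>y. y \<in> F \<Longrightarrow> cinner u y = a x y) \<Longrightarrow> compression a F x = u"
proof -
  have sub: "complex_vector.subspace F" by (rule findim_subspaceD[OF F])
  obtain B where B: "finite B" "orthonormal B" and span: "complex_vector.span B = F"
    using ex_orthonormal_basis[OF F] .
  have BF: "b \<in> F" if "b \<in> B" for b using complex_vector.span_base[OF that] span by simp
  define u where "u = (\<Sum>b\<in>B. a x b *\<^sub>C b)"
  have "u \<in> F" unfolding u_def
    by (intro complex_vector.subspace_sum sub complex_vector.subspace_scale BF)
  have u: "cinner u y = a x y" if "y \<in> F" for y
  proof -
    have "y = (\<Sum>b\<in>B. cinner y b *\<^sub>C b)"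
      using basis_proj_id[OF B(2,1), of y] that span by (simp add: basis_proj_def)
    then have "a x y = a x (\<Sum>b\<in>B. cinner y b *\<^sub>C b)" by simp
    also have "\<dots> = (\<Sum>b\<in>B. cnj (cinner y b) * a x b)"
      by (simp add: form_sum_right[OF a sub] form_scale_right[OF a sub] x BF
          complex_vector.subspace_scale[OF sub])
    also have "\<dots> = cinner u y"
      unfolding u_def cinner_sum_left cinner_scaleC_left
      by (intro sum.cong refl, subst cinner_commute) simp
    finally show ?thesis by simp
  qed
  have uniq: "v = u" if "v \<in> F" "\<forall>y\<in>F. cinner v y = a x y" for v
  proof -
    have "v - u \<in> F" using that \<open>u \<in> F\<close> complex_vector.subspace_diff[OF sub] by blast
    then have "cinner (v - u) (v - u) = 0" using that u by (simp add: cinner_diff_left)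
    then show "v = u" by simp
  qed
  have eq: "compression a F x = u"
    unfolding compression_def
  proof (rule the_equality)
    show "u \<in> F \<and> (\<forall>y\<in>F. cinner u y = a x y)" using \<open>u \<in> F\<close> u by simp
  qed (use uniq in blast)
  show "compression a F x \<in> F" using eq \<open>u \<in> F\<close> by simp
  show "y \<in> F \<Longrightarrow> cinner (compression a F x) y = a x y" using eq u by simp
  show "compression a F x = v" if "v \<in> F" "\<And>y. y \<in> F \<Longrightarrow> cinner v y = a x y" for v
    unfolding eq using that by (intro uniq[symmetric]) auto
qed

lemma linear_op_compression:
  assumes F: "findim_subspace F" and a: "hermitian_form_on F a"
  shows "linear_op F (compression a F)"
proof -
  have sub: "complex_vector.subspace F" by (rule findim_subspaceD[OF F])
  note [simp] = compression_in[OF F a] cinner_compression[OF F a] complex_vector.subspace_add[OF sub]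
    complex_vector.subspace_scale[OF sub] form_add_left[OF a sub] form_scale_left[OF a sub]
  show ?thesis
    unfolding linear_op_def
    by (intro conjI sub ballI allI compression_unique[OF F a])
      (simp_all add: cinner_add_left cinner_scaleC_left)
qed

lemma orthonormal_independent:
  assumes "orthonormal B" "finite B"
  shows "complex_vector.independent B"
proof
  assume "complex_vector.dependent B"
  then obtain f b where "b \<in> B" "f b \<noteq> 0" "(\<Sum>b\<in>B. f b *\<^sub>C b) = 0"
    unfolding complex_vector.dependent_finite[OF assms(2)] by blast
  then show False using cinner_orthonormal_sum[OF assms, of b f] by simp
qed

text \<open>A largest orthonormal system of eigenvectors must span: its orthogonal complement is invariant,
  so it would otherwise contain another eigenvector.\<close>

lemma hermitian_form_diagonalization:
  assumes F: "findim_subspace F" and a: "hermitian_form_on F a"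
  obtains B and c :: "'a::complex_hilbert_space \<Rightarrow> real"
  where "finite B" "orthonormal B" "complex_vector.span B = F"
    "\<And>b y. b \<in> B \<Longrightarrow> y \<in> F \<Longrightarrow> a b y = complex_of_real (c b) * cinner b y"
proof -
  have sub: "complex_vector.subspace F" by (rule findim_subspaceD[OF F])
  obtain B0 where "finite B0" and F0: "F = complex_vector.span B0"
    using F by (auto simp: findim_subspace_def)
  define T where "T = compression a F"
  have T: "linear_op F T" unfolding T_def by (rule linear_op_compression[OF F a])
  define eig where "eig B \<longleftrightarrow> finite B \<and> orthonormal B \<and> B \<subseteq> F \<and>
    (\<forall>b\<in>B. \<exists>c::real. \<forall>y\<in>F. a b y = complex_of_real c * cinner b y)" for B
  have "eig {}" by (simp add: eig_def orthonormal_def)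
  moreover have "card B < Suc (card B0)" if "eig B" for B
    using complex_vector.independent_span_bound[OF \<open>finite B0\<close> orthonormal_independent[of B]]
      that F0 by (simp add: eig_def)
  ultimately obtain B where B: "eig B" and greatest: "\<And>B'. eig B' \<Longrightarrow> card B' \<le> card B"
    using ex_has_greatest_nat[of eig "{}" card "Suc (card B0)"] by blast
  have fin: "finite B" and orth: "orthonormal B" and BF: "B \<subseteq> F" using B by (auto simp: eig_def)
  define F' where "F' = {x\<in>F. \<forall>b\<in>B. cinner x b = 0}"
  have sub': "complex_vector.subspace F'"
    unfolding F'_def complex_vector.subspace_def
    using sub by (auto simp: complex_vector.subspace_def cinner_add_left cinner_scaleC_left)
  have findim': "findim_subspace F'"
    by (rule findim_subspace_subset[OF F sub']) (auto simp: F'_def)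
  have "F' = {0}"
  proof (rule ccontr)
    assume "F' \<noteq> {0}"
    have "linear_op F' T"
      using T sub' by (auto simp: linear_op_def F'_def)
    moreover have "T x \<in> F'" if x: "x \<in> F'" for x
    proof -
      have "cinner (T x) b = 0" if b: "b \<in> B" for b
      proof -
        obtain c :: real where c: "\<forall>y\<in>F. a b y = complex_of_real c * cinner b y"
          using B b unfolding eig_def by blast
        have "x \<in> F" "b \<in> F" using x b BF by (auto simp: F'_def)
        then have "cinner (T x) b = cnj (a b x)"
          unfolding T_def cinner_compression[OF F a \<open>x \<in> F\<close> \<open>b \<in> F\<close>] by (intro form_commute[OF a sub])
        also have "\<dots> = complex_of_real c * cinner x b"
          using x c cinner_commute[of x b] by (simp add: F'_def)
        finally show ?thesis using x b by (simp add: F'_def)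
      qed
      then show ?thesis
        using x compression_in[OF F a] by (simp add: F'_def T_def)
    qed
    ultimately obtain x c where x: "x \<in> F'" "x \<noteq> 0" "T x = c *\<^sub>C x"
      using ex_eigenvector[OF findim' _ _ \<open>F' \<noteq> {0}\<close>] by blast
    define e where "e = complex_of_real (1 / norm x) *\<^sub>C x"
    have "e \<in> F'" unfolding e_def using complex_vector.subspace_scale[OF sub'] x by blast
    then have "e \<in> F" by (simp add: F'_def)
    have e1: "norm e = 1" using x by (simp add: e_def norm_divide)
    have Te: "T e = c *\<^sub>C e"
      using x linear_op_scale[OF T, of x "complex_of_real (1 / norm x)"]
      by (simp add: e_def F'_def mult.commute)
    have ae: "a e y = c * cinner e y" if "y \<in> F" for y
      using cinner_compression[OF F a \<open>e \<in> F\<close> that] Te by (simp add: T_def cinner_scaleC_left)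
    have "a e e = c" using ae[OF \<open>e \<in> F\<close>] e1 by (simp add: cinner_self)
    then have "c = cnj c" using form_commute[OF a sub \<open>e \<in> F\<close> \<open>e \<in> F\<close>] by metis
    then have c: "c = complex_of_real (Re c)" by (simp add: complex_eq_iff)
    have "orthonormal (insert e B)"
      by (rule orthonormal_insert[OF orth e1]) (use \<open>e \<in> F'\<close> in \<open>auto simp: F'_def\<close>)
    then have "eig (insert e B)"
      using B ae c \<open>e \<in> F\<close> unfolding eig_def by (metis finite_insert insert_iff insert_subset)
    moreover have "e \<notin> B"
      using \<open>e \<in> F'\<close> e1 by (force simp: F'_def cinner_self)
    ultimately show False using greatest[of "insert e B"] fin by simp
  qed
  have span: "complex_vector.span B = F"
  proof (rule antisym)
    show "complex_vector.span B \<subseteq> F" by (rule complex_vector.span_minimal[OF BF sub])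
    then have in_F: "basis_proj B x \<in> F" for x using basis_proj_in[of B x] by blast
    show "F \<subseteq> complex_vector.span B"
    proof
      fix x assume "x \<in> F"
      then have "x - basis_proj B x \<in> F'"
        using in_F complex_vector.subspace_diff[OF sub] basis_proj_orth[OF orth fin]
        by (simp add: F'_def complex_vector.span_base)
      then have "x = basis_proj B x" using \<open>F' = {0}\<close> by simp
      then show "x \<in> complex_vector.span B" using basis_proj_in[of B x] by simp
    qed
  qed
  have "\<forall>b. \<exists>c::real. b \<in> B \<longrightarrow> (\<forall>y\<in>F. a b y = complex_of_real c * cinner b y)"
    using B unfolding eig_def by blast
  then obtain c :: "'a \<Rightarrow> real" where
    "\<And>b y. b \<in> B \<Longrightarrow> y \<in> F \<Longrightarrow> a b y = complex_of_real (c b) * cinner b y" by metis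
  with fin orth span show thesis by (rule that)
qed

lemma form_diagonal:
  assumes a: "hermitian_form_on F a" and sub: "complex_vector.subspace F"
    and B: "finite B" "orthonormal B" "B \<subseteq> F"
    and c: "\<And>b y. b \<in> B \<Longrightarrow> y \<in> F \<Longrightarrow> a b y = complex_of_real (c b) * cinner b y"
  shows "a (\<Sum>b\<in>B. f b *\<^sub>C b) (\<Sum>b\<in>B. f b *\<^sub>C b) = complex_of_real (\<Sum>b\<in>B. c b * (cmod (f b))\<^sup>2)"
proof -
  let ?x = "\<Sum>b\<in>B. f b *\<^sub>C b"
  have x: "?x \<in> F"
    by (intro complex_vector.subspace_sum sub complex_vector.subspace_scale) (use B in auto)
  have "a ?x ?x = (\<Sum>b\<in>B. f b * a b ?x)"
    using B x by (subst form_sum_left[OF a sub])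
      (auto intro!: sum.cong form_scale_left[OF a sub] complex_vector.subspace_scale[OF sub])
  also have "\<dots> = (\<Sum>b\<in>B. complex_of_real (c b * (cmod (f b))\<^sup>2))"
  proof (rule sum.cong)
    fix b assume b: "b \<in> B"
    have "cinner b ?x = cnj (f b)"
      using cinner_orthonormal_sum[OF B(2,1) b, of f] cinner_commute[of b ?x] by simp
    then show "f b * a b ?x = complex_of_real (c b * (cmod (f b))\<^sup>2)"
      by (simp only: c[OF b x] of_real_mult complex_norm_square) (simp only: mult_ac)
  qed simp
  finally show ?thesis by simp
qed

lemma norm_orthonormal_sum_sq:
  assumes "finite B" "orthonormal B"
  shows "(norm (\<Sum>b\<in>B. f b *\<^sub>C b))\<^sup>2 = (\<Sum>b\<in>B. (cmod (f b))\<^sup>2)"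
proof -
  have "hermitian_form_on UNIV cinner"
    by (auto simp: hermitian_form_on_def cinner_add_left cinner_scaleC_left intro: cinner_commute)
  from form_diagonal[OF this complex_vector.subspace_UNIV assms, of "\<lambda>_. 1" f]
  show ?thesis by (simp only: cinner_self of_real_eq_iff) simp
qed

section \<open>Distance of Ritz values\<close>

text \<open>By the triangle inequality in an orthonormal basis.  It makes every linear map on a
  finite-dimensional space bounded, and compares the norm of \<open>V\<close> with that of the ambient space.\<close>

lemma findim_seminorm_bound:
  assumes F: "findim_subspace F"
    and add: "\<And>x y. x \<in> F \<Longrightarrow> y \<in> F \<Longrightarrow> N (x + y) \<le> N x + N y"
    and scale: "\<And>c x. x \<in> F \<Longrightarrow> N (c *\<^sub>C x) = cmod c * N x"
  obtains C :: real where "0 < C" "\<And>x. x \<in> F \<Longrightarrow> N x \<le> C * norm x"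
proof -
  have sub: "complex_vector.subspace F" by (rule findim_subspaceD[OF F])
  have zero: "N 0 = 0" using scale[of 0 0] complex_vector.subspace_0[OF sub] by simp
  have nonneg: "0 \<le> N x" if "x \<in> F" for x
  proof -
    have "N (x + (-1) *\<^sub>C x) \<le> N x + N ((-1) *\<^sub>C x)"
      by (intro add that complex_vector.subspace_scale[OF sub])
    moreover have "x + (-1) *\<^sub>C x = 0" by (simp only: scaleC_minus1 add.right_inverse)
    moreover have "N ((-1) *\<^sub>C x) = N x" unfolding scale[OF that] by simp
    ultimately have "N 0 \<le> N x + N x" by metis
    then show ?thesis using zero by simp
  qed
  obtain B where B: "finite B" "orthonormal B" and span: "complex_vector.span B = F"
    using ex_orthonormal_basis[OF F] .
  have BF: "b \<in> F" if "b \<in> B" for b using complex_vector.span_base[OF that] span by simp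
  have sum: "N (\<Sum>b\<in>I. f b *\<^sub>C b) \<le> (\<Sum>b\<in>I. cmod (f b) * N b)" if "finite I" "I \<subseteq> B" for I f
    using that
  proof (induction I rule: finite_induct)
    case (insert b I)
    have "N (f b *\<^sub>C b + (\<Sum>b\<in>I. f b *\<^sub>C b)) \<le> N (f b *\<^sub>C b) + N (\<Sum>b\<in>I. f b *\<^sub>C b)"
      using insert.prems BF
      by (intro add complex_vector.subspace_sum complex_vector.subspace_scale sub) auto
    also have "N (f b *\<^sub>C b) = cmod (f b) * N b"
      using insert.prems by (intro scale BF) auto
    also have "N (\<Sum>b\<in>I. f b *\<^sub>C b) \<le> (\<Sum>b\<in>I. cmod (f b) * N b)"
      using insert.prems by (intro insert.IH) auto
    finally show ?case unfolding sum.insert[OF insert.hyps] by simp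
  qed (simp add: zero)
  define C where "C = (\<Sum>b\<in>B. N b) + 1"
  have "0 \<le> (\<Sum>b\<in>B. N b)" by (intro sum_nonneg nonneg BF)
  then have "0 < C" by (simp add: C_def)
  moreover have "N x \<le> C * norm x" if x: "x \<in> F" for x
  proof -
    have "N x = N (\<Sum>b\<in>B. cinner x b *\<^sub>C b)"
      using basis_proj_id[OF B(2,1), of x] x span by (simp add: basis_proj_def)
    also have "\<dots> \<le> (\<Sum>b\<in>B. cmod (cinner x b) * N b)" using sum[of B] B by simp
    also have "\<dots> \<le> (\<Sum>b\<in>B. norm x * N b)"
    proof (intro sum_mono mult_right_mono)
      fix b assume b: "b \<in> B"
      then have "cinner b b = 1" using B(2) by (simp add: orthonormal_def)
      then have "(norm b)\<^sup>2 = 1" using Re_cinner_self[of b] by simp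
      then have "norm b = 1" using norm_ge_zero[of b] by (simp add: power2_eq_1_iff)
      then show "cmod (cinner x b) \<le> norm x" using cauchy_schwarz[of x b] by simp
      show "0 \<le> N b" using nonneg BF[OF b] .
    qed
    also have "\<dots> \<le> C * norm x"
      unfolding sum_distrib_left[symmetric] C_def by (simp add: distrib_left mult.commute)
    finally show ?thesis .
  qed
  ultimately show thesis by (rule that)
qed

lemma linear_op_the_inv_into:
  assumes L: "linear_op D L" and bij: "bij_betw L D X" and X: "complex_vector.subspace X"
  shows "linear_op X (the_inv_into D L)"
proof -
  have inj: "inj_on L D" and img: "L ` D = X" using bij by (auto simp: bij_betw_def)
  have D: "complex_vector.subspace D" by (rule linear_op_subspace[OF L])
  have eq: "the_inv_into D L (L x) = x" if "x \<in> D" for x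
    by (rule the_inv_into_f_f[OF inj that])
  show ?thesis
    unfolding linear_op_def img[symmetric]
  proof (intro conjI ballI allI)
    show "complex_vector.subspace (L ` D)" using X img by simp
    fix c x y assume "x \<in> L ` D" "y \<in> L ` D"
    then obtain u v where uv: "u \<in> D" "v \<in> D" "x = L u" "y = L v" by auto
    have "x + y = L (u + v)" using uv linear_op_add[OF L] by simp
    then show "the_inv_into D L (x + y) = the_inv_into D L x + the_inv_into D L y"
      using uv eq complex_vector.subspace_add[OF D] by simp
  next
    fix c x assume "x \<in> L ` D"
    then obtain u where u: "u \<in> D" "x = L u" by auto
    have "c *\<^sub>C x = L (c *\<^sub>C u)" using u linear_op_scale[OF L] by simp
    then show "the_inv_into D L (c *\<^sub>C x) = c *\<^sub>C the_inv_into D L x"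
      using u eq complex_vector.subspace_scale[OF D] by simp
  qed
qed

lemma linear_op_shift:
  assumes T: "linear_op D T"
  shows "linear_op D (\<lambda>x. z *\<^sub>C x - T x)"
  using linear_op_subspace[OF T] linear_op_add[OF T] linear_op_scale[OF T]
  by (auto simp: linear_op_def scaleC_add_right complex_vector.scale_right_diff_distrib mult.commute)

text \<open>In finite dimension the spectrum consists of eigenvalues, since an injective operator is
  surjective and its inverse is bounded.\<close>

lemma ritz_values_iff:
  assumes F: "findim_subspace F" and a: "hermitian_form_on F a"
  shows "c \<in> ritz_values a F \<longleftrightarrow> (\<exists>x\<in>F. x \<noteq> 0 \<and> (\<forall>y\<in>F. a x y = c * cinner x y))"
proof -
  let ?T = "compression a F"
  let ?L = "\<lambda>x. c *\<^sub>C x - ?T x"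
  have sub: "complex_vector.subspace F" by (rule findim_subspaceD[OF F])
  have L: "linear_op F ?L" by (intro linear_op_shift linear_op_compression F a)
  have LF: "?L x \<in> F" if "x \<in> F" for x
    using that compression_in[OF F a] complex_vector.subspace_diff[OF sub]
      complex_vector.subspace_scale[OF sub] by blast
  have eig: "?L x = 0 \<longleftrightarrow> (\<forall>y\<in>F. a x y = c * cinner x y)" if x: "x \<in> F" for x
  proof
    assume "?L x = 0"
    then show "\<forall>y\<in>F. a x y = c * cinner x y"
      using cinner_compression[OF F a x] by (metis cinner_scaleC_left right_minus_eq)
  next
    assume "\<forall>y\<in>F. a x y = c * cinner x y"
    then have "?T x = c *\<^sub>C x"
      by (intro compression_unique[OF F a x] complex_vector.subspace_scale[OF sub x])
        (simp add: cinner_scaleC_left)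
    then show "?L x = 0" by simp
  qed
  have "c \<in> ritz_values a F \<longleftrightarrow> (\<exists>x\<in>F. x \<noteq> 0 \<and> ?L x = 0)"
  proof
    assume spec: "c \<in> ritz_values a F"
    show "\<exists>x\<in>F. x \<noteq> 0 \<and> ?L x = 0"
    proof (rule ccontr)
      assume "\<not> ?thesis"
      then have ker: "x = 0" if "x \<in> F" "?L x = 0" for x using that by blast
      have "bij_betw ?L F F"
        using inj_on_linear_op[OF L ker] findim_inj_imp_surj[OF F L LF ker]
            by (simp add: bij_betw_def)
      moreover have "linear_op F (resolvent F ?T c)"
        unfolding resolvent_def by (rule linear_op_the_inv_into[OF L calculation sub])
      then have "\<And>x y. x \<in> F \<Longrightarrow> y \<in> F \<Longrightarrow> norm (resolvent F ?T c (x + y))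
          \<le> norm (resolvent F ?T c x) + norm (resolvent F ?T c y)"
        "\<And>k x. x \<in> F \<Longrightarrow> norm (resolvent F ?T c (k *\<^sub>C x)) = cmod k * norm (resolvent F ?T c x)"
        by (simp_all add: linear_op_add linear_op_scale norm_triangle_ineq)
      from findim_seminorm_bound[OF F this]
      obtain C where "\<And>x. x \<in> F \<Longrightarrow> norm (resolvent F ?T c x) \<le> C * norm x" by blast
      ultimately show False
        using spec by (auto simp: ritz_values_def spectrum_in_def resolvent_set_in_def)
    qed
  next
    assume "\<exists>x\<in>F. x \<noteq> 0 \<and> ?L x = 0"
    then obtain x where "x \<in> F" "x \<noteq> 0" "?L x = ?L 0"
      using linear_op_zero[OF L] by auto
    then have "\<not> inj_on ?L F"
      using complex_vector.subspace_0[OF sub] unfolding inj_on_def by metis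
    then show "c \<in> ritz_values a F"
      by (auto simp: ritz_values_def spectrum_in_def resolvent_set_in_def bij_betw_def)
  qed
  with eig show ?thesis by blast
qed

lemma ritz_values_diagonal:
  assumes F: "findim_subspace F" and a: "hermitian_form_on F a"
    and B: "finite B" "orthonormal B" "complex_vector.span B = F"
    and c: "\<And>b y. b \<in> B \<Longrightarrow> y \<in> F \<Longrightarrow> a b y = complex_of_real (c b) * cinner b y"
  shows "ritz_values a F = complex_of_real ` c ` B"
proof (rule set_eqI)
  fix \<mu>
  have sub: "complex_vector.subspace F" by (rule findim_subspaceD[OF F])
  have BF: "b \<in> F" if "b \<in> B" for b using complex_vector.span_base[OF that] B by simp
  have "\<mu> \<in> complex_of_real ` c ` B" if x: "x \<in> F" "x \<noteq> 0" "\<forall>y\<in>F. a x y = \<mu> * cinner x y" for x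
  proof -
    have "x = (\<Sum>b\<in>B. cinner x b *\<^sub>C b)"
      using basis_proj_id[OF B(2,1), of x] x B by (simp add: basis_proj_def)
    then obtain b where b: "b \<in> B" "cinner x b \<noteq> 0"
      using x(2) by (metis (no_types, lifting) complex_vector.scale_eq_0_iff sum.neutral)
    have "a x b = cnj (a b x)" using x BF[OF b(1)] by (intro form_commute[OF a sub])
    also have "\<dots> = complex_of_real (c b) * cinner x b"
      using c[OF b(1) x(1)] cinner_commute[of x b] by simp
    finally have "\<mu> = complex_of_real (c b)" using x(3) b BF by simp
    with b show ?thesis by auto
  qed
  moreover have "\<exists>x\<in>F. x \<noteq> 0 \<and> (\<forall>y\<in>F. a x y = \<mu> * cinner x y)"
    if "\<mu> \<in> complex_of_real ` c ` B"
  proof -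
    from that obtain b where b: "b \<in> B" "\<mu> = complex_of_real (c b)" by auto
    then have "cinner b b = 1" using B(2) by (simp add: orthonormal_def)
    then have "b \<noteq> 0" by auto
    with b c BF show ?thesis by (intro bexI[of _ b]) auto
  qed
  ultimately show "\<mu> \<in> ritz_values a F \<longleftrightarrow> \<mu> \<in> complex_of_real ` c ` B"
    unfolding ritz_values_iff[OF F a] by metis
qed

definition rayleigh :: "('a::complex_hilbert_space \<Rightarrow> 'a \<Rightarrow> complex) \<Rightarrow> 'a \<Rightarrow> real" where
  "rayleigh a x = Re (a x x) / (norm x)\<^sup>2"

text \<open>The form \<open>b = a - \<mu> (\<cdot>, \<cdot>)\<close> vanishes on \<open>(p + n, p)\<close> and \<open>(p + n, n)\<close>.  Subtracting, the
  mixed terms cancel and \<open>b(p, p) = b(n, n)\<close>; the left side is positive unless \<open>p = 0\<close>, the right side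
  negative unless \<open>n = 0\<close>.\<close>

lemma eigenvector_definite_splitting:
  assumes a: "hermitian_form_on G a" and sub: "complex_vector.subspace G"
    and in_G: "p \<in> G" "n \<in> G"
    and eig: "\<And>y. y \<in> G \<Longrightarrow> a (p + n) y = complex_of_real \<mu> * cinner (p + n) y"
    and pos: "p \<noteq> 0 \<Longrightarrow> \<mu> < rayleigh a p" and neg: "n \<noteq> 0 \<Longrightarrow> rayleigh a n < \<mu>"
  shows "p + n = 0"
proof -
  have "a p p + a n p = complex_of_real \<mu> * (cinner p p + cinner n p)"
    using eig[of p] in_G form_add_left[OF a sub] by (simp add: cinner_add_left)
  moreover have "a p n + a n n = complex_of_real \<mu> * (cinner p n + cinner n n)"
    using eig[of n] in_G form_add_left[OF a sub] by (simp add: cinner_add_left)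
  moreover have "Re (a n p) = Re (a p n)"
    using form_commute[OF a sub in_G] by simp
  moreover have "Re (cinner n p) = Re (cinner p n)"
    using cinner_commute[of n p] by simp
  ultimately have eq: "Re (a p p) - \<mu> * (norm p)\<^sup>2 = Re (a n n) - \<mu> * (norm n)\<^sup>2"
    by (simp add: complex_eq_iff cinner_self algebra_simps)
  have zero: "Re (a 0 0) = 0"
    using form_scale_left[OF a sub, of 0 0 0] complex_vector.subspace_0[OF sub] by simp
  have "p \<noteq> 0 \<Longrightarrow> 0 < Re (a p p) - \<mu> * (norm p)\<^sup>2"
    using pos by (simp add: rayleigh_def field_simps)
  moreover have "n \<noteq> 0 \<Longrightarrow> Re (a n n) - \<mu> * (norm n)\<^sup>2 < 0"
    using neg by (simp add: rayleigh_def field_simps)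
  ultimately have "p = 0 \<and> n = 0"
    using eq zero by (cases "p = 0"; cases "n = 0") auto
  then show ?thesis by simp
qed

text \<open>Take \<open>p\<close> and \<open>n\<close> to be the spectral components of \<open>x\<close> above and below \<open>\<mu>\<close>; each Rayleigh
  quotient is a weighted mean of eigenvalues on its side.\<close>

lemma rayleigh_split:
  assumes F: "findim_subspace F" and a: "hermitian_form_on F a"
    and gap: "\<And>\<nu>. \<nu> \<in> ritz_values a F \<Longrightarrow> d < cmod (complex_of_real \<mu> - \<nu>)" and "0 \<le> d"
    and x: "x \<in> F"
  obtains p n where "p \<in> F" "n \<in> F" "x = p + n"
    "p \<noteq> 0 \<Longrightarrow> \<mu> + d < rayleigh a p" "n \<noteq> 0 \<Longrightarrow> rayleigh a n < \<mu> - d"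
proof -
  have sub: "complex_vector.subspace F" by (rule findim_subspaceD[OF F])
  obtain B and c :: "'a \<Rightarrow> real" where B: "finite B" "orthonormal B" "complex_vector.span B = F"
    and c: "\<And>b y. b \<in> B \<Longrightarrow> y \<in> F \<Longrightarrow> a b y = complex_of_real (c b) * cinner b y"
    using hermitian_form_diagonalization[OF F a] by metis
  have BF: "b \<in> F" if "b \<in> B" for b using complex_vector.span_base[OF that] B by simp
  define s where "s I = (\<Sum>b\<in>I. cinner x b *\<^sub>C b)" for I
  define Bp where "Bp = {b\<in>B. \<mu> < c b}"
  define Bn where "Bn = {b\<in>B. \<not> \<mu> < c b}"
  have s: "s I \<in> F" "a (s I) (s I) = complex_of_real (\<Sum>b\<in>I. c b * (cmod (cinner x b))\<^sup>2)"
    "(norm (s I))\<^sup>2 = (\<Sum>b\<in>I. (cmod (cinner x b))\<^sup>2)" if "I \<subseteq> B" for I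
  proof -
    have I: "finite I" "orthonormal I" "I \<subseteq> F"
    proof -
      show "finite I" using that B(1) by (rule finite_subset)
      show "orthonormal I" using that B(2) unfolding orthonormal_def by blast
      show "I \<subseteq> F" using that BF by blast
    qed
    show "s I \<in> F" unfolding s_def
      by (intro complex_vector.subspace_sum sub complex_vector.subspace_scale) (use I in auto)
    show "a (s I) (s I) = complex_of_real (\<Sum>b\<in>I. c b * (cmod (cinner x b))\<^sup>2)"
      unfolding s_def by (rule form_diagonal[OF a sub I]) (use c that in auto)
    show "(norm (s I))\<^sup>2 = (\<Sum>b\<in>I. (cmod (cinner x b))\<^sup>2)"
      unfolding s_def by (rule norm_orthonormal_sum_sq[OF I(1,2)])
  qed
  have gap': "d < \<bar>\<mu> - c b\<bar>" if "b \<in> B" for b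
    using gap[of "complex_of_real (c b)"] that ritz_values_diagonal[OF F a B c]
    by (metis image_eqI norm_of_real of_real_diff)
  have "x = s B" using basis_proj_id[OF B(2,1), of x] x B by (simp add: basis_proj_def s_def)
  also have "\<dots> = s Bp + s Bn"
    unfolding s_def Bp_def Bn_def using B(1)
    by (subst sum.union_disjoint[symmetric]) (auto intro: sum.cong)
  finally have "x = s Bp + s Bn" .
  moreover have "\<mu> + d < rayleigh a (s Bp)" if "s Bp \<noteq> 0"
  proof -
    have sub: "Bp \<subseteq> B" and fin: "finite Bp" using B by (auto simp: Bp_def)
    have "(\<Sum>b\<in>Bp. (cmod (cinner x b))\<^sup>2) \<noteq> 0" using that s(3)[OF sub]
        by (metis norm_eq_zero zero_eq_power2)
    then obtain b where "b \<in> Bp" "(cmod (cinner x b))\<^sup>2 \<noteq> 0" by (meson sum.neutral)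
    then have "(\<Sum>b\<in>Bp. (\<mu> + d) * (cmod (cinner x b))\<^sup>2) < (\<Sum>b\<in>Bp. c b * (cmod (cinner x b))\<^sup>2)"
      using gap' fin by (intro sum_strict_mono_ex1 bexI[of _ b] ballI mult_right_mono
          mult_strict_right_mono)
        (fastforce simp: Bp_def)+
    then have "(\<mu> + d) * (norm (s Bp))\<^sup>2 < Re (a (s Bp) (s Bp))"
      unfolding s(2,3)[OF sub] by (simp add: sum_distrib_left)
    then show ?thesis
      using that by (simp add: rayleigh_def less_divide_eq)
  qed
  moreover have "rayleigh a (s Bn) < \<mu> - d" if "s Bn \<noteq> 0"
  proof -
    have sub: "Bn \<subseteq> B" and fin: "finite Bn" using B by (auto simp: Bn_def)
    have "(\<Sum>b\<in>Bn. (cmod (cinner x b))\<^sup>2) \<noteq> 0" using that s(3)[OF sub]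
        by (metis norm_eq_zero zero_eq_power2)
    then obtain b where "b \<in> Bn" "(cmod (cinner x b))\<^sup>2 \<noteq> 0" by (meson sum.neutral)
    then have "(\<Sum>b\<in>Bn. c b * (cmod (cinner x b))\<^sup>2) < (\<Sum>b\<in>Bn. (\<mu> - d) * (cmod (cinner x b))\<^sup>2)"
      using gap' fin by (intro sum_strict_mono_ex1 bexI[of _ b] ballI mult_right_mono
          mult_strict_right_mono)
        (fastforce simp: Bn_def)+
    then have "Re (a (s Bn) (s Bn)) < (\<mu> - d) * (norm (s Bn))\<^sup>2"
      unfolding s(2,3)[OF sub] by (simp add: sum_distrib_left)
    then show ?thesis
      using that by (simp add: rayleigh_def divide_less_eq)
  qed
  moreover have "s Bp \<in> F" "s Bn \<in> F" using s(1) by (auto simp: Bp_def Bn_def)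
  ultimately show thesis using that by blast
qed

text \<open>With \<open>e = S v\<close> and \<open>d = v - S v\<close>, both \<open>a(v, v) = a(e, e) + a(d, d)\<close> and
  \<open>\<parallel>v\<parallel>\<^sup>2 = \<parallel>e\<parallel>\<^sup>2 + \<parallel>d\<parallel>\<^sup>2\<close>, because \<open>E\<close> reduces the form.  Hence the Rayleigh quotients \<open>\<rho>\<close> satisfy
  \<open>\<rho>(v) - \<rho>(e) = (a(d, d) - \<rho>(e) \<parallel>d\<parallel>\<^sup>2) / \<parallel>v\<parallel>\<^sup>2\<close>, which is quadratic in \<open>d\<close>.\<close>

lemma rayleigh_orth_proj_close:
  assumes D: "hermitian_form_on D a" "complex_vector.subspace D" and E: "findim_subspace E" "E \<subseteq> D"
    and reducing: "\<And>x. x \<in> E \<Longrightarrow> \<exists>u\<in>E. \<forall>y\<in>D. a x y = cinner u y"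
    and M: "\<And>e. e \<in> E \<Longrightarrow> cmod (a e e) \<le> M * (norm e)\<^sup>2"
    and v: "v \<in> D" "orth_proj E v \<noteq> 0"
    and g: "norm (v - orth_proj E v) \<le> g * norm v" "0 \<le> g"
    and s: "cmod (a (v - orth_proj E v) (v - orth_proj E v)) \<le> s * (norm v)\<^sup>2"
  shows "\<bar>rayleigh a v - rayleigh a (orth_proj E v)\<bar> \<le> s + M * g\<^sup>2"
proof -
  define e where "e = orth_proj E v"
  have eE: "e \<in> E" unfolding e_def by (rule orth_proj_in[OF E(1)])
  have eD: "e \<in> D" and e0: "e \<noteq> 0" using eE E v by (auto simp: e_def)
  have dD: "v - e \<in> D" using complex_vector.subspace_diff[OF D(2) v(1) eD] .
  obtain u where u: "u \<in> E" "\<forall>y\<in>D. a e y = cinner u y" using reducing[OF eE] by blast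
  have "cinner (v - e) u = 0" unfolding e_def by (rule orth_proj_orth[OF E(1) u(1)])
  then have cross: "a e (v - e) = 0"
    using u(2) dD cinner_commute[of u "v - e"] by simp
  then have cross': "a (v - e) e = 0"
    using form_commute[OF D dD eD] by simp
  have "a v v = a (e + (v - e)) (e + (v - e))" by simp
  also have "\<dots> = a e e + a (v - e) (v - e)"
    using cross cross' eD dD v(1) by (simp only: form_add_left[OF D] form_add_right[OF D]
        complex_vector.subspace_add[OF D(2)]) simp
  finally have split: "a v v = a e e + a (v - e) (v - e)" .
  have pyth: "(norm v)\<^sup>2 = (norm e)\<^sup>2 + (norm (v - e))\<^sup>2"
    unfolding e_def by (rule norm_orth_proj_sq[OF E(1)])
  have pos: "0 < (norm e)\<^sup>2" using e0 by simp
  have "0 < (norm v)\<^sup>2" using pyth pos by (smt (verit) zero_le_power2)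
  have vsq: "(norm (v - e))\<^sup>2 \<le> g\<^sup>2 * (norm v)\<^sup>2"
    using g power_mono[of "norm (v - e)" "g * norm v" 2] by (simp add: e_def power_mult_distrib)
  have "rayleigh a v - rayleigh a e = Re (a (v - e) (v - e)) / (norm v)\<^sup>2
      - Re (a e e) / (norm e)\<^sup>2 * ((norm (v - e))\<^sup>2 / (norm v)\<^sup>2)"
  proof -
    have *: "(p + q) / n - p / k = q / n - p / k * ((n - k) / n)" if "0 < n" "0 < k"
        for p q n k :: real
      using that by (simp add: divide_simps) (simp add: algebra_simps)
    have "(norm (v - e))\<^sup>2 = (norm v)\<^sup>2 - (norm e)\<^sup>2" using pyth by simp
    then show ?thesis
      unfolding rayleigh_def split plus_complex.sel using *[OF \<open>0 < (norm v)\<^sup>2\<close> pos] by simp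
  qed
  also have "\<bar>\<dots>\<bar> \<le> \<bar>Re (a (v - e) (v - e)) / (norm v)\<^sup>2\<bar>
      + \<bar>Re (a e e) / (norm e)\<^sup>2 * ((norm (v - e))\<^sup>2 / (norm v)\<^sup>2)\<bar>"
    by (rule abs_triangle_ineq4)
  also have "\<bar>Re (a (v - e) (v - e)) / (norm v)\<^sup>2\<bar> \<le> s"
    using s abs_Re_le_cmod[of "a (v - e) (v - e)"] \<open>0 < (norm v)\<^sup>2\<close>
    by (simp add: e_def abs_divide divide_le_eq)
  also have "\<bar>Re (a e e) / (norm e)\<^sup>2 * ((norm (v - e))\<^sup>2 / (norm v)\<^sup>2)\<bar> \<le> M * g\<^sup>2"
  proof -
    have "\<bar>Re (a e e) / (norm e)\<^sup>2\<bar> \<le> M"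
      using M[OF eE] abs_Re_le_cmod[of "a e e"] pos by (simp add: abs_divide divide_le_eq)
    moreover have "(norm (v - e))\<^sup>2 / (norm v)\<^sup>2 \<le> g\<^sup>2"
      using vsq \<open>0 < (norm v)\<^sup>2\<close> by (simp add: divide_le_eq)
    ultimately show ?thesis
      unfolding abs_mult
      using order_trans[OF abs_ge_zero[of "Re (a e e) / (norm e)\<^sup>2"]] by (intro mult_mono) auto
  qed
  finally show ?thesis by (simp add: e_def)
qed

lemma hausdorff_distance_le:
  assumes "M \<noteq> {}" "L \<noteq> {}" "\<And>x. x \<in> M \<Longrightarrow> infdist x L \<le> d" "\<And>x. x \<in> L \<Longrightarrow> infdist x M \<le> d"
  shows "hausdorff_distance M L \<le> d"
  unfolding hausdorff_distance_def using assms by (auto intro!: cSUP_least)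

text \<open>Both halves of the Hausdorff distance are bounded by contradiction.  The spectral splitting takes
  place in the space whose eigenvalues are far from \<open>\<mu>\<close>, where it leaves Rayleigh quotients beyond \<open>\<mu> \<pm> \<Delta>\<close>;
  transport by the bijection \<open>S\<close> from \<open>F\<close> onto \<open>E\<close> changes these by at most \<open>\<Delta>\<close>, so they remain on the
  same side of \<open>\<mu>\<close> and \<open>eigenvector_definite_splitting\<close> applies in the other space.\<close>

theorem hausdorff_distance_ritz_values:
  assumes D: "hermitian_form_on D a" "complex_vector.subspace D"
    and E: "findim_subspace E" "E \<subseteq> D" "E \<noteq> {0}" and F: "findim_subspace F" "F \<subseteq> D"
    and reducing: "\<And>x. x \<in> E \<Longrightarrow> \<exists>u\<in>E. \<forall>y\<in>D. a x y = cinner u y"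
    and inj: "\<And>v. v \<in> F \<Longrightarrow> orth_proj E v = 0 \<Longrightarrow> v = 0" and surj: "E \<subseteq> orth_proj E ` F"
    and M: "\<And>e. e \<in> E \<Longrightarrow> cmod (a e e) \<le> M * (norm e)\<^sup>2"
    and g: "\<And>v. v \<in> F \<Longrightarrow> norm (v - orth_proj E v) \<le> g * norm v" "0 \<le> g"
    and s: "\<And>v. v \<in> F \<Longrightarrow>
      cmod (a (v - orth_proj E v) (v - orth_proj E v)) \<le> s * (norm v)\<^sup>2" "0 \<le> s"
  shows "hausdorff_distance (ritz_values a E) (ritz_values a F) \<le> s + M * g\<^sup>2"
proof -
  let ?S = "orth_proj E" and ?d = "s + M * g\<^sup>2"
  interpret S: Vector_Spaces.linear scaleC scaleC ?S by (rule orth_proj_linear[OF E(1)])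
  have subE: "complex_vector.subspace E" and subF: "complex_vector.subspace F"
    using E F findim_subspaceD by auto
  have aE: "hermitian_form_on E a" and aF: "hermitian_form_on F a"
    using hermitian_form_on_subset[OF D(1)] E F by auto
  have close: "\<bar>rayleigh a v - rayleigh a (?S v)\<bar> \<le> ?d" if "v \<in> F" "?S v \<noteq> 0" for v
    using that F g s M reducing by (intro rayleigh_orth_proj_close[OF D E(1,2)]) auto
  obtain e where e: "e \<in> E" "e \<noteq> 0" using E(3) complex_vector.subspace_0[OF subE] by blast
  have "0 \<le> M * (norm e)\<^sup>2" using M[OF e(1)] by (meson norm_ge_zero order_trans)
  then have "0 \<le> M" using e(2) by (simp add: zero_le_mult_iff)
  then have d: "0 \<le> ?d" using s by simp
  obtain B and c :: "'a \<Rightarrow> real" where B: "finite B" "orthonormal B" "complex_vector.span B = E"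
    and c: "\<And>b y. b \<in> B \<Longrightarrow> y \<in> E \<Longrightarrow> a b y = complex_of_real (c b) * cinner b y"
    using hermitian_form_diagonalization[OF E(1) aE] by metis
  obtain B' and c' :: "'a \<Rightarrow> real" where B': "finite B'" "orthonormal B'" "complex_vector.span B' = F"
    and c': "\<And>b y. b \<in> B' \<Longrightarrow> y \<in> F \<Longrightarrow> a b y = complex_of_real (c' b) * cinner b y"
    using hermitian_form_diagonalization[OF F(1) aF] by metis
  have ritzE: "ritz_values a E = complex_of_real ` c ` B"
    by (rule ritz_values_diagonal[OF E(1) aE B c])
  have ritzF: "ritz_values a F = complex_of_real ` c' ` B'"
    by (rule ritz_values_diagonal[OF F(1) aF B' c'])
  have "B \<noteq> {}" using e B(3) by auto
  moreover have "F \<noteq> {0}" using e surj by auto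
  then have "B' \<noteq> {}" using B'(3) by auto
  moreover have "infdist \<mu> (ritz_values a E) \<le> ?d" if \<mu>: "\<mu> \<in> ritz_values a F" for \<mu>
  proof (rule ccontr)
    assume far: "\<not> ?thesis"
    obtain b where b: "b \<in> B'" "\<mu> = complex_of_real (c' b)" using \<mu> ritzF by auto
    have bF: "b \<in> F" using complex_vector.span_base[OF b(1)] B' by simp
    have "?d < cmod (complex_of_real (c' b) - \<nu>)" if "\<nu> \<in> ritz_values a E" for \<nu>
      using infdist_le[OF that, of \<mu>] far b by (simp add: dist_norm)
    from rayleigh_split[OF E(1) aE this d orth_proj_in[OF E(1)], of b]
    obtain p n where pn: "p \<in> E" "n \<in> E" "?S b = p + n"
      "p \<noteq> 0 \<Longrightarrow> c' b + ?d < rayleigh a p" "n \<noteq> 0 \<Longrightarrow> rayleigh a n < c' b - ?d" by blast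
    obtain p' where p': "p' \<in> F" "?S p' = p" using subsetD[OF surj pn(1)] by auto
    obtain n' where n': "n' \<in> F" "?S n' = n" using subsetD[OF surj pn(2)] by auto
    note p'n' = p' n'
    have "b - (p' + n') = 0"
    proof (rule inj)
      show "b - (p' + n') \<in> F"
        by (intro complex_vector.subspace_diff complex_vector.subspace_add subF bF p'(1) n'(1))
      show "?S (b - (p' + n')) = 0"
        unfolding S.diff S.add pn(3) p'(2) n'(2) by simp
    qed
    then have eq: "b = p' + n'" by simp
    have "p' + n' = 0"
    proof (rule eigenvector_definite_splitting[OF aF subF])
      show "a (p' + n') y = complex_of_real (c' b) * cinner (p' + n') y" if "y \<in> F" for y
        using c'[OF b(1) that] eq by simp
      show "p' \<noteq> 0 \<Longrightarrow> c' b < rayleigh a p'"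
        using close[OF p'(1)] inj[OF p'(1)] p'(2) pn(4) by (smt (verit))
      show "n' \<noteq> 0 \<Longrightarrow> rayleigh a n' < c' b"
        using close[OF n'(1)] inj[OF n'(1)] n'(2) pn(5) by (smt (verit))
    qed (use p'n' in auto)
    then show False using B'(2) b(1) eq by (force simp: orthonormal_def)
  qed
  moreover have "infdist \<mu> (ritz_values a F) \<le> ?d" if \<mu>: "\<mu> \<in> ritz_values a E" for \<mu>
  proof (rule ccontr)
    assume far: "\<not> ?thesis"
    obtain b where b: "b \<in> B" "\<mu> = complex_of_real (c b)" using \<mu> ritzE by auto
    have bE: "b \<in> E" using complex_vector.span_base[OF b(1)] B by simp
    then obtain v where v: "v \<in> F" "?S v = b" using surj by auto
    have "?d < cmod (complex_of_real (c b) - \<nu>)" if "\<nu> \<in> ritz_values a F" for \<nu>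
      using infdist_le[OF that, of \<mu>] far b by (simp add: dist_norm)
    from rayleigh_split[OF F(1) aF this d v(1)]
    obtain p n where pn: "p \<in> F" "n \<in> F" "v = p + n"
      "p \<noteq> 0 \<Longrightarrow> c b + ?d < rayleigh a p" "n \<noteq> 0 \<Longrightarrow> rayleigh a n < c b - ?d" by blast
    have eq: "b = ?S p + ?S n" using v(2) pn(3) by (simp add: S.add)
    have "?S p + ?S n = 0"
    proof (rule eigenvector_definite_splitting[OF aE subE])
      show "a (?S p + ?S n) y = complex_of_real (c b) * cinner (?S p + ?S n) y" if "y \<in> E" for y
        using c[OF b(1) that] eq by simp
      show "?S p \<noteq> 0 \<Longrightarrow> c b < rayleigh a (?S p)"
        using close[OF pn(1)] pn(4) S.zero by (smt (verit))
      show "?S n \<noteq> 0 \<Longrightarrow> rayleigh a (?S n) < c b"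
        using close[OF pn(2)] pn(5) S.zero by (smt (verit))
    qed (use orth_proj_in[OF E(1)] in auto)
    then show False using B(2) b(1) eq by (force simp: orthonormal_def)
  qed
  ultimately show ?thesis
    by (intro hausdorff_distance_le) (auto simp: ritzE ritzF)
qed

section \<open>The form on eigenvectors\<close>

lemma possemidef_negative_eigenvector:
  assumes "possemidef_op D P" "w \<in> D" "P w = complex_of_real (- c) *\<^sub>C w" "0 < c"
  shows "w = 0"
proof -
  have "0 \<le> Re (cinner (P w) w)" using assms(1,2) by (simp add: possemidef_op_def)
  also have "\<dots> = - c * (norm w)\<^sup>2"
    unfolding assms(3) by (simp add: cinner_scaleC_left cinner_self del: of_real_minus)
  finally show ?thesis using assms(4) mult_pos_pos[of c "(norm w)\<^sup>2"] by fastforce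
qed

text \<open>From \<open>A = U P = P U\<close> and \<open>U\<^sup>2 = 1\<close> on the range of \<open>P\<close> one gets \<open>P x = l U x\<close> and
  \<open>P (U x) = l x\<close>.  So \<open>U x - sgn l x\<close> is an eigenvector of \<open>P\<close> for \<open>- \<bar>l\<bar>\<close>, and \<open>P\<close>, being positive,
  has none.  This avoids the uniqueness of the polar decomposition and any functional calculus.\<close>

lemma polar_decomposition_eigenvector:
  assumes polar: "polar_decomposition D A U P" and x: "x \<in> D" "A x = complex_of_real l *\<^sub>C x"
  shows "P x = complex_of_real \<bar>l\<bar> *\<^sub>C x" "U x = complex_of_real (sgn l) *\<^sub>C x"
proof -
  have P: "possemidef_op D P" and linU: "linear_op UNIV U"
    and symU: "\<And>x y. cinner (U x) y = cinner x (U y)"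
    using polar by (simp_all add: polar_decomposition_def selfadjoint_op_def)
  have iso: "norm (U x) = norm x" if "\<And>y. U y = 0 \<Longrightarrow> cinner x y = 0" for x
    using polar that unfolding polar_decomposition_def partial_isometry_def by blast
  have "{x. U x = 0} = {x\<in>D. P x = 0}" "{x. U x \<in> D} = D"
    and UP: "\<And>x. x \<in> D \<Longrightarrow> A x = U (P x)" and PU: "\<And>x. x \<in> D \<Longrightarrow> A x = P (U x)"
    using polar unfolding polar_decomposition_def by blast+
  then have ker: "U x = 0 \<longleftrightarrow> x \<in> D \<and> P x = 0" and UD: "U x \<in> D \<longleftrightarrow> x \<in> D" for x
    by blast+
  have linP: "linear_op D P" and symP: "\<And>x y. x \<in> D \<Longrightarrow> y \<in> D \<Longrightarrow> cinner (P x) y = cinner x (P y)"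
    using P by (auto simp: possemidef_op_def selfadjoint_op_def)
  note subD = linear_op_subspace[OF linP]
  have "P x = complex_of_real \<bar>l\<bar> *\<^sub>C x \<and> U x = complex_of_real (sgn l) *\<^sub>C x"
  proof (cases "l = 0")
    case True
    then have "U (P x) = 0" using UP x by simp
    then have "P x \<in> D" "P (P x) = 0" using ker by auto
    then have "cinner (P x) (P x) = 0" using symP[of "P x" x] x by simp
    then have "P x = 0" by simp
    then show ?thesis using ker x True by simp
  next
    case False
    have ran: "norm (U (U z)) = norm (U z)" for z
      by (rule iso) (simp add: symU)
    have sq: "U (U z) = z" if "norm (U z) = norm z" for z
    proof -
      have "Re (cinner (U (U z)) z) = (norm (U z))\<^sup>2"
        by (simp add: symU[of "U z"] cinner_self)
      then have "(norm (U (U z) - z))\<^sup>2 = 0"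
        using norm_add_sq[of "U (U z)" "- z"] ran[of z] that by simp
      then show ?thesis by simp
    qed
    have "norm (U (P x)) = norm (P x)"
      by (rule iso) (use ker symP x in auto)
    then have "P x = U (U (P x))" using sq by simp
    also have "\<dots> = complex_of_real l *\<^sub>C U x"
      unfolding UP[OF x(1), symmetric] x(2) using linear_op_scale[OF linU, of x] by simp
    finally have Px: "P x = complex_of_real l *\<^sub>C U x" .
    have PUx: "P (U x) = complex_of_real l *\<^sub>C x" using PU x by simp
    define w where "w = U x - complex_of_real (sgn l) *\<^sub>C x"
    have wD: "w \<in> D" unfolding w_def
      by (intro complex_vector.subspace_diff subD complex_vector.subspace_scale x) (use UD x in auto)
    have abs: "complex_of_real \<bar>l\<bar> = complex_of_real (sgn l) * complex_of_real l"
      "complex_of_real l = complex_of_real \<bar>l\<bar> * complex_of_real (sgn l)"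
      by (simp_all add: abs_sgn mult.commute flip: of_real_mult) (simp add: sgn_mult_abs)?
    have "P w = P (U x) - complex_of_real (sgn l) *\<^sub>C P x"
      unfolding w_def using linear_op_diff[OF linP] linear_op_scale[OF linP] UD x
        complex_vector.subspace_scale[OF subD] by simp
    also have "\<dots> = complex_of_real (- \<bar>l\<bar>) *\<^sub>C w"
      unfolding Px PUx w_def
      using abs by (simp add: complex_vector.scale_right_diff_distrib)
    finally have "w = 0"
      using False by (intro possemidef_negative_eigenvector[OF P wD]) auto
    then have Ux: "U x = complex_of_real (sgn l) *\<^sub>C x" by (simp add: w_def)
    show ?thesis
      unfolding Px Ux abs(1) by (simp only: scaleC_scaleC mult.commute simp_thms)
  qed
  then show "P x = complex_of_real \<bar>l\<bar> *\<^sub>C x" "U x = complex_of_real (sgn l) *\<^sub>C x" by auto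
qed

text \<open>Again \<open>T x - c x\<close> would be an eigenvector of the positive operator \<open>T\<close> for the value \<open>- c\<close>.\<close>

lemma sqrt_op_eigenvector:
  assumes T: "sqrt_op D P D' T" and x: "x \<in> D" "P x = complex_of_real (c\<^sup>2) *\<^sub>C x" "0 \<le> c"
  shows "T x = complex_of_real c *\<^sub>C x"
proof -
  have pos: "possemidef_op D' T" and "{x\<in>D'. T x \<in> D'} = D"
    and TT: "\<And>x. x \<in> D \<Longrightarrow> T (T x) = P x"
    using T unfolding sqrt_op_def by blast+
  then have D: "x \<in> D' \<and> T x \<in> D' \<longleftrightarrow> x \<in> D" for x
    by blast
  have lin: "linear_op D' T" and sym: "\<And>x y. x \<in> D' \<Longrightarrow> y \<in> D' \<Longrightarrow> cinner (T x) y = cinner x (T y)"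
    using pos by (auto simp: possemidef_op_def selfadjoint_op_def)
  note sub = linear_op_subspace[OF lin]
  have xD': "x \<in> D'" "T x \<in> D'" using D x by auto
  show ?thesis
  proof (cases "c = 0")
    case True
    then have "cinner (T x) (T x) = 0" using sym[of "T x" x] xD' TT x by simp
    with True show ?thesis by simp
  next
    case False
    define w where "w = T x - complex_of_real c *\<^sub>C x"
    have "T w = T (T x) - complex_of_real c *\<^sub>C T x"
      unfolding w_def using linear_op_diff[OF lin] linear_op_scale[OF lin] xD'
        complex_vector.subspace_scale[OF sub] by simp
    also have "\<dots> = complex_of_real (- c) *\<^sub>C w"
      using TT x by (simp add: w_def complex_vector.scale_right_diff_distrib power2_eq_square)
    finally have "w = 0"
      using False x by (intro possemidef_negative_eigenvector[OF pos _ _, of w c])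
        (auto simp: w_def intro!: complex_vector.subspace_diff sub complex_vector.subspace_scale xD')
    then show ?thesis by (simp add: w_def)
  qed
qed

lemma form_of_eigenvector:
  assumes "polar_decomposition D A U P" "sqrt_op D P D' T" "x \<in> D" "A x = complex_of_real l *\<^sub>C x"
      "y \<in> D'"
  shows "form_of U T x y = complex_of_real l * cinner x y"
proof -
  let ?c = "sqrt \<bar>l\<bar>"
  note PU = polar_decomposition_eigenvector[OF assms(1,3,4)]
  have Tx: "T x = complex_of_real ?c *\<^sub>C x"
    by (rule sqrt_op_eigenvector[OF assms(2,3)]) (use PU in auto)
  have "linear_op UNIV U" using assms(1) by (auto simp: polar_decomposition_def selfadjoint_op_def)
  then have "U (T x) = (complex_of_real ?c * complex_of_real (sgn l)) *\<^sub>C x"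
    unfolding Tx using linear_op_scale[of UNIV U x] PU(2) by simp
  moreover have "x \<in> D'" "cinner x (T y) = cinner (T x) y"
    using assms(2,3,5) by (auto simp: sqrt_op_def possemidef_op_def selfadjoint_op_def)
  ultimately have "form_of U T x y = complex_of_real (?c * sgn l * ?c) * cinner x y"
    by (simp add: form_of_def Tx cinner_scaleC_left)
  also have "?c * sgn l * ?c = l"
    using real_sqrt_mult_self[of "\<bar>l\<bar>"] by (metis abs_abs mult.assoc mult.commute mult_sgn_abs)
  finally show ?thesis .
qed

lemma hermitian_form_of:
  assumes "polar_decomposition D A U P" "sqrt_op D P D' T"
  shows "hermitian_form_on D' (form_of U T)"
proof -
  have linU: "linear_op UNIV U" and symU: "\<And>x y. cinner (U x) y = cinner x (U y)"
    using assms(1) by (auto simp: polar_decomposition_def selfadjoint_op_def)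
  have lin: "linear_op D' T"
    using assms(2) by (auto simp: sqrt_op_def possemidef_op_def selfadjoint_op_def)
  have "form_of U T x y = cnj (form_of U T y x)" for x y
    unfolding form_of_def using symU cinner_commute by metis
  moreover have "form_of U T (x + y) u = form_of U T x u + form_of U T y u"
    "form_of U T (c *\<^sub>C x) u = c * form_of U T x u" if "x \<in> D'" "y \<in> D'" for x y u c
    using that by (simp_all add: form_of_def linear_op_add[OF lin] linear_op_scale[OF lin]
        linear_op_add[OF linU] linear_op_scale[OF linU] cinner_add_left cinner_scaleC_left)
  ultimately show ?thesis
    unfolding hermitian_form_on_def by blast
qed

section \<open>Riemann-Stieltjes sums along rectifiable paths\<close>

definition rs_sum :: "(real \<Rightarrow> complex) \<Rightarrow> (complex \<Rightarrow> complex) \<Rightarrow> (real \<times> real set) set \<Rightarrow> complex" where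
  "rs_sum g f p = (\<Sum>(t, K)\<in>p. (g (Sup K) - g (Inf K)) * f (g t))"

text \<open>The explicit bound \<open>L\<close> enters the error estimates below.\<close>

definition variation_le :: "(real \<Rightarrow> complex) \<Rightarrow> real \<Rightarrow> bool" where
  "variation_le g L \<longleftrightarrow> (\<forall>d. d division_of {0..1} \<longrightarrow> (\<Sum>K\<in>d. cmod (g (Sup K) - g (Inf K))) \<le> L)"

lemma variation_le_tagged:
  assumes "variation_le g L" "p tagged_division_of {0..1}"
  shows "(\<Sum>(t, K)\<in>p. cmod (g (Sup K) - g (Inf K))) \<le> L"
proof -
  \<comment> \<open>\<open>sum.over_tagged_division_lemma\<close> asks for the value \<open>0\<close> on every degenerate interval, the empty
    one included\<close>
  let ?d = "\<lambda>K. if K = {} then 0 else cmod (g (Sup K) - g (Inf K))"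
  have "(\<Sum>(t, K)\<in>p. cmod (g (Sup K) - g (Inf K))) = (\<Sum>(t, K)\<in>p. ?d K)"
    using assms(2) by (intro sum.cong) auto
  also have "\<dots> = (\<Sum>K\<in>snd ` p. ?d K)"
    using assms(2) by (rule sum.over_tagged_division_lemma) auto
  also have "\<dots> = (\<Sum>K\<in>snd ` p. cmod (g (Sup K) - g (Inf K)))"
    using assms(2) by (intro sum.cong) auto
  also have "\<dots> \<le> L"
    using assms division_of_tagged_division by (auto simp: variation_le_def)
  finally show ?thesis .
qed

lemma tagged_division_interval:
  assumes "p tagged_division_of {0..1::real}" "(t, K) \<in> p"
  obtains a b where "K = {a..b}" "a \<le> b" "0 \<le> a" "b \<le> 1" "t \<in> {a..b}" "Sup K = b" "Inf K = a"
proof -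
  obtain a b where K: "K = cbox a b" "t \<in> K" "K \<subseteq> {0..1}"
    using assms tagged_division_ofD(2,3,4) by metis
  then have "a \<le> b" by auto
  with K that[of a b] show thesis by auto
qed

text \<open>On the ball \<open>f\<close> has a primitive \<open>\<Phi>\<close>.  The integral of \<open>f\<close> along a nearby smooth path \<open>h\<close> is
  \<open>\<Phi>(h b) - \<Phi>(h a)\<close>, which is close to \<open>\<Phi>(g b) - \<Phi>(g a)\<close>; and that differs from
  \<open>f(g t) (g b - g a)\<close> by at most \<open>e \<bar>g b - g a\<bar>\<close>, by the mean value inequality for \<open>\<Phi> - f(g t)\<close>.  So only
  the endpoints of \<open>g\<close> matter, and no derivative of \<open>g\<close>.\<close>

lemma rs_term_bound:
  assumes "f holomorphic_on ball (g t) r" "\<And>w. w \<in> ball (g t) r \<Longrightarrow> cmod (f w - f (g t)) \<le> e"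
    and g: "continuous_on {a..b} g" "g ` {a..b} \<subseteq> ball (g t) r" and "a \<le> b" and "0 < \<eta>"
  shows "\<exists>d>0. \<forall>h h'. (\<forall>s\<in>{a..b}. cmod (h s - g s) < d) \<longrightarrow>
      (\<forall>s\<in>{a..b}. (h has_vector_derivative h' s) (at s within {a..b})) \<longrightarrow>
      (\<exists>I. ((\<lambda>s. f (h s) * h' s) has_integral I) {a..b} \<and>
        cmod ((g b - g a) * f (g t) - I) \<le> e * cmod (g b - g a) + \<eta>)"
proof -
  let ?B = "ball (g t) r"
  obtain \<Phi> where \<Phi>: "\<And>w. w \<in> ?B \<Longrightarrow> (\<Phi> has_field_derivative f w) (at w)"
    using holomorphic_convex_primitive'[OF convex_ball open_ball assms(1)]
    by (metis at_within_open open_ball)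
  have bd: "cmod ((\<Phi> v - f (g t) * v) - (\<Phi> u - f (g t) * u)) \<le> e * cmod (v - u)"
    if "u \<in> ?B" "v \<in> ?B" for u v
  proof (rule field_differentiable_bound[where f' = "\<lambda>w. f w - f (g t)"])
    fix w assume "w \<in> ?B"
    then show "((\<lambda>w. \<Phi> w - f (g t) * w) has_field_derivative f w - f (g t)) (at w within ?B)"
      using DERIV_diff[OF \<Phi> DERIV_cmult[OF DERIV_ident, of "f (g t)"]]
      by (auto intro: has_field_derivative_at_within)
  qed (use assms that in auto)
  have "a \<in> {a..b}" "b \<in> {a..b}" using \<open>a \<le> b\<close> by auto
  then have ab: "g a \<in> ?B" "g b \<in> ?B" using g(2) by blast+
  have cont: "continuous (at w) \<Phi>" if "w \<in> ?B" for w
    using \<Phi>[OF that] DERIV_isCont by blast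
  have "\<exists>d>0. \<forall>w. cmod (w - v) < d \<longrightarrow> cmod (\<Phi> w - \<Phi> v) < \<eta> / 2" if "v \<in> ?B" for v
    using cont[OF that] \<open>0 < \<eta>\<close> unfolding continuous_at_eps_delta dist_norm by (meson half_gt_zero)
  from this[OF ab(1)] this[OF ab(2)] obtain d1 d2 where
    d1: "0 < d1" "\<And>w. cmod (w - g a) < d1 \<Longrightarrow> cmod (\<Phi> w - \<Phi> (g a)) < \<eta> / 2" and
    d2: "0 < d2" "\<And>w. cmod (w - g b) < d2 \<Longrightarrow> cmod (\<Phi> w - \<Phi> (g b)) < \<eta> / 2" by blast
  have "compact (g ` {a..b})" using g(1) by (intro compact_continuous_image) auto
  then obtain d3 where d3: "0 < d3" "(\<Union>x\<in>g ` {a..b}. ball x d3) \<subseteq> ?B"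
    using compact_subset_open_imp_ball_epsilon_subset[of "g ` {a..b}" ?B] g(2) by auto
  show ?thesis
  proof (intro exI[of _ "min d1 (min d2 d3)"] conjI allI impI)
    show "0 < min d1 (min d2 d3)" using d1 d2 d3 by simp
    fix h h' assume h: "\<forall>s\<in>{a..b}. cmod (h s - g s) < min d1 (min d2 d3)"
      and h': "\<forall>s\<in>{a..b}. (h has_vector_derivative h' s) (at s within {a..b})"
    have hB: "h s \<in> ?B" if "s \<in> {a..b}" for s
    proof -
      have "h s \<in> ball (g s) d3" using h that by (simp add: dist_norm norm_minus_commute)
      then show ?thesis using d3(2) that by blast
    qed
    have "((\<lambda>s. f (h s) * h' s) has_integral \<Phi> (h b) - \<Phi> (h a)) {a..b}"
    proof (rule fundamental_theorem_of_calculus[OF \<open>a \<le> b\<close>, where f = "\<lambda>s. \<Phi> (h s)"])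
      fix s assume s: "s \<in> {a..b}"
      have "((\<Phi> \<circ> h) has_vector_derivative h' s * f (h s)) (at s within {a..b})"
        by (intro field_vector_diff_chain_within has_field_derivative_at_within[OF \<Phi>[OF hB[OF s]]])
          (use h' s in blast)
      then show "((\<lambda>s. \<Phi> (h s)) has_vector_derivative f (h s) * h' s) (at s within {a..b})"
        by (simp add: o_def mult.commute)
    qed
    moreover have "cmod ((g b - g a) * f (g t) - (\<Phi> (h b) - \<Phi> (h a))) \<le> e * cmod (g b - g a) + \<eta>"
    proof -
      have "cmod (\<Phi> (h a) - \<Phi> (g a)) < \<eta> / 2" "cmod (\<Phi> (h b) - \<Phi> (g b)) < \<eta> / 2"
        using h \<open>a \<le> b\<close> d1(2) d2(2) by auto
      moreover have eq: "(g b - g a) * f (g t) - (\<Phi> (h b) - \<Phi> (h a)) =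
          (\<Phi> (h a) - \<Phi> (g a)) - (\<Phi> (h b) - \<Phi> (g b))
          - ((\<Phi> (g b) - f (g t) * g b) - (\<Phi> (g a) - f (g t) * g a))"
        by (simp add: algebra_simps)
      ultimately show ?thesis
        unfolding eq using bd[OF ab] norm_triangle_ineq4[of "(\<Phi> (h a) - \<Phi> (g a)) - (\<Phi> (h b) - \<Phi> (g
            b))"
            "(\<Phi> (g b) - f (g t) * g b) - (\<Phi> (g a) - f (g t) * g a)"]
          norm_triangle_ineq4[of "\<Phi> (h a) - \<Phi> (g a)" "\<Phi> (h b) - \<Phi> (g b)"] by linarith
    qed
    ultimately show "\<exists>I. ((\<lambda>s. f (h s) * h' s) has_integral I) {a..b} \<and>
        cmod ((g b - g a) * f (g t) - I) \<le> e * cmod (g b - g a) + \<eta>" by blast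
  qed
qed

text \<open>The local errors \<open>e \<bar>g b - g a\<bar>\<close> add up to at most \<open>e L\<close>; the errors from replacing \<open>g\<close> by \<open>h\<close> at the
  endpoints are shared out over the finitely many intervals of the given division.\<close>

lemma rs_sum_near_contour_integral:
  assumes g: "path g" "variation_le g L" and p: "p tagged_division_of {0..1}"
    and fine: "\<And>t K. (t, K) \<in> p \<Longrightarrow> g ` K \<subseteq> ball (g t) r"
    and f: "\<And>t. t \<in> {0..1} \<Longrightarrow> f holomorphic_on ball (g t) r"
      "\<And>t w. t \<in> {0..1} \<Longrightarrow> w \<in> ball (g t) r \<Longrightarrow> cmod (f w - f (g t)) \<le> e"
    and "0 < \<eta>" "0 \<le> e"
  obtains d where "0 < d"
    "\<And>h. polynomial_function h \<Longrightarrow> (\<And>s. s \<in> {0..1} \<Longrightarrow> cmod (h s - g s) < d) \<Longrightarrow>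
      cmod (rs_sum g f p - contour_integral h f) \<le> e * L + \<eta>"
proof -
  have fin: "finite p" using p by blast
  define \<eta>' where "\<eta>' = \<eta> / (card p + 1)"
  have \<eta>': "0 < \<eta>'" using \<open>0 < \<eta>\<close> by (simp add: \<eta>'_def)
  define good where "good x d \<longleftrightarrow> (\<forall>h h'. (\<forall>s\<in>snd x. cmod (h s - g s) < d) \<longrightarrow>
      (\<forall>s\<in>snd x. (h has_vector_derivative h' s) (at s within snd x)) \<longrightarrow>
      (\<exists>I. ((\<lambda>s. f (h s) * h' s) has_integral I) (snd x) \<and>
        cmod ((g (Sup (snd x)) - g (Inf (snd x))) * f (g (fst x)) - I)
          \<le> e * cmod (g (Sup (snd x)) - g (Inf (snd x))) + \<eta>'))" for x d
  have "\<exists>d>0. good x d" if xp: "x \<in> p" for x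
  proof -
    obtain t K where x: "x = (t, K)" by fastforce
    from tagged_division_interval[OF p] xp x obtain a b where K: "K = {a..b}" "a \<le> b" "0 \<le> a" "b \<le> 1"
      "t \<in> {a..b}" "Sup K = b" "Inf K = a" by metis
    have t: "t \<in> {0..1}" using K by auto
    have "continuous_on {a..b} g"
      using g(1) K unfolding path_def by (auto intro: continuous_on_subset)
    moreover have "g ` {a..b} \<subseteq> ball (g t) r" using fine[of t K] xp x K by simp
    ultimately show ?thesis
      using rs_term_bound[of f g t r e a b \<eta>', OF f(1)[OF t] f(2)[OF t] _ _ K(2) \<eta>'] K
      by (simp add: good_def x)
  qed
  then obtain D where D: "\<And>x. x \<in> p \<Longrightarrow> 0 < D x \<and> good x (D x)" by metis
  define d where "d = Min (insert 1 (D ` p))"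
  have d: "0 < d" "\<And>x. x \<in> p \<Longrightarrow> d \<le> D x"
    using D fin by (auto simp: d_def)
  moreover have "cmod (rs_sum g f p - contour_integral h f) \<le> e * L + \<eta>"
    if h: "polynomial_function h" "\<And>s. s \<in> {0..1} \<Longrightarrow> cmod (h s - g s) < d" for h
  proof -
    obtain h' where h': "\<And>s. (h has_vector_derivative h' s) (at s)"
      using has_vector_derivative_polynomial_function[OF h(1)] by metis
    have ex: "\<exists>I. ((\<lambda>s. f (h s) * h' s) has_integral I) (snd x) \<and>
        cmod ((g (Sup (snd x)) - g (Inf (snd x))) * f (g (fst x)) - I)
          \<le> e * cmod (g (Sup (snd x)) - g (Inf (snd x))) + \<eta>'" if "x \<in> p" for x
    proof -
      have "snd x \<subseteq> {0..1}"
        using that tagged_division_ofD(3)[OF p] by (metis prod.collapse)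
      then have "\<forall>s\<in>snd x. cmod (h s - g s) < D x"
        using h(2) d(2)[OF that] by fastforce
      moreover have "\<forall>s\<in>snd x. (h has_vector_derivative h' s) (at s within snd x)"
        using h' has_vector_derivative_at_within by blast
      ultimately show ?thesis
        using D[OF that] unfolding good_def by blast
    qed
    define I where "I x = (SOME I. ((\<lambda>s. f (h s) * h' s) has_integral I) (snd x) \<and>
        cmod ((g (Sup (snd x)) - g (Inf (snd x))) * f (g (fst x)) - I)
          \<le> e * cmod (g (Sup (snd x)) - g (Inf (snd x))) + \<eta>')" for x
    have I: "((\<lambda>s. f (h s) * h' s) has_integral I x) (snd x)"
      "cmod ((g (Sup (snd x)) - g (Inf (snd x))) * f (g (fst x)) - I x)
          \<le> e * cmod (g (Sup (snd x)) - g (Inf (snd x))) + \<eta>'" if "x \<in> p" for x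
      using someI_ex[OF ex[OF that]] unfolding I_def by auto
    have "((\<lambda>s. f (h s) * h' s) has_integral (\<Sum>(t, K)\<in>p. integral K (\<lambda>s. f (h s) * h' s))) {0..1}"
    proof (rule has_integral_combine_tagged_division[OF p])
      fix t K assume "(t, K) \<in> p"
      from I(1)[OF this] show "((\<lambda>s. f (h s) * h' s) has_integral integral K (\<lambda>s. f (h s) * h' s)) K"
        by (auto intro: integrable_integral)
    qed
    then have int: "((\<lambda>s. f (h s) * h' s) has_integral
        (\<Sum>x\<in>p. integral (snd x) (\<lambda>s. f (h s) * h' s))) {0..1}"
      by (simp add: case_prod_unfold)
    have "(f has_contour_integral (\<Sum>x\<in>p. I x)) h"
    proof -
      have "vector_derivative h (at s within {0..1}) = h' s" if "s \<in> {0..1}" for s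
        using that by (intro vector_derivative_within_closed_interval
            has_vector_derivative_at_within[OF h']) auto
      moreover have "(\<Sum>x\<in>p. integral (snd x) (\<lambda>s. f (h s) * h' s)) = (\<Sum>x\<in>p. I x)"
        using I(1) by (intro sum.cong) (auto intro: integral_unique)
      ultimately have "((\<lambda>s. f (h s) * vector_derivative h (at s within {0..1}))
          has_integral (\<Sum>x\<in>p. I x)) {0..1}"
        using int by (subst has_integral_cong[where g = "\<lambda>s. f (h s) * h' s"]) auto
      then show ?thesis unfolding has_contour_integral_def .
    qed
    then have "rs_sum g f p - contour_integral h f =
        (\<Sum>x\<in>p. (g (Sup (snd x)) - g (Inf (snd x))) * f (g (fst x)) - I x)"
      by (simp add: rs_sum_def case_prod_unfold contour_integral_unique sum_subtractf)
    also have "cmod \<dots> \<le> (\<Sum>x\<in>p. e * cmod (g (Sup (snd x)) - g (Inf (snd x))) + \<eta>')"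
      by (intro sum_norm_le I(2))
    also have "\<dots> = e * (\<Sum>(t, K)\<in>p. cmod (g (Sup K) - g (Inf K))) + card p * \<eta>'"
      by (simp add: sum.distrib sum_distrib_left case_prod_unfold)
    also have "\<dots> \<le> e * L + \<eta>"
    proof (rule add_mono)
      show "e * (\<Sum>(t, K)\<in>p. cmod (g (Sup K) - g (Inf K))) \<le> e * L"
        using variation_le_tagged[OF g(2) p] \<open>0 \<le> e\<close> by (rule mult_left_mono)
      show "card p * \<eta>' \<le> \<eta>"
        using \<open>0 < \<eta>\<close> by (simp add: \<eta>'_def field_simps)
    qed
    finally show ?thesis .
  qed
  ultimately show thesis using that by blast
qed

text \<open>In \<open>rs_sum_near_contour_integral\<close> the path depends on \<open>\<eta>\<close> and on the division, but all loops near
  \<open>g\<close> give the same integral of a function holomorphic on \<open>U\<close>.  So one polynomial loop \<open>h\<close> serves for all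
  functions and divisions, and \<open>\<eta>\<close> can tend to \<open>0\<close>.\<close>

lemma rs_sum_approximates_contour_integral:
  assumes g: "path g" "variation_le g L" "pathfinish g = pathstart g"
    and U: "open U" "path_image g \<subseteq> U"
  obtains h where "polynomial_function h" "pathfinish h = pathstart h" "path_image h \<subseteq> U"
    "\<And>w. w \<notin> U \<Longrightarrow> winding_number h w = winding_number g w"
    "\<And>f r e p. f holomorphic_on U \<Longrightarrow> p tagged_division_of {0..1} \<Longrightarrow>
      (\<And>t K. (t, K) \<in> p \<Longrightarrow> g ` K \<subseteq> ball (g t) r) \<Longrightarrow>
      (\<And>t. t \<in> {0..1} \<Longrightarrow> ball (g t) r \<subseteq> U) \<Longrightarrow>
      (\<And>t w. t \<in> {0..1} \<Longrightarrow> w \<in> ball (g t) r \<Longrightarrow> cmod (f w - f (g t)) \<le> e) \<Longrightarrow>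
      0 < r \<Longrightarrow> cmod (rs_sum g f p - contour_integral h f) \<le> e * L"
proof -
  obtain d1 where d1: "0 < d1" and near:
    "\<And>h k. valid_path h \<Longrightarrow> valid_path k \<Longrightarrow> \<forall>t\<in>{0..1}. cmod (h t - g t) < d1 \<and> cmod (k t - g t) < d1 \<Longrightarrow>
      pathstart k = pathstart h \<Longrightarrow> pathfinish k = pathfinish h \<Longrightarrow>
      path_image h \<subseteq> U \<and> path_image k \<subseteq> U \<and> (\<forall>f. f holomorphic_on U \<longrightarrow> contour_integral k f
          = contour_integral h f)"
    using contour_integral_nearby_ends[OF U(1) g(1) U(2)] by metis
  obtain d2 where d2: "0 < d2" "(\<Union>x\<in>path_image g. ball x d2) \<subseteq> U"
    using compact_subset_open_imp_ball_epsilon_subset[OF compact_path_image[OF g(1)] U] by auto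
  have ex: "\<exists>h. polynomial_function h \<and> pathstart h = pathstart g \<and> pathfinish h = pathfinish g \<and>
      (\<forall>t\<in>{0..1}. cmod (h t - g t) < d)" if "0 < d" for d
    using path_approx_polynomial_function[OF g(1) that] by metis
  obtain h where h: "polynomial_function h" "pathstart h = pathstart g" "pathfinish h = pathfinish g"
    "\<forall>t\<in>{0..1}. cmod (h t - g t) < min d1 d2"
    using ex[of "min d1 d2"] d1 d2 by auto
  have vh: "valid_path h" using h(1) by (rule valid_path_polynomial_function)
  show thesis
  proof (rule that[OF h(1)])
    show "pathfinish h = pathstart h" using h g by simp
    show "path_image h \<subseteq> U" using near[OF vh vh] h by simp
    show "winding_number h w = winding_number g w" if "w \<notin> U" for w
    proof (rule winding_number_nearby_loops_eq[OF g(1) valid_path_imp_path[OF vh] g(3)])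
      show "pathfinish h = pathstart h" using h g by simp
      fix t :: real assume t: "t \<in> {0..1}"
      have "g t \<in> path_image g" using t by (simp add: path_image_def)
      then have "w \<notin> ball (g t) d2" using that d2(2) by blast
      then show "cmod (h t - g t) < cmod (g t - w)" using h(4) t by (fastforce simp: dist_norm)
    qed
    fix f r e p
    assume f: "f holomorphic_on U" and p: "p tagged_division_of {0..1}"
      and fine: "\<And>t K. (t, K) \<in> p \<Longrightarrow> g ` K \<subseteq> ball (g t) r"
      and r: "\<And>t. t \<in> {0..1} \<Longrightarrow> ball (g t) r \<subseteq> U"
      and e: "\<And>t w. t \<in> {0..1} \<Longrightarrow> w \<in> ball (g t) r \<Longrightarrow> cmod (f w - f (g t)) \<le> e" and "0 < r"
    have e0: "0 \<le> e" using e[of 0 "g 0"] \<open>0 < r\<close> by simp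
    show "cmod (rs_sum g f p - contour_integral h f) \<le> e * L"
    proof (rule field_le_epsilon)
      fix \<eta> :: real assume "0 < \<eta>"
      from rs_sum_near_contour_integral[OF g(1,2) p fine holomorphic_on_subset[OF f r] e this e0]
      obtain d where d: "0 < d" "\<And>k. polynomial_function k \<Longrightarrow> (\<And>s. s \<in> {0..1} \<Longrightarrow> cmod (k s - g s) < d) \<Longrightarrow>
        cmod (rs_sum g f p - contour_integral k f) \<le> e * L + \<eta>" by blast
      \<comment> \<open>a second loop, so close to \<open>g\<close> that it suits the given division\<close>
      obtain k where k: "polynomial_function k" "pathstart k = pathstart g" "pathfinish k
          = pathfinish g"
        "\<forall>t\<in>{0..1}. cmod (k t - g t) < min d1 d"
        using ex[of "min d1 d"] d1 d by auto
      have "contour_integral k f = contour_integral h f"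
        using near[OF vh valid_path_polynomial_function[OF k(1)]] h k f by simp
      then show "cmod (rs_sum g f p - contour_integral h f) \<le> e * L + \<eta>"
        using d(2)[OF k(1)] k(4) by simp
    qed
  qed
qed

section \<open>Bounded operators on a Hilbert subspace\<close>

locale hilbert_on =
  fixes V :: "'a::complex_hilbert_space set" and ip :: "'a \<Rightarrow> 'a \<Rightarrow> complex" and C :: real
  assumes hilbert: "hilbert_space_on V ip"
    and C_pos: "0 < C"
    and embedding: "\<And>u. u \<in> V \<Longrightarrow> norm u \<le> C * norm_of ip u"
begin

abbreviation "nrm \<equiv> norm_of ip"

lemma subspace_V: "complex_vector.subspace V"
  using hilbert unfolding hilbert_space_on_def by (elim conjE)

lemma hermitian_ip: "hermitian_form_on V ip"
  using hilbert unfolding hilbert_space_on_def hermitian_form_on_def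
  by (elim conjE) (intro conjI; assumption)

lemmas V_add = complex_vector.subspace_add[OF subspace_V]
  and V_diff = complex_vector.subspace_diff[OF subspace_V]
  and V_scale = complex_vector.subspace_scale[OF subspace_V]
  and V_zero = complex_vector.subspace_0[OF subspace_V]
  and V_sum = complex_vector.subspace_sum[OF subspace_V]

lemmas ip_add_left = form_add_left[OF hermitian_ip subspace_V]
  and ip_add_right = form_add_right[OF hermitian_ip subspace_V]
  and ip_scale_left = form_scale_left[OF hermitian_ip subspace_V]
  and ip_scale_right = form_scale_right[OF hermitian_ip subspace_V]
  and ip_commute = form_commute[OF hermitian_ip subspace_V]
  and ip_sum_left = form_sum_left[OF hermitian_ip subspace_V]

lemma V_minus: "x \<in> V \<Longrightarrow> - x \<in> V"
  using V_scale[of x "-1"] by (simp add: scaleC_minus1)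

lemma ip_diff_left: "x \<in> V \<Longrightarrow> y \<in> V \<Longrightarrow> u \<in> V \<Longrightarrow> ip (x - y) u = ip x u - ip y u"
  using ip_add_left[of "x - y" y u] V_diff[of x y] by simp

lemma ip_self_pos:
  assumes "x \<in> V" "x \<noteq> 0"
  shows "0 < Re (ip x x)"
proof -
  have "\<forall>x\<in>V. x \<noteq> 0 \<longrightarrow> 0 < Re (ip x x)"
    using hilbert unfolding hilbert_space_on_def by (elim conjE)
  then show ?thesis using assms by blast
qed

lemma ip_zero_left: "u \<in> V \<Longrightarrow> ip 0 u = 0"
  using ip_scale_left[of 0 u 0] V_zero by simp

lemma ip_self_nonneg: "x \<in> V \<Longrightarrow> 0 \<le> Re (ip x x)"
  using ip_self_pos[of x] ip_zero_left[OF V_zero] by (cases "x = 0") auto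

lemma ip_self: assumes "x \<in> V" shows "ip x x = complex_of_real ((nrm x)\<^sup>2)"
proof -
  have "Im (ip x x) = Im (cnj (ip x x))"
    by (rule arg_cong[OF ip_commute[OF assms assms]])
  then have "Im (ip x x) = 0" by simp
  then show ?thesis
    using ip_self_nonneg[OF assms] by (simp add: norm_of_def complex_eq_iff)
qed

lemma nrm_sq: "x \<in> V \<Longrightarrow> (nrm x)\<^sup>2 = Re (ip x x)"
  using ip_self[of x] by simp

lemma nrm_nonneg: "x \<in> V \<Longrightarrow> 0 \<le> nrm x"
  by (simp add: norm_of_def ip_self_nonneg)

lemma nrm_zero [simp]: "nrm 0 = 0"
  by (simp add: norm_of_def ip_zero_left[OF V_zero])

lemma nrm_pos: "x \<in> V \<Longrightarrow> x \<noteq> 0 \<Longrightarrow> 0 < nrm x"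
  by (simp add: norm_of_def ip_self_pos)

lemma nrm_eq_0D: "x \<in> V \<Longrightarrow> nrm x \<le> 0 \<Longrightarrow> x = 0"
  using nrm_pos[of x] by linarith

lemma nrm_scale: assumes "x \<in> V" shows "nrm (c *\<^sub>C x) = cmod c * nrm x"
proof -
  have "ip (c *\<^sub>C x) (c *\<^sub>C x) = (c * cnj c) * ip x x"
    unfolding ip_scale_left[OF assms V_scale[OF assms]] ip_scale_right[OF assms assms]
    by (simp only: mult.assoc)
  also have "\<dots> = complex_of_real ((cmod c * nrm x)\<^sup>2)"
    by (simp only: complex_norm_square [symmetric] ip_self[OF assms] power_mult_distrib of_real_mult)
  finally have "(nrm (c *\<^sub>C x))\<^sup>2 = (cmod c * nrm x)\<^sup>2"
    using nrm_sq[OF V_scale[OF assms]] by simp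
  then show ?thesis
    using nrm_nonneg[OF assms] nrm_nonneg[OF V_scale[OF assms]] by (simp add: power2_eq_iff_nonneg)
qed

lemma nrm_add_sq:
  assumes "x \<in> V" "y \<in> V"
  shows "(nrm (x + y))\<^sup>2 = (nrm x)\<^sup>2 + (nrm y)\<^sup>2 + 2 * Re (ip x y)"
proof -
  have "Re (ip x y) = Re (cnj (ip y x))" by (rule arg_cong[OF ip_commute[OF assms]])
  then have "Re (ip y x) = Re (ip x y)" by simp
  then show ?thesis
    using assms V_add[OF assms] by (simp add: nrm_sq ip_add_left ip_add_right)
qed

lemma ip_cauchy_schwarz:
  assumes x: "x \<in> V" and y: "y \<in> V"
  shows "cmod (ip x y) \<le> nrm x * nrm y"
proof (cases "y = 0")
  case True
  have "ip x 0 = 0" using ip_scale_right[OF x x, of 0] by simp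
  with True show ?thesis by simp
next
  case False
  define c where "c = ip x y / ip y y"
  have pos: "0 < nrm y" by (rule nrm_pos[OF y False])
  then have yy: "ip y y \<noteq> 0" by (simp add: ip_self[OF y])
  define d where "d = c *\<^sub>C y"
  have d: "d \<in> V" "x - d \<in> V" using x y V_scale V_diff by (auto simp: d_def)
  have "ip (x - d) y = 0"
    using x y d yy ip_scale_left[OF y y, of c] by (simp add: ip_diff_left c_def d_def)
  then have "ip (x - d) d = 0"
    using ip_scale_right[OF d(2) y, of c] by (simp add: d_def)
  then have "(nrm d)\<^sup>2 \<le> (nrm x)\<^sup>2"
    using nrm_add_sq[OF d(2,1)] by simp
  then have "nrm d \<le> nrm x"
    by (rule power2_le_imp_le) (rule nrm_nonneg[OF x])
  moreover have "nrm d = cmod (ip x y) / nrm y"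
    using pos by (simp add: d_def nrm_scale[OF y] c_def norm_divide ip_self[OF y] norm_power
        power2_eq_square norm_mult)
  ultimately show ?thesis using pos by (simp add: divide_le_eq)
qed

lemma nrm_triangle:
  assumes "x \<in> V" "y \<in> V"
  shows "nrm (x + y) \<le> nrm x + nrm y"
proof (rule power2_le_imp_le)
  have "Re (ip x y) \<le> nrm x * nrm y"
    using ip_cauchy_schwarz[OF assms] complex_Re_le_cmod order_trans by blast
  then show "(nrm (x + y))\<^sup>2 \<le> (nrm x + nrm y)\<^sup>2"
    by (simp add: nrm_add_sq[OF assms] power2_sum)
  show "0 \<le> nrm x + nrm y" using nrm_nonneg assms by simp
qed

lemma nrm_minus: "x \<in> V \<Longrightarrow> nrm (- x) = nrm x"
  using nrm_scale[of x "-1"] by (simp add: scaleC_minus1)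

lemma nrm_diff_commute: "x \<in> V \<Longrightarrow> y \<in> V \<Longrightarrow> nrm (x - y) = nrm (y - x)"
  using nrm_minus[of "x - y"] V_diff by simp

lemma nrm_diff_triangle:
  assumes "x \<in> V" "y \<in> V" "u \<in> V"
  shows "nrm (x - y) \<le> nrm (x - u) + nrm (u - y)"
  using nrm_triangle[of "x - u" "u - y"] assms V_diff by simp

lemma nrm_diff_le: "x \<in> V \<Longrightarrow> y \<in> V \<Longrightarrow> nrm (x - y) \<le> nrm x + nrm y"
  using nrm_triangle[of x "- y"] V_minus nrm_minus by simp

lemma nrm_sum:
  assumes "\<And>i. i \<in> I \<Longrightarrow> f i \<in> V"
  shows "nrm (sum f I) \<le> (\<Sum>i\<in>I. nrm (f i))"
  using assms
proof (induction I rule: infinite_finite_induct)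
  case (insert i I)
  then have "nrm (f i + sum f I) \<le> nrm (f i) + nrm (sum f I)"
    by (intro nrm_triangle V_sum) auto
  also have "nrm (sum f I) \<le> (\<Sum>i\<in>I. nrm (f i))" using insert by simp
  finally show ?case using insert by simp
qed auto

text \<open>Reduces estimates of operator-valued integrals to estimates of scalar ones.\<close>

lemma nrm_le_by_duality:
  assumes x: "x \<in> V" and le: "\<And>w. w \<in> V \<Longrightarrow> cmod (ip x w) \<le> e * nrm w" and "0 \<le> e"
  shows "nrm x \<le> e"
proof (cases "x = 0")
  case False
  have "(nrm x)\<^sup>2 \<le> e * nrm x"
    using le[OF x] by (simp add: ip_self[OF x] norm_power)
  then show ?thesis using nrm_pos[OF x False] by (simp add: power2_eq_square)
qed (use \<open>0 \<le> e\<close> in simp)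

lemma eq_0_by_duality: "x \<in> V \<Longrightarrow> (\<And>w. w \<in> V \<Longrightarrow> ip x w = 0) \<Longrightarrow> x = 0"
  using nrm_le_by_duality[of x 0] nrm_eq_0D by simp

lemma complete:
  assumes "\<And>n::nat. X n \<in> V" "\<And>e. 0 < e \<Longrightarrow> \<exists>M. \<forall>m\<ge>M. \<forall>n\<ge>M. nrm (X m - X n) < e"
  obtains l where "l \<in> V" "(\<lambda>n. nrm (X n - l)) \<longlonglongrightarrow> 0"
proof -
  have "\<forall>X. (\<forall>n. X n \<in> V) \<and> (\<forall>e>0. \<exists>M. \<forall>m\<ge>M. \<forall>n\<ge>M. nrm (X m - X n) < e) \<longrightarrow>
      (\<exists>l\<in>V. (\<lambda>n::nat. nrm (X n - l)) \<longlonglongrightarrow> 0)"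
    using hilbert unfolding hilbert_space_on_def by (elim conjE)
  then have "\<exists>l\<in>V. (\<lambda>n. nrm (X n - l)) \<longlonglongrightarrow> 0" using assms by blast
  then show thesis using that by blast
qed

text \<open>The Neumann series, as the fixed-point iteration \<open>x = y + K x\<close>.\<close>

lemma neumann:
  assumes K: "linear_op V K" "\<And>u. u \<in> V \<Longrightarrow> K u \<in> V" "\<And>u. u \<in> V \<Longrightarrow> nrm (K u) \<le> q * nrm u"
    and q: "0 \<le> q" "q < 1" and y: "y \<in> V"
  obtains x where "x \<in> V" "x - K x = y"
proof -
  define X where "X = rec_nat 0 (\<lambda>_ x. y + K x)"
  have X0: "X 0 = 0" and XS: "X (Suc n) = y + K (X n)" for n by (simp_all add: X_def)
  have XV: "X n \<in> V" for n
    by (induction n) (use V_zero V_add y K(2) in \<open>auto simp: X0 XS\<close>)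
  define c where "c = nrm y / (1 - q)"
  have c: "0 \<le> c" using q nrm_nonneg[OF y] by (simp add: c_def)
  have bound: "nrm (X n) \<le> c" for n
  proof (induction n)
    case (Suc n)
    have "nrm (X (Suc n)) \<le> nrm y + nrm (K (X n))"
      unfolding XS by (intro nrm_triangle y K(2) XV)
    also have "nrm (K (X n)) \<le> q * c"
      using K(3)[OF XV[of n]] mult_left_mono[OF Suc q(1)] by linarith
    also have "nrm y + q * c = c" using q by (simp add: c_def field_simps)
    finally show ?case by simp
  qed (simp add: X0 c)
  have diff: "nrm (X (n + k) - X n) \<le> q ^ n * c" for n k
  proof (induction n)
    case 0
    show ?case using bound by (simp add: X0)
  next
    case (Suc n)
    have "X (Suc n + k) - X (Suc n) = K (X (n + k) - X n)"
      using linear_op_diff[OF K(1) XV XV] by (simp add: XS)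
    then have "nrm (X (Suc n + k) - X (Suc n)) \<le> q * nrm (X (n + k) - X n)"
      using K(3)[OF V_diff[OF XV XV]] by simp
    also have "\<dots> \<le> q * (q ^ n * c)" using Suc q by (intro mult_left_mono)
    finally show ?case by simp
  qed
  have lim: "(\<lambda>n. q ^ n * c) \<longlonglongrightarrow> 0"
    using tendsto_mult_right[OF LIMSEQ_power_zero[of q], of c] q by simp
  obtain x where x: "x \<in> V" "(\<lambda>n. nrm (X n - x)) \<longlonglongrightarrow> 0"
  proof (rule complete[of X])
    show "X n \<in> V" for n by (rule XV)
    fix e :: real assume "0 < e"
    then have "0 < e / 2" by simp
    from order_tendstoD(2)[OF lim this] obtain M where M: "q ^ M * c < e / 2"
      by (auto simp: eventually_sequentially)
    have "nrm (X m - X n) < e" if "M \<le> m" "M \<le> n" for m n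
    proof -
      have "nrm (X m - X n) \<le> nrm (X m - X M) + nrm (X M - X n)"
        by (intro nrm_diff_triangle XV)
      moreover have "nrm (X m - X M) \<le> q ^ M * c" "nrm (X n - X M) \<le> q ^ M * c"
        using diff[of M "m - M"] diff[of M "n - M"] that by simp_all
      ultimately show ?thesis
        using M nrm_diff_commute[OF XV XV, of M n] by linarith
    qed
    then show "\<exists>M. \<forall>m\<ge>M. \<forall>n\<ge>M. nrm (X m - X n) < e" by blast
  qed
  have le: "nrm (x - K x - y) \<le> nrm (X (Suc n) - x) + nrm (X n - x)" for n
  proof -
    have "x - K x - y = (K (X n) - K x) - (X (Suc n) - x)" by (simp add: XS)
    also have "K (X n) - K x = K (X n - x)"
      using linear_op_diff[OF K(1) XV x(1)] by simp
    finally have "nrm (x - K x - y) \<le> nrm (K (X n - x)) + nrm (X (Suc n) - x)"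
      by (metis nrm_diff_le K(2) V_diff XV x(1))
    also have "nrm (K (X n - x)) \<le> 1 * nrm (X n - x)"
      using K(3)[OF V_diff[OF XV x(1)]] q nrm_nonneg[OF V_diff[OF XV x(1)]]
      by (meson less_imp_le mult_right_mono order_trans)
    finally show ?thesis by simp
  qed
  have lim2: "(\<lambda>n. nrm (X (Suc n) - x) + nrm (X n - x)) \<longlonglongrightarrow> 0"
    using tendsto_add[OF LIMSEQ_Suc[OF x(2)] x(2)] by simp
  have "nrm (x - K x - y) \<le> 0"
    by (rule LIMSEQ_le_const[OF lim2]) (use le in blast)
  moreover have "x - K x - y \<in> V" by (intro V_diff x(1) K(2) y)
  ultimately have "x - K x - y = 0" by (intro nrm_eq_0D)
  then show thesis using that x(1) by simp
qed

abbreviation "res T \<equiv> resolvent_set_in V nrm V T"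
abbreviation "R T \<equiv> resolvent V T"

text \<open>Continuity is not included; where needed, it is stated by an explicit bound.\<close>

definition op_on :: "('a \<Rightarrow> 'a) \<Rightarrow> bool" where
  "op_on T \<longleftrightarrow> linear_op V T \<and> (\<forall>u\<in>V. T u \<in> V)"

lemma
  assumes "op_on T"
  shows op_on_linear: "linear_op V T" and op_on_in: "u \<in> V \<Longrightarrow> T u \<in> V"
  using assms by (auto simp: op_on_def)

definition res_bound :: "('a \<Rightarrow> 'a) \<Rightarrow> complex \<Rightarrow> real \<Rightarrow> bool" where
  "res_bound T z B \<longleftrightarrow> z \<in> res T \<and> (\<forall>y\<in>V. nrm (R T z y) \<le> B * nrm y)"

lemma res_boundD: "res_bound T z B \<Longrightarrow> y \<in> V \<Longrightarrow> nrm (R T z y) \<le> B * nrm y"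
  by (simp add: res_bound_def)

lemma res_bound_mono:
  assumes "res_bound T z B" "B \<le> B'" shows "res_bound T z B'"
proof -
  have "nrm (R T z y) \<le> B' * nrm y" if "y \<in> V" for y
    using res_boundD[OF assms(1) that] mult_right_mono[OF assms(2) nrm_nonneg[OF that]] by linarith
  with assms(1) show ?thesis by (simp add: res_bound_def)
qed

lemma ex_res_bound: assumes "z \<in> res T" obtains B where "0 < B" "res_bound T z B"
proof -
  obtain B where "\<forall>y\<in>V. nrm (R T z y) \<le> B * nrm y"
    using assms by (auto simp: resolvent_set_in_def)
  then have "res_bound T z B" using assms by (simp add: res_bound_def)
  then have "res_bound T z (max B 1)" by (rule res_bound_mono) simp
  then show thesis by (intro that[of "max B 1"]) auto
qed

lemma
  assumes "z \<in> res T"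
  shows R_in: "y \<in> V \<Longrightarrow> R T z y \<in> V"
    and R_right: "y \<in> V \<Longrightarrow> z *\<^sub>C R T z y - T (R T z y) = y"
    and R_left: "x \<in> V \<Longrightarrow> R T z (z *\<^sub>C x - T x) = x"
proof -
  have bij: "bij_betw (\<lambda>x. z *\<^sub>C x - T x) V V"
    using assms by (simp add: resolvent_set_in_def)
  then have inj: "inj_on (\<lambda>x. z *\<^sub>C x - T x) V" and img: "(\<lambda>x. z *\<^sub>C x - T x) ` V = V"
    by (auto simp: bij_betw_def)
  show "y \<in> V \<Longrightarrow> R T z y \<in> V"
    unfolding resolvent_def using the_inv_into_into[OF inj, of y V] img by auto
  show "y \<in> V \<Longrightarrow> z *\<^sub>C R T z y - T (R T z y) = y"
    unfolding resolvent_def using f_the_inv_into_f[OF inj, of y] img by simp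
  show "x \<in> V \<Longrightarrow> R T z (z *\<^sub>C x - T x) = x"
    unfolding resolvent_def by (rule the_inv_into_f_f[OF inj])
qed

lemma R_unique: "z \<in> res T \<Longrightarrow> x \<in> V \<Longrightarrow> z *\<^sub>C x - T x = y \<Longrightarrow> R T z y = x"
  using R_left by blast

lemma op_on_R: assumes "op_on T" "z \<in> res T" shows "op_on (R T z)"
proof -
  have "bij_betw (\<lambda>x. z *\<^sub>C x - T x) V V"
    using assms(2) by (simp add: resolvent_set_in_def)
  then have "linear_op V (R T z)"
    unfolding resolvent_def
    by (intro linear_op_the_inv_into linear_op_shift op_on_linear[OF assms(1)] subspace_V)
  then show ?thesis using R_in[OF assms(2)] by (simp add: op_on_def)
qed

text \<open>Injectivity comes from the lower bound, so a bounded inverse results from solvability and one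
  inequality.\<close>

lemma res_boundI:
  assumes T: "op_on T" and surj: "\<And>y. y \<in> V \<Longrightarrow> \<exists>x\<in>V. z *\<^sub>C x - T x = y"
    and lower: "\<And>x. x \<in> V \<Longrightarrow> nrm x \<le> B * nrm (z *\<^sub>C x - T x)"
  shows "res_bound T z B"
proof -
  let ?L = "\<lambda>x. z *\<^sub>C x - T x"
  have L: "linear_op V ?L" by (rule linear_op_shift[OF op_on_linear[OF T]])
  have inj: "inj_on ?L V"
    by (rule inj_on_linear_op[OF L]) (use lower nrm_eq_0D in force)
  have LV: "?L x \<in> V" if "x \<in> V" for x
    by (intro V_diff V_scale op_on_in[OF T] that)
  have img: "?L ` V = V"
  proof
    show "V \<subseteq> ?L ` V" using surj by fastforce
  qed (use LV in blast)
  have "nrm (R T z y) \<le> B * nrm y" if y: "y \<in> V" for y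
  proof -
    have "R T z y \<in> V" unfolding resolvent_def
      using the_inv_into_into[OF inj, of y V] img y by auto
    moreover have "?L (R T z y) = y" unfolding resolvent_def
      using f_the_inv_into_f[OF inj, of y] img y by simp
    ultimately show ?thesis using lower[of "R T z y"] by simp
  qed
  then show ?thesis
    using inj img unfolding res_bound_def resolvent_set_in_def bij_betw_def by auto
qed

text \<open>With \<open>D\<close> the difference of \<open>z' - T'\<close> and \<open>z - T\<close>, one has \<open>z' - T' = (1 + D R(z)) (z - T)\<close> and
  \<open>D R(z)\<close> has norm at most \<open>B e < 1\<close>.  Changing the point and changing the operator are treated together.\<close>

lemma resolvent_perturbation:
  assumes T: "op_on T" and B: "res_bound T z B" "0 \<le> B" and T': "op_on T'" and "0 \<le> e" "B * e < 1"
    and close: "\<And>u. u \<in> V \<Longrightarrow> nrm ((z' *\<^sub>C u - T' u) - (z *\<^sub>C u - T u)) \<le> e * nrm u"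
  shows "res_bound T' z' (B / (1 - B * e))"
    and "y \<in> V \<Longrightarrow> nrm (R T' z' y - R T z y) \<le> B * e * (B / (1 - B * e)) * nrm y"
proof -
  have z: "z \<in> res T" using B by (simp add: res_bound_def)
  define D where "D u = (z' *\<^sub>C u - T' u) - (z *\<^sub>C u - T u)" for u
  have lin: "linear_op V (\<lambda>u. z' *\<^sub>C u - T' u)" "linear_op V (\<lambda>u. z *\<^sub>C u - T u)"
    by (intro linear_op_shift op_on_linear T T')+
  have D_in: "D u \<in> V" if "u \<in> V" for u
    unfolding D_def by (intro V_diff V_scale op_on_in[OF T] op_on_in[OF T'] that)
  have D_lin: "linear_op V D"
    unfolding D_def linear_op_def
    using linear_op_add[OF lin(1)] linear_op_add[OF lin(2)] linear_op_scale[OF lin(1)]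
      linear_op_scale[OF lin(2)] subspace_V
    by (simp add: complex_vector.scale_right_diff_distrib)
  have D_le: "nrm (D u) \<le> e * nrm u" if "u \<in> V" for u using close[OF that] by (simp add: D_def)
  have L': "z' *\<^sub>C x - T' x = (z *\<^sub>C x - T x) + D x" for x by (simp add: D_def)
  have RV: "op_on (R T z)" by (rule op_on_R[OF T z])
  have pos: "0 < 1 - B * e" using \<open>B * e < 1\<close> by simp
  show bound: "res_bound T' z' (B / (1 - B * e))"
  proof (rule res_boundI[OF T'])
    fix y assume y: "y \<in> V"
    \<comment> \<open>the equation \<open>u - K u = y\<close> for \<open>u = (z - T) x\<close> is \<open>(z' - T') x = y\<close>\<close>
    define K where "K u = - D (R T z u)" for u
    have K: "linear_op V K"
      unfolding K_def linear_op_def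
      using linear_op_add[OF D_lin R_in[OF z] R_in[OF z]] linear_op_scale[OF D_lin R_in[OF z]]
        linear_op_add[OF op_on_linear[OF RV]] linear_op_scale[OF op_on_linear[OF RV]] subspace_V
      by simp
    have K_le: "nrm (K u) \<le> (B * e) * nrm u" if u: "u \<in> V" for u
    proof -
      have "nrm (K u) \<le> e * nrm (R T z u)"
        unfolding K_def using D_le[OF R_in[OF z u]] nrm_minus[OF D_in[OF R_in[OF z u]]] by simp
      also have "\<dots> \<le> e * (B * nrm u)"
        using res_boundD[OF B(1) u] \<open>0 \<le> e\<close> by (rule mult_left_mono)
      finally show ?thesis by (simp add: mult_ac)
    qed
    obtain u where u: "u \<in> V" "u - K u = y"
      by (rule neumann[OF K _ K_le _ \<open>B * e < 1\<close> y])
        (use D_in R_in[OF z] V_minus B(2) \<open>0 \<le> e\<close> in \<open>auto simp: K_def\<close>)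
    have "z' *\<^sub>C R T z u - T' (R T z u) = y"
      using u R_right[OF z u(1)] by (simp add: L' K_def)
    then show "\<exists>x\<in>V. z' *\<^sub>C x - T' x = y" using R_in[OF z u(1)] by blast
  next
    fix x assume x: "x \<in> V"
    let ?y = "z' *\<^sub>C x - T' x"
    have y: "?y \<in> V" by (intro V_diff V_scale op_on_in[OF T'] x)
    have "x = R T z (?y - D x)" using R_left[OF z x] by (simp add: L')
    then have "nrm x \<le> B * nrm (?y - D x)"
      using res_boundD[OF B(1) V_diff[OF y D_in[OF x]]] by simp
    also have "\<dots> \<le> B * (nrm ?y + e * nrm x)"
      using nrm_diff_le[OF y D_in[OF x]] D_le[OF x] B(2) by (intro mult_left_mono) auto
    finally have "(1 - B * e) * nrm x \<le> B * nrm ?y" by (simp add: algebra_simps)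
    then show "nrm x \<le> B / (1 - B * e) * nrm ?y"
      using pos by (simp add: pos_le_divide_eq mult.commute)
  qed
  assume y: "y \<in> V"
  have z': "z' \<in> res T'" using bound by (simp add: res_bound_def)
  let ?x = "R T' z' y"
  have x: "?x \<in> V" by (rule R_in[OF z' y])
  have "y = (z *\<^sub>C ?x - T ?x) + D ?x" using R_right[OF z' y] L' by metis
  then have "R T z y = R T z (z *\<^sub>C ?x - T ?x) + R T z (D ?x)"
    using linear_op_add[OF op_on_linear[OF RV] V_diff[OF V_scale[OF x] op_on_in[OF T x]] D_in[OF x]]
    by metis
  then have "?x - R T z y = - R T z (D ?x)" using R_left[OF z x] by simp
  then have "nrm (?x - R T z y) = nrm (R T z (D ?x))"
    using nrm_minus[OF R_in[OF z D_in[OF x]]] by simp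
  also have "\<dots> \<le> B * nrm (D ?x)" by (rule res_boundD[OF B(1) D_in[OF x]])
  also have "\<dots> \<le> B * (e * nrm ?x)" using D_le[OF x] B(2) by (intro mult_left_mono)
  also have "\<dots> \<le> B * (e * (B / (1 - B * e) * nrm y))"
    using res_boundD[OF bound y] B(2) \<open>0 \<le> e\<close> by (intro mult_left_mono)
  finally show "nrm (?x - R T z y) \<le> B * e * (B / (1 - B * e)) * nrm y" by (simp add: mult_ac)
qed

lemma resolvent_nearby:
  assumes T: "op_on T" and B: "res_bound T z B" "0 < B" and near: "cmod (z' - z) \<le> 1 / (2 * B)"
  shows "res_bound T z' (2 * B)"
    and "y \<in> V \<Longrightarrow> nrm (R T z' y - R T z y) \<le> 2 * B\<^sup>2 * cmod (z' - z) * nrm y"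
proof -
  let ?e = "cmod (z' - z)"
  have half: "B * ?e \<le> 1 / 2" using near B(2) by (simp add: field_simps)
  have close: "nrm ((z' *\<^sub>C u - T u) - (z *\<^sub>C u - T u)) \<le> ?e * nrm u" if "u \<in> V" for u
    using nrm_scale[OF that, of "z' - z"] by (simp add: complex_vector.scale_left_diff_distrib)
  have le: "B / (1 - B * ?e) \<le> 2 * B"
  proof -
    have "B * 1 \<le> B * (2 * (1 - B * ?e))" using half B(2) by (intro mult_left_mono) auto
    then show ?thesis using half by (simp add: divide_le_eq mult_ac)
  qed
  have lt: "B * ?e < 1" using half by simp
  note pert = resolvent_perturbation[OF T B(1) less_imp_le[OF B(2)] T norm_ge_zero lt close]
  show "res_bound T z' (2 * B)" by (rule res_bound_mono[OF pert(1) le]) auto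
  show "nrm (R T z' y - R T z y) \<le> 2 * B\<^sup>2 * ?e * nrm y" if y: "y \<in> V"
  proof -
    have "B * ?e * (B / (1 - B * ?e)) * nrm y \<le> B * ?e * (2 * B) * nrm y"
      using le B(2) nrm_nonneg[OF y] by (intro mult_right_mono mult_left_mono) auto
    moreover have "nrm (R T z' y - R T z y) \<le> B * ?e * (B / (1 - B * ?e)) * nrm y"
      by (rule pert(2)) (use y in auto)
    ultimately show ?thesis by (simp add: power2_eq_square mult_ac)
  qed
qed

lemma open_res: assumes T: "op_on T" shows "open (res T)"
proof (rule openI)
  fix z assume "z \<in> res T"
  then obtain B where B: "0 < B" "res_bound T z B" by (rule ex_res_bound)
  have "ball z (1 / (2 * B)) \<subseteq> res T"
    using resolvent_nearby(1)[OF T B(2,1)]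
    by (auto simp: dist_norm norm_minus_commute res_bound_def)
  then show "\<exists>e>0. ball z e \<subseteq> res T" using B(1) by (intro exI[of _ "1 / (2 * B)"]) auto
qed

lemma compact_res_bound:
  assumes T: "op_on T" and K: "compact K" "K \<subseteq> res T"
  obtains B where "0 < B" "\<And>z. z \<in> K \<Longrightarrow> res_bound T z B"
proof -
  have "\<forall>z\<in>K. \<exists>B. 0 < B \<and> res_bound T z B"
    using K(2) by (meson ex_res_bound subsetD)
  then obtain B where B: "\<And>z. z \<in> K \<Longrightarrow> 0 < B z \<and> res_bound T z (B z)"
    using bchoice by metis
  have "K \<subseteq> (\<Union>z\<in>K. ball z (1 / (2 * B z)))" using B by force
  then obtain K' where K': "K' \<subseteq> K" "finite K'" "K \<subseteq> (\<Union>z\<in>K'. ball z (1 / (2 * B z)))"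
    using compactE_image[OF K(1), of K "\<lambda>z. ball z (1 / (2 * B z))"] by blast
  define M where "M = Max (insert 1 ((\<lambda>z. 2 * B z) ` K'))"
  have M: "1 \<le> M" "\<And>z. z \<in> K' \<Longrightarrow> 2 * B z \<le> M" using K'(2) by (auto simp: M_def)
  have "res_bound T z M" if zK: "z \<in> K" for z
  proof -
    obtain z0 where z0: "z0 \<in> K'" "z \<in> ball z0 (1 / (2 * B z0))" using K'(3) zK by auto
    have "res_bound T z (2 * B z0)"
      by (rule resolvent_nearby(1)[OF T]) (use B z0 K'(1) in \<open>auto simp: dist_norm
          norm_minus_commute\<close>)
    then show ?thesis using M(2)[OF z0(1)] res_bound_mono by blast
  qed
  then show thesis using that[of M] M(1) by simp
qed

lemma resolvent_identity:
  assumes T: "op_on T" and z: "z \<in> res T" "z' \<in> res T" and u: "u \<in> V"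
  shows "R T z' u - R T z u = (z - z') *\<^sub>C R T z' (R T z u)"
proof -
  let ?x = "R T z u"
  have x: "?x \<in> V" by (rule R_in[OF z(1) u])
  have lin: "linear_op V (R T z')" by (rule op_on_linear[OF op_on_R[OF T z(2)]])
  have "u = (z' *\<^sub>C ?x - T ?x) + (z - z') *\<^sub>C ?x"
    using R_right[OF z(1) u] by (simp add: complex_vector.scale_left_diff_distrib)
  then have "R T z' u = R T z' (z' *\<^sub>C ?x - T ?x) + R T z' ((z - z') *\<^sub>C ?x)"
    using linear_op_add[OF lin V_diff[OF V_scale[OF x] op_on_in[OF T x]] V_scale[OF x]] by metis
  then show ?thesis
    using R_left[OF z(2) x] linear_op_scale[OF lin x] by simp
qed

text \<open>By the resolvent identity the difference quotient at \<open>z\<close> is \<open>- R(z') R(z) u\<close>, and it converges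
  since the resolvent is locally Lipschitz.\<close>

lemma holomorphic_resolvent:
  assumes T: "op_on T" and u: "u \<in> V" and w: "w \<in> V"
  shows "(\<lambda>z. ip (R T z u) w) holomorphic_on res T"
proof -
  have "((\<lambda>z. ip (R T z u) w) has_field_derivative - ip (R T z (R T z u)) w) (at z)"
    if z: "z \<in> res T" for z
  proof -
    let ?v = "R T z u"
    have v: "?v \<in> V" by (rule R_in[OF z u])
    obtain B where B: "0 < B" "res_bound T z B" using ex_res_bound[OF z] .
    define c where "c = 2 * B\<^sup>2 * nrm ?v * nrm w"
    have "\<forall>\<^sub>F z' in at z. cmod ((ip (R T z' u) w - ip ?v w) / (z' - z) - (- ip (R T z ?v) w))
        \<le> c * cmod (z' - z)"
      unfolding eventually_at
    proof (intro exI[of _ "1 / (2 * B)"] conjI ballI impI)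
      show "0 < 1 / (2 * B)" using B by simp
      fix z' assume z': "z' \<noteq> z \<and> dist z' z < 1 / (2 * B)"
      note near = resolvent_nearby[OF T B(2,1), of z']
      have "res_bound T z' (2 * B)" using near(1) z' by (simp add: dist_norm)
      then have z'r: "z' \<in> res T" by (simp add: res_bound_def)
      have in_V: "R T z' ?v \<in> V" "R T z ?v \<in> V" "R T z' u \<in> V"
        using R_in v u z z'r by auto
      have "ip (R T z' u) w - ip ?v w = ip ((z - z') *\<^sub>C R T z' ?v) w"
        using ip_diff_left[OF in_V(3) v w] resolvent_identity[OF T z z'r u] by simp
      also have "\<dots> = (z - z') * ip (R T z' ?v) w" by (rule ip_scale_left[OF in_V(1) w])
      finally have "(ip (R T z' u) w - ip ?v w) / (z' - z) = - ip (R T z' ?v) w"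
        using z' by (simp add: divide_eq_eq algebra_simps)
      then have "(ip (R T z' u) w - ip ?v w) / (z' - z) - (- ip (R T z ?v) w)
          = - ip (R T z' ?v - R T z ?v) w"
        using ip_diff_left[OF in_V(1,2) w] by simp
      then have "cmod ((ip (R T z' u) w - ip ?v w) / (z' - z) - (- ip (R T z ?v) w))
          \<le> nrm (R T z' ?v - R T z ?v) * nrm w"
        using ip_cauchy_schwarz[OF V_diff[OF in_V(1,2)] w] by simp
      also have "\<dots> \<le> (2 * B\<^sup>2 * cmod (z' - z) * nrm ?v) * nrm w"
        using near(2)[OF _ v] z' nrm_nonneg[OF w] by (intro mult_right_mono) (auto simp: dist_norm)
      finally show "cmod ((ip (R T z' u) w - ip ?v w) / (z' - z) - (- ip (R T z ?v) w))
          \<le> c * cmod (z' - z)" by (simp add: c_def mult_ac)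
    qed
    moreover have "((\<lambda>z'. c * cmod (z' - z)) \<longlongrightarrow> 0) (at z)"
      by (intro tendsto_eq_intros) auto
    ultimately have "((\<lambda>z'. (ip (R T z' u) w - ip ?v w) / (z' - z) - (- ip (R T z ?v) w)) \<longlongrightarrow> 0) (at z)"
      by (rule Lim_null_comparison)
    then show ?thesis
      unfolding has_field_derivative_iff by (subst Lim_null) 
  qed
  then show ?thesis
    unfolding holomorphic_on_def field_differentiable_def
    using has_field_derivative_at_within by blast
qed

end

section \<open>Riesz projections along a rectifiable loop\<close>

abbreviation two_pi_i :: complex where "two_pi_i \<equiv> 2 * of_real pi * \<i>"

lemma polynomial_path_derivative_bounded:
  fixes h :: "real \<Rightarrow> complex"
  assumes "polynomial_function h"
  obtains M where "\<And>t. t \<in> {0..1} \<Longrightarrow> norm (vector_derivative h (at t)) \<le> M"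
proof -
  obtain h' where h': "polynomial_function h'" "\<And>t. (h has_vector_derivative h' t) (at t)"
    using has_vector_derivative_polynomial_function[OF assms] by metis
  have "compact (h' ` {0..1})"
    by (intro compact_continuous_image continuous_on_polymonial_function h'(1)) simp
  then obtain M where "\<forall>x\<in>h' ` {0..1}. norm x \<le> M"
    using compact_imp_bounded bounded_iff by blast
  then show thesis
    using that[of M] vector_derivative_at[OF h'(2)] by simp
qed

locale contour = hilbert_on +
  fixes g :: "real \<Rightarrow> complex" and L :: real
  assumes path: "path g" and closed: "pathfinish g = pathstart g" and var: "variation_le g L"
begin

lemma L_nonneg: "0 \<le> L"
proof -
  have "{{0..1::real}} division_of {0..1}" by (metis atLeastatMost_empty_iff2 box_real(2)
      division_of_self zero_le_one not_one_less_zero linorder_not_le)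
  then have "cmod (g (Sup {0..1}) - g (Inf {0..1})) \<le> L"
    using var by (fastforce simp: variation_le_def)
  then show ?thesis by (meson norm_ge_zero order_trans)
qed

definition fine_div :: "real \<Rightarrow> (real \<times> real set) set \<Rightarrow> bool" where
  "fine_div d p \<longleftrightarrow> p tagged_division_of {0..1} \<and> (\<lambda>t. ball t d) fine p"

lemma fine_div_exists: "0 < d \<Longrightarrow> \<exists>p. fine_div d p"
  by (rule fine_division_exists_real[OF gauge_ball[of d], of 0 1]) (auto simp: fine_div_def)

lemma fine_div_mono: "fine_div d p \<Longrightarrow> d \<le> d' \<Longrightarrow> fine_div d' p"
  by (fastforce simp: fine_div_def fine_def)

lemma fine_div_tag: "fine_div d p \<Longrightarrow> (t, K) \<in> p \<Longrightarrow> t \<in> {0..1}"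
  using tagged_division_ofD(2,3) unfolding fine_div_def by blast

lemma fine_div_image:
  assumes "0 < r"
  obtains d where "0 < d" "\<And>p t K. fine_div d p \<Longrightarrow> (t, K) \<in> p \<Longrightarrow> g ` K \<subseteq> ball (g t) r"
proof -
  have "uniformly_continuous_on {0..1} g"
    using path by (intro compact_uniformly_continuous) (auto simp: path_def)
  then obtain d where d: "0 < d"
    "\<And>s t. s \<in> {0..1} \<Longrightarrow> t \<in> {0..1} \<Longrightarrow> dist s t < d \<Longrightarrow> dist (g s) (g t) < r"
    using assms unfolding uniformly_continuous_on_def by metis
  show thesis
  proof (rule that[OF d(1)])
    fix p t K assume p: "fine_div d p" and K: "(t, K) \<in> p"
    have "K \<subseteq> {0..1}" "t \<in> {0..1}" "K \<subseteq> ball t d"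
      using p K tagged_division_ofD(3) fine_div_tag unfolding fine_div_def fine_def by blast+
    then show "g ` K \<subseteq> ball (g t) r"
      using d(2)[of t] by fastforce
  qed
qed

lemma path_in: "t \<in> {0..1} \<Longrightarrow> g t \<in> path_image g"
  by (simp add: path_image_def)

definition rs_op :: "('a \<Rightarrow> 'a) \<Rightarrow> (real \<times> real set) set \<Rightarrow> 'a \<Rightarrow> 'a" where
  "rs_op T p u = (\<Sum>(t, K)\<in>p. (g (Sup K) - g (Inf K)) *\<^sub>C R T (g t) u)"

text \<open>A fixed sequence of ever finer divisions, so that integrals along \<open>g\<close> become limits of sequences.\<close>

definition div_seq :: "nat \<Rightarrow> (real \<times> real set) set" where
  "div_seq n = (SOME p. fine_div (1 / (real n + 1)) p)"

lemma div_seq: "fine_div (1 / (real n + 1)) (div_seq n)"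
  unfolding div_seq_def by (rule someI_ex[OF fine_div_exists]) simp

lemma div_seq_eventually: assumes "0 < d" shows "\<exists>M. \<forall>n\<ge>M. fine_div d (div_seq n)"
proof -
  obtain M where M: "1 / (real M + 1) < d"
    using nat_approx_posE[OF assms] by (metis of_nat_Suc add.commute)
  have "fine_div d (div_seq n)" if "M \<le> n" for n
  proof (rule fine_div_mono[OF div_seq])
    have "1 / (real n + 1) \<le> 1 / (real M + 1)" using that by (simp add: frac_le)
    then show "1 / (real n + 1) \<le> d" using M by simp
  qed
  then show ?thesis by blast
qed

context
  fixes T assumes T: "op_on T" and spec: "path_image g \<subseteq> res T"
begin

lemma g_res: "t \<in> {0..1} \<Longrightarrow> g t \<in> res T"
  using spec path_in by blast

lemma rs_op_in: assumes "fine_div d p" "u \<in> V" shows "rs_op T p u \<in> V"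
  unfolding rs_op_def
proof (rule V_sum)
  fix x assume "x \<in> p"
  then have "fst x \<in> {0..1}" using fine_div_tag[OF assms(1)] by (metis prod.collapse)
  then show "(case x of (t, K) \<Rightarrow> (g (Sup K) - g (Inf K)) *\<^sub>C R T (g t) u) \<in> V"
    using V_scale R_in[OF g_res assms(2)] by (simp add: case_prod_unfold)
qed

lemma ip_rs_op:
  assumes p: "fine_div d p" and u: "u \<in> V" and w: "w \<in> V"
  shows "ip (rs_op T p u) w = rs_sum g (\<lambda>z. ip (R T z u) w) p"
proof -
  have tag: "fst x \<in> {0..1}" if "x \<in> p" for x
    using fine_div_tag[OF p] that by (metis prod.collapse)
  have "ip (rs_op T p u) w = (\<Sum>x\<in>p. ip ((g (Sup (snd x)) - g (Inf (snd x))) *\<^sub>C R T (g (fst x)) u) w)"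
    unfolding rs_op_def case_prod_unfold
    by (rule ip_sum_left[OF _ w]) (use tag V_scale R_in[OF g_res u] in blast)
  also have "\<dots> = rs_sum g (\<lambda>z. ip (R T z u) w) p"
    unfolding rs_sum_def case_prod_unfold
    by (intro sum.cong refl ip_scale_left w R_in[OF g_res u] tag)
  finally show ?thesis .
qed

lemma resolvent_modulus:
  assumes "0 < e"
  obtains r where "0 < r" "\<And>t z. t \<in> {0..1} \<Longrightarrow> z \<in> ball (g t) r \<Longrightarrow> z \<in> res T"
    "\<And>t z u. t \<in> {0..1} \<Longrightarrow> z \<in> ball (g t) r \<Longrightarrow> u \<in> V \<Longrightarrow> nrm (R T z u - R T (g t) u) \<le> e * nrm u"
proof -
  obtain B where B: "0 < B" "\<And>z. z \<in> path_image g \<Longrightarrow> res_bound T z B"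
    using compact_res_bound[OF T compact_path_image[OF path] spec] by metis
  define r where "r = min (1 / (2 * B)) (e / (2 * B\<^sup>2))"
  have r: "0 < r" "r \<le> 1 / (2 * B)" "2 * B\<^sup>2 * r \<le> e"
  proof -
    show "0 < r" using B(1) assms by (simp add: r_def)
    show "r \<le> 1 / (2 * B)" by (simp add: r_def)
    have "2 * B\<^sup>2 * r \<le> 2 * B\<^sup>2 * (e / (2 * B\<^sup>2))"
      by (intro mult_left_mono) (auto simp: r_def)
    then show "2 * B\<^sup>2 * r \<le> e" using B(1) by simp
  qed
  show thesis
  proof (rule that[OF r(1)])
    fix t :: real and z assume t: "t \<in> {0..1}" and z: "z \<in> ball (g t) r"
    then have dist: "cmod (z - g t) \<le> r" by (simp add: dist_norm norm_minus_commute)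
    then have near: "cmod (z - g t) \<le> 1 / (2 * B)" using r(2) by simp
    show "z \<in> res T"
      using resolvent_nearby(1)[OF T B(2)[OF path_in[OF t]] B(1) near] by (simp add: res_bound_def)
    fix u assume u: "u \<in> V"
    have "nrm (R T z u - R T (g t) u) \<le> 2 * B\<^sup>2 * cmod (z - g t) * nrm u"
      by (rule resolvent_nearby(2)[OF T B(2)[OF path_in[OF t]] B(1) near u])
    also have "\<dots> \<le> e * nrm u"
    proof (rule mult_right_mono)
      have "2 * B\<^sup>2 * cmod (z - g t) \<le> 2 * B\<^sup>2 * r" by (intro mult_left_mono dist) simp
      then show "2 * B\<^sup>2 * cmod (z - g t) \<le> e" using r(3) by simp
    qed (rule nrm_nonneg[OF u])
    finally show "nrm (R T z u - R T (g t) u) \<le> e * nrm u" .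
  qed
qed

text \<open>Paired with a vector \<open>w\<close>, the sums for two divisions both approximate the same scalar contour
  integral, with an error proportional to \<open>\<parallel>u\<parallel> \<parallel>w\<parallel>\<close>.\<close>

lemma rs_op_cauchy:
  assumes "0 < e"
  obtains d where "0 < d"
    "\<And>p q u. fine_div d p \<Longrightarrow> fine_div d q \<Longrightarrow> u \<in> V \<Longrightarrow> nrm (rs_op T p u - rs_op T q u) \<le> e * nrm u"
proof -
  define e' where "e' = e / (2 * L + 1)"
  have e': "0 < e'" "2 * e' * L \<le> e"
    using assms L_nonneg by (auto simp: e'_def field_simps)
  obtain r where r: "0 < r" "\<And>t z. t \<in> {0..1} \<Longrightarrow> z \<in> ball (g t) r \<Longrightarrow> z \<in> res T"
    "\<And>t z u. t \<in> {0..1} \<Longrightarrow> z \<in> ball (g t) r \<Longrightarrow> u \<in> V \<Longrightarrow> nrm (R T z u - R T (g t) u) \<le> e' * nrm u"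
    using resolvent_modulus[OF e'(1)] by blast
  obtain d where d: "0 < d" "\<And>p t K. fine_div d p \<Longrightarrow> (t, K) \<in> p \<Longrightarrow> g ` K \<subseteq> ball (g t) r"
    using fine_div_image[OF r(1)] by blast
  obtain h where h: "\<And>f r e p. f holomorphic_on res T \<Longrightarrow> p tagged_division_of {0..1} \<Longrightarrow>
      (\<And>t K. (t, K) \<in> p \<Longrightarrow> g ` K \<subseteq> ball (g t) r) \<Longrightarrow>
      (\<And>t. t \<in> {0..1} \<Longrightarrow> ball (g t) r \<subseteq> res T) \<Longrightarrow>
      (\<And>t w. t \<in> {0..1} \<Longrightarrow> w \<in> ball (g t) r \<Longrightarrow> cmod (f w - f (g t)) \<le> e) \<Longrightarrow>
      0 < r \<Longrightarrow> cmod (rs_sum g f p - contour_integral h f) \<le> e * L"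
    using rs_sum_approximates_contour_integral[OF path var closed open_res[OF T] spec] by metis
  have near: "cmod (ip (rs_op T p u) w - contour_integral h (\<lambda>z. ip (R T z u) w))
      \<le> (e' * nrm u * nrm w) * L"
    if p: "fine_div d p" and u: "u \<in> V" and w: "w \<in> V" for p u w
    unfolding ip_rs_op[OF p u w]
  proof (rule h)
    show "(\<lambda>z. ip (R T z u) w) holomorphic_on res T" by (rule holomorphic_resolvent[OF T u w])
    show "p tagged_division_of {0..1}" using p by (simp add: fine_div_def)
    show "\<And>t K. (t, K) \<in> p \<Longrightarrow> g ` K \<subseteq> ball (g t) r" by (rule d(2)[OF p])
    show "\<And>t. t \<in> {0..1} \<Longrightarrow> ball (g t) r \<subseteq> res T" using r(2) by blast
    fix t :: real and z assume t: "t \<in> {0..1}" and z: "z \<in> ball (g t) r"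
    have in_V: "R T z u \<in> V" "R T (g t) u \<in> V"
      using R_in[OF r(2)[OF t z] u] R_in[OF g_res[OF t] u] by auto
    have "cmod (ip (R T z u) w - ip (R T (g t) u) w) \<le> nrm (R T z u - R T (g t) u) * nrm w"
      using ip_cauchy_schwarz[OF V_diff[OF in_V] w] ip_diff_left[OF in_V w] by simp
    also have "\<dots> \<le> e' * nrm u * nrm w"
      by (intro mult_right_mono r(3) t z u nrm_nonneg w)
    finally show "cmod (ip (R T z u) w - ip (R T (g t) u) w) \<le> e' * nrm u * nrm w" .
  qed (rule r(1))
  show thesis
  proof (rule that[OF d(1)])
    fix p q u assume p: "fine_div d p" and q: "fine_div d q" and u: "u \<in> V"
    have in_V: "rs_op T p u \<in> V" "rs_op T q u \<in> V" using rs_op_in p q u by auto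
    show "nrm (rs_op T p u - rs_op T q u) \<le> e * nrm u"
    proof (rule nrm_le_by_duality[OF V_diff[OF in_V]])
      show "0 \<le> e * nrm u" using assms nrm_nonneg[OF u] by simp
      fix w assume w: "w \<in> V"
      let ?I = "contour_integral h (\<lambda>z. ip (R T z u) w)"
      have "cmod (ip (rs_op T p u - rs_op T q u) w)
          = cmod ((ip (rs_op T p u) w - ?I) - (ip (rs_op T q u) w - ?I))"
        by (simp add: ip_diff_left[OF in_V w])
      also have "\<dots> \<le> cmod (ip (rs_op T p u) w - ?I) + cmod (ip (rs_op T q u) w - ?I)"
        by (rule norm_triangle_ineq4)
      also have "\<dots> \<le> (e' * nrm u * nrm w) * L + (e' * nrm u * nrm w) * L"
        by (intro add_mono near p q u w)
      also have "\<dots> = (2 * e' * L) * (nrm u * nrm w)" by simp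
      also have "\<dots> \<le> e * (nrm u * nrm w)"
        by (intro mult_right_mono e'(2) mult_nonneg_nonneg nrm_nonneg u w)
      finally show "cmod (ip (rs_op T p u - rs_op T q u) w) \<le> e * nrm u * nrm w" by simp
    qed
  qed
qed

abbreviation "J \<equiv> op_contour_integral V nrm (R T) g"

text \<open>The Riemann-Stieltjes sums are Cauchy in operator norm and \<open>V\<close> is complete, so the integral exists;
  it is unique because two candidates are close to the same sum.\<close>

lemma has_op_contour_integral_J:
  shows "has_op_contour_integral V nrm (R T) J g"
proof -
  have "\<exists>l\<in>V. (\<lambda>n. nrm (rs_op T (div_seq n) u - l)) \<longlonglongrightarrow> 0" if u: "u \<in> V" for u
  proof -
    have seq_in: "rs_op T (div_seq n) u \<in> V" for n by (rule rs_op_in[OF div_seq u])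
    have "\<exists>M. \<forall>m\<ge>M. \<forall>n\<ge>M. nrm (rs_op T (div_seq m) u - rs_op T (div_seq n) u) < e" if "0 < e" for e
    proof -
      define e' where "e' = e / (nrm u + 1)"
      have "0 < e'" "e' * nrm u < e"
        using that nrm_nonneg[OF u] by (auto simp: e'_def field_simps)
      from rs_op_cauchy[OF this(1)] obtain d where d: "0 < d" "\<And>p q u. fine_div d p \<Longrightarrow> fine_div d q \<Longrightarrow>
          u \<in> V \<Longrightarrow> nrm (rs_op T p u - rs_op T q u) \<le> e' * nrm u" by blast
      obtain M where "\<forall>n\<ge>M. fine_div d (div_seq n)" using div_seq_eventually[OF d(1)] by blast
      then show ?thesis using d(2) u \<open>e' * nrm u < e\<close> by (meson le_less_trans)
    qed
    then show ?thesis using complete[of "\<lambda>n. rs_op T (div_seq n) u", OF seq_in] by blast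
  qed
  then obtain J' where J': "\<And>u. u \<in> V \<Longrightarrow> J' u \<in> V"
    "\<And>u. u \<in> V \<Longrightarrow> (\<lambda>n. nrm (rs_op T (div_seq n) u - J' u)) \<longlonglongrightarrow> 0" by metis
  have J'_integral: "has_op_contour_integral V nrm (R T) J' g"
    unfolding has_op_contour_integral_def fine_div_def[symmetric] rs_op_def[symmetric]
  proof (intro conjI ballI allI impI)
    fix e :: real assume "0 < e"
    obtain d where d: "0 < d" "\<And>p q u. fine_div d p \<Longrightarrow> fine_div d q \<Longrightarrow>
          u \<in> V \<Longrightarrow> nrm (rs_op T p u - rs_op T q u) \<le> e * nrm u" using rs_op_cauchy[OF \<open>0 < e\<close>] by blast
    obtain M where M: "\<forall>n\<ge>M. fine_div d (div_seq n)" using div_seq_eventually[OF d(1)] by blast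
    have "nrm (rs_op T p u - J' u) \<le> e * nrm u" if p: "fine_div d p" and u: "u \<in> V" for p u
    proof -
      have lim: "(\<lambda>n. e * nrm u + nrm (rs_op T (div_seq n) u - J' u)) \<longlonglongrightarrow> e * nrm u + 0"
        by (intro tendsto_add tendsto_const J'(2) u)
      have "nrm (rs_op T p u - J' u) \<le> e * nrm u + nrm (rs_op T (div_seq n) u - J' u)" if "M \<le> n"
          for n
      proof -
        have "fine_div d (div_seq n)" using M that by blast
        then show ?thesis
          using nrm_diff_triangle[OF rs_op_in[OF p u] J'(1)[OF u] rs_op_in[OF div_seq u], of n]
            d(2)[OF p _ u, of "div_seq n"] by simp
      qed
      then have "nrm (rs_op T p u - J' u) \<le> e * nrm u + 0"
        by (intro LIMSEQ_le_const[OF lim]) blast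
      then show ?thesis by simp
    qed
    with d(1) show "\<exists>d>0. \<forall>p. fine_div d p \<longrightarrow> (\<forall>u\<in>V. nrm (rs_op T p u - J' u) \<le> e * nrm u)" by blast
  qed (rule J'(1))
  have unique: "J1 u = J' u" if J1: "has_op_contour_integral V nrm (R T) J1 g" and u: "u \<in> V" for J1 u
  proof -
    have in_V: "J1 u \<in> V" "J' u \<in> V" using J1 J'(1) u by (auto simp: has_op_contour_integral_def)
    have "nrm (J1 u - J' u) \<le> 0"
    proof (rule field_le_epsilon)
      fix e :: real assume "0 < e"
      define e' where "e' = e / (2 * nrm u + 1)"
      have e': "0 < e'" "2 * (e' * nrm u) \<le> e"
        using \<open>0 < e\<close> nrm_nonneg[OF u] by (auto simp: e'_def field_simps)
      obtain d1 where d1: "0 < d1" "\<forall>p. fine_div d1 p \<longrightarrow> (\<forall>u\<in>V. nrm (rs_op T p u - J1 u) \<le> e' * nrm u)"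
        using J1 e'(1) unfolding has_op_contour_integral_def fine_div_def[symmetric]
            rs_op_def[symmetric] by blast
      obtain d2 where d2: "0 < d2" "\<forall>p. fine_div d2 p \<longrightarrow> (\<forall>u\<in>V. nrm (rs_op T p u - J' u) \<le> e' * nrm u)"
        using J'_integral e'(1) unfolding has_op_contour_integral_def fine_div_def[symmetric]
            rs_op_def[symmetric] by blast
      obtain p where p: "fine_div (min d1 d2) p" using fine_div_exists[of "min d1 d2"] d1 d2 by auto
      then have p12: "fine_div d1 p" "fine_div d2 p" by (auto intro: fine_div_mono)
      have X: "rs_op T p u \<in> V" by (rule rs_op_in[OF p u])
      have "nrm (J1 u - J' u) \<le> nrm (J1 u - rs_op T p u) + nrm (rs_op T p u - J' u)"
        by (intro nrm_diff_triangle in_V X)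
      also have "nrm (J1 u - rs_op T p u) = nrm (rs_op T p u - J1 u)"
        by (rule nrm_diff_commute[OF in_V(1) X])
      also have "nrm (rs_op T p u - J1 u) + nrm (rs_op T p u - J' u) \<le> 2 * (e' * nrm u)"
        using d1(2)[rule_format, OF p12(1) u] d2(2)[rule_format, OF p12(2) u] by simp
      finally show "nrm (J1 u - J' u) \<le> 0 + e" using e'(2) by simp
    qed
    then have "J1 u - J' u = 0" by (intro nrm_eq_0D V_diff in_V)
    then show ?thesis by simp
  qed
  have "J u = J' u" if "u \<in> V" for u
    unfolding op_contour_integral_def
    by (rule the_equality) (use J'_integral unique that in blast)+
  then show ?thesis
    using J'_integral unfolding has_op_contour_integral_def by simp
qed

lemma J_in: "u \<in> V \<Longrightarrow> J u \<in> V"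
  using has_op_contour_integral_J by (simp add: has_op_contour_integral_def)

lemma rs_op_near_J:
  assumes "0 < e"
  obtains d where "0 < d" "\<And>p u. fine_div d p \<Longrightarrow> u \<in> V \<Longrightarrow> nrm (rs_op T p u - J u) \<le> e * nrm u"
  using has_op_contour_integral_J assms
  unfolding has_op_contour_integral_def fine_div_def[symmetric] rs_op_def[symmetric] by blast

lemma ip_rs_op_tendsto:
  assumes u: "u \<in> V" and w: "w \<in> V"
  shows "(\<lambda>n. rs_sum g (\<lambda>z. ip (R T z u) w) (div_seq n)) \<longlonglongrightarrow> ip (J u) w"
proof (rule LIMSEQ_I)
  fix e :: real assume "0 < e"
  define e' where "e' = e / (nrm u * nrm w + 1)"
  have nn: "0 \<le> nrm u * nrm w" using nrm_nonneg u w by simp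
  then have e': "0 < e'" "e' * (nrm u * nrm w) < e"
    using \<open>0 < e\<close> by (auto simp: e'_def field_simps)
  obtain d where d: "0 < d" "\<And>p u. fine_div d p \<Longrightarrow> u \<in> V \<Longrightarrow> nrm (rs_op T p u - J u) \<le> e' * nrm u"
    using rs_op_near_J[OF e'(1)] by blast
  obtain M where M: "\<forall>n\<ge>M. fine_div d (div_seq n)" using div_seq_eventually[OF d(1)] by blast
  have "norm (rs_sum g (\<lambda>z. ip (R T z u) w) (div_seq n) - ip (J u) w) < e" if "M \<le> n" for n
  proof -
    have fine: "fine_div d (div_seq n)" using M that by blast
    have X: "rs_op T (div_seq n) u \<in> V" by (rule rs_op_in[OF fine u])
    have "norm (rs_sum g (\<lambda>z. ip (R T z u) w) (div_seq n) - ip (J u) w)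
        \<le> nrm (rs_op T (div_seq n) u - J u) * nrm w"
      using ip_cauchy_schwarz[OF V_diff[OF X J_in[OF u]] w]
      by (simp add: ip_rs_op[OF fine u w, symmetric] ip_diff_left[OF X J_in[OF u] w])
    also have "\<dots> \<le> e' * nrm u * nrm w"
      by (intro mult_right_mono d(2)[OF fine u] nrm_nonneg w)
    finally show ?thesis using e'(2) by (simp add: mult.assoc)
  qed
  then show "\<exists>M. \<forall>n\<ge>M. norm (rs_sum g (\<lambda>z. ip (R T z u) w) (div_seq n) - ip (J u) w) < e" by blast
qed

end

text \<open>Lebesgue numbers for the cover of the path by open sets on which \<open>k\<close> oscillates by at most \<open>e\<close>.\<close>

lemma scalar_modulus:
  assumes "continuous_on U k" "open U" "path_image g \<subseteq> U" "0 < e"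
  obtains r where "0 < r" "\<And>t. t \<in> {0..1} \<Longrightarrow> ball (g t) r \<subseteq> U"
    "\<And>t w. t \<in> {0..1} \<Longrightarrow> w \<in> ball (g t) r \<Longrightarrow> cmod (k w - k (g t)) \<le> e"
proof -
  define G where "G = {B. open B \<and> B \<subseteq> U \<and> (\<forall>x\<in>B. \<forall>y\<in>B. cmod (k x - k y) \<le> e)}"
  have "x \<in> \<Union>G" if "x \<in> path_image g" for x
  proof -
    have x: "x \<in> U" using that assms(3) by blast
    define B where "B = {y\<in>U. dist (k y) (k x) < e / 2}"
    have "B = U \<inter> k -` ball (k x) (e / 2)" by (auto simp: B_def dist_commute)
    then have "open B"
      using continuous_open_preimage[OF assms(1,2), of "ball (k x) (e / 2)"] by simp
    moreover have "cmod (k y - k y') \<le> e" if "y \<in> B" "y' \<in> B" for y y'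
      using that dist_triangle_half_l[of "k y" "k x" e "k y'"] by (simp add: B_def dist_norm)
    moreover have "x \<in> B" using x assms(4) by (simp add: B_def)
    moreover have "B \<subseteq> U" by (auto simp: B_def)
    ultimately show ?thesis by (auto simp: G_def)
  qed
  then have "path_image g \<subseteq> \<Union>G" by blast
  moreover have "open B" if "B \<in> G" for B using that by (simp add: G_def)
  ultimately obtain r where r: "0 < r" "\<And>x. x \<in> path_image g \<Longrightarrow> \<exists>B\<in>G. ball x r \<subseteq> B"
    using Heine_Borel_lemma[OF compact_path_image[OF path]] by metis
  show thesis
  proof (rule that[OF r(1)])
    fix t :: real assume t: "t \<in> {0..1}"
    obtain B where B: "B \<in> G" "ball (g t) r \<subseteq> B" using r(2)[OF path_in[OF t]] by blast
    then show "ball (g t) r \<subseteq> U" by (auto simp: G_def)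
    show "cmod (k w - k (g t)) \<le> e" if "w \<in> ball (g t) r" for w
    proof -
      have "w \<in> B" "g t \<in> B" using that B(2) r(1) by auto
      with B(1) show ?thesis by (auto simp: G_def)
    qed
  qed
qed

text \<open>From here on the limits of Riemann-Stieltjes sums along \<open>g\<close> are contour integrals along one
  smooth loop \<open>h\<close>, which may be chosen within any open neighbourhood \<open>U\<close> of \<open>g\<close>.\<close>

lemma smooth_contour:
  assumes U: "open U" "path_image g \<subseteq> U"
  obtains h where "polynomial_function h" "valid_path h" "pathfinish h = pathstart h"
      "path_image h \<subseteq> U"
    "\<And>w. w \<notin> U \<Longrightarrow> winding_number h w = winding_number g w"
    "\<And>k. k holomorphic_on U \<Longrightarrow> (\<lambda>n. rs_sum g k (div_seq n)) \<longlonglongrightarrow> contour_integral h k"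
proof -
  obtain h where h: "polynomial_function h" "pathfinish h = pathstart h" "path_image h \<subseteq> U"
    "\<And>w. w \<notin> U \<Longrightarrow> winding_number h w = winding_number g w"
    and approx: "\<And>f r e p. f holomorphic_on U \<Longrightarrow> p tagged_division_of {0..1} \<Longrightarrow>
      (\<And>t K. (t, K) \<in> p \<Longrightarrow> g ` K \<subseteq> ball (g t) r) \<Longrightarrow>
      (\<And>t. t \<in> {0..1} \<Longrightarrow> ball (g t) r \<subseteq> U) \<Longrightarrow>
      (\<And>t w. t \<in> {0..1} \<Longrightarrow> w \<in> ball (g t) r \<Longrightarrow> cmod (f w - f (g t)) \<le> e) \<Longrightarrow>
      0 < r \<Longrightarrow> cmod (rs_sum g f p - contour_integral h f) \<le> e * L"
    using rs_sum_approximates_contour_integral[OF path var closed U] by metis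
  show thesis
  proof (rule that[OF h(1) valid_path_polynomial_function[OF h(1)] h(2,3,4)])
    fix k assume k: "k holomorphic_on U"
    show "(\<lambda>n. rs_sum g k (div_seq n)) \<longlonglongrightarrow> contour_integral h k"
    proof (rule LIMSEQ_I)
      fix e :: real assume "0 < e"
      define e' where "e' = e / (L + 1)"
      have e': "0 < e'" "e' * L < e" using \<open>0 < e\<close> L_nonneg by (auto simp: e'_def field_simps)
      obtain r where r: "0 < r" "\<And>t. t \<in> {0..1} \<Longrightarrow> ball (g t) r \<subseteq> U"
        "\<And>t w. t \<in> {0..1} \<Longrightarrow> w \<in> ball (g t) r \<Longrightarrow> cmod (k w - k (g t)) \<le> e'"
        using scalar_modulus[OF holomorphic_on_imp_continuous_on[OF k] U e'(1)] by metis
      obtain d where d: "0 < d" "\<And>p t K. fine_div d p \<Longrightarrow> (t, K) \<in> p \<Longrightarrow> g ` K \<subseteq> ball (g t) r"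
        using fine_div_image[OF r(1)] by blast
      obtain M where M: "\<forall>n\<ge>M. fine_div d (div_seq n)" using div_seq_eventually[OF d(1)] by blast
      have "norm (rs_sum g k (div_seq n) - contour_integral h k) < e" if "M \<le> n" for n
      proof -
        have fine: "fine_div d (div_seq n)" using M that by blast
        have "norm (rs_sum g k (div_seq n) - contour_integral h k) \<le> e' * L"
          by (rule approx[OF k _ d(2)[OF fine] r(2,3,1)]) (use fine in \<open>auto simp: fine_div_def\<close>)
        then show ?thesis using e'(2) by simp
      qed
      then show "\<exists>M. \<forall>n\<ge>M. norm (rs_sum g k (div_seq n) - contour_integral h k) < e" by blast
    qed
  qed
qed

abbreviation "P T \<equiv> riesz_projection V nrm T g"

text \<open>Pairings with the Riesz projection become contour integrals along a smooth loop, to which Cauchy's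
  theorem applies.\<close>

lemma smooth_contour_P:
  assumes T: "op_on T" and U: "open U" "path_image g \<subseteq> U" "U \<subseteq> res T"
  obtains h where "polynomial_function h" "valid_path h" "pathfinish h = pathstart h"
      "path_image h \<subseteq> U"
    "\<And>w. w \<notin> U \<Longrightarrow> winding_number h w = winding_number g w"
    "\<And>k. k holomorphic_on U \<Longrightarrow> (\<lambda>n. rs_sum g k (div_seq n)) \<longlonglongrightarrow> contour_integral h k"
    "\<And>u w. u \<in> V \<Longrightarrow> w \<in> V \<Longrightarrow> ip (P T u) w = contour_integral h (\<lambda>z. ip (R T z u) w) / two_pi_i"
proof -
  have spec: "path_image g \<subseteq> res T" using U by blast
  obtain h where h: "polynomial_function h" "valid_path h" "pathfinish h = pathstart h"
      "path_image h \<subseteq> U"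
    "\<And>w. w \<notin> U \<Longrightarrow> winding_number h w = winding_number g w"
    and lim: "\<And>k. k holomorphic_on U \<Longrightarrow> (\<lambda>n. rs_sum g k (div_seq n)) \<longlonglongrightarrow> contour_integral h k"
    using smooth_contour[OF U(1,2)] by metis
  show thesis
  proof (rule that[OF h lim])
    fix u w assume u: "u \<in> V" and w: "w \<in> V"
    have "(\<lambda>n. rs_sum g (\<lambda>z. ip (R T z u) w) (div_seq n)) \<longlonglongrightarrow> contour_integral h (\<lambda>z. ip (R T z u) w)"
      by (intro lim holomorphic_on_subset[OF holomorphic_resolvent[OF T u w] U(3)])
    then have "ip (op_contour_integral V nrm (R T) g u) w = contour_integral h (\<lambda>z. ip (R T z u) w)"
      by (rule LIMSEQ_unique[OF ip_rs_op_tendsto[OF T spec u w]])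
    then show "ip (P T u) w = contour_integral h (\<lambda>z. ip (R T z u) w) / two_pi_i"
      unfolding riesz_projection_def ip_scale_left[OF J_in[OF T spec u] w] by simp
  qed
qed

end

context contour
begin

lemma
  assumes T: "op_on T" and spec: "path_image g \<subseteq> res T"
  shows P_in: "u \<in> V \<Longrightarrow> P T u \<in> V"
    and op_on_P: "op_on (P T)"
proof -
  show P_V: "P T u \<in> V" if "u \<in> V" for u
    unfolding riesz_projection_def by (intro V_scale J_in[OF T spec] that)
  obtain h where h: "valid_path h" "path_image h \<subseteq> res T"
    and ipP: "\<And>u w. u \<in> V \<Longrightarrow> w \<in> V \<Longrightarrow> ip (P T u) w = contour_integral h (\<lambda>z. ip (R T z u) w) / two_pi_i"
    using smooth_contour_P[OF T open_res[OF T] spec order_refl] by metis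
  have int: "(\<lambda>z. ip (R T z u) w) contour_integrable_on h" if "u \<in> V" "w \<in> V" for u w
    by (rule contour_integrable_holomorphic_simple[OF holomorphic_resolvent[OF T that]
        open_res[OF T] h])
  have lin: "linear_op V (R T z)" if "z \<in> path_image h" for z
    using op_on_linear[OF op_on_R[OF T]] h that by blast
  have R_V: "R T z u \<in> V" if "z \<in> path_image h" "u \<in> V" for z u
    using R_in h that by blast
  have "P T (u + v) = P T u + P T v" if u: "u \<in> V" and v: "v \<in> V" for u v
  proof -
    have in_V: "P T (u + v) \<in> V" "P T u + P T v \<in> V" using u v V_add P_V by auto
    have "ip (P T (u + v) - (P T u + P T v)) w = 0" if w: "w \<in> V" for w
    proof -
      have "contour_integral h (\<lambda>z. ip (R T z (u + v)) w)
          = contour_integral h (\<lambda>z. ip (R T z u) w + ip (R T z v) w)"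
        by (rule contour_integral_eq)
          (simp add: linear_op_add[OF lin u v] ip_add_left[OF R_V R_V w] u v)
      also have "\<dots> = contour_integral h (\<lambda>z. ip (R T z u) w) + contour_integral h (\<lambda>z.
          ip (R T z v) w)"
        by (intro contour_integral_add int u v w)
      finally have "ip (P T (u + v)) w = ip (P T u) w + ip (P T v) w"
        by (simp add: ipP V_add u v w add_divide_distrib)
      then show ?thesis
        by (simp add: ip_diff_left[OF in_V w] ip_add_left[OF P_V[OF u] P_V[OF v] w])
    qed
    then have "P T (u + v) - (P T u + P T v) = 0"
      by (intro eq_0_by_duality V_diff in_V)
    then show ?thesis by simp
  qed
  moreover have "P T (c *\<^sub>C u) = c *\<^sub>C P T u" if u: "u \<in> V" for u c
  proof -
    have in_V: "P T (c *\<^sub>C u) \<in> V" "c *\<^sub>C P T u \<in> V" using u V_scale P_V by auto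
    have "ip (P T (c *\<^sub>C u) - c *\<^sub>C P T u) w = 0" if w: "w \<in> V" for w
    proof -
      have "contour_integral h (\<lambda>z. ip (R T z (c *\<^sub>C u)) w) = contour_integral h (\<lambda>z.
          c * ip (R T z u) w)"
        by (rule contour_integral_eq)
          (simp add: linear_op_scale[OF lin u] ip_scale_left[OF R_V w] u)
      also have "\<dots> = c * contour_integral h (\<lambda>z. ip (R T z u) w)"
        by (intro contour_integral_lmul int u w)
      finally have "ip (P T (c *\<^sub>C u)) w = c * ip (P T u) w"
        by (simp add: ipP V_scale u w)
      then show ?thesis
        by (simp add: ip_diff_left[OF in_V w] ip_scale_left[OF P_V[OF u] w])
    qed
    then have "P T (c *\<^sub>C u) - c *\<^sub>C P T u = 0"
      by (intro eq_0_by_duality V_diff in_V)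
    then show ?thesis by simp
  qed
  ultimately show "op_on (P T)"
    using subspace_V P_V by (simp add: op_on_def linear_op_def)
qed

text \<open>\<open>S\<close> commutes with every Riemann-Stieltjes sum and, being bounded, with the limit.\<close>

lemma P_commute:
  assumes T: "op_on T" and spec: "path_image g \<subseteq> res T"
    and S: "op_on S" "\<And>u. u \<in> V \<Longrightarrow> nrm (S u) \<le> B * nrm u"
    and comm: "\<And>z u. z \<in> path_image g \<Longrightarrow> u \<in> V \<Longrightarrow> S (R T z u) = R T z (S u)" and u: "u \<in> V"
  shows "S (P T u) = P T (S u)"
proof -
  let ?J = "op_contour_integral V nrm (R T) g"
  have Su: "S u \<in> V" by (rule op_on_in[OF S(1) u])
  have in_V: "?J u \<in> V" "?J (S u) \<in> V" "S (?J u) \<in> V"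
    using J_in[OF T spec] u Su op_on_in[OF S(1)] by auto
  have "nrm (S (?J u) - ?J (S u)) \<le> 0"
  proof (rule field_le_epsilon)
    fix e :: real assume "0 < e"
    define K where "K = \<bar>B\<bar> * nrm u + nrm (S u)"
    have K: "0 \<le> K" using nrm_nonneg[OF u] nrm_nonneg[OF Su] by (simp add: K_def)
    define e' where "e' = e / (K + 1)"
    have e': "0 < e'" "e' * K \<le> e" using \<open>0 < e\<close> K by (auto simp: e'_def field_simps)
    obtain d where d: "0 < d" "\<And>p u. fine_div d p \<Longrightarrow> u \<in> V \<Longrightarrow> nrm (rs_op T p u - ?J u) \<le> e' * nrm u"
      using rs_op_near_J[OF T spec e'(1)] by blast
    obtain p where p: "fine_div d p" using fine_div_exists[OF d(1)] by blast
    have X: "rs_op T p u \<in> V" "rs_op T p (S u) \<in> V" using rs_op_in[OF T spec p] u Su by auto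
    have tag: "fst x \<in> {0..1}" if "x \<in> p" for x
      using fine_div_tag[OF p] that by (metis prod.collapse)
    have R_V: "R T (g (fst x)) u \<in> V" if "x \<in> p" for x
      using R_in[OF g_res[OF T spec tag[OF that]] u] .
    have "S (rs_op T p u) = (\<Sum>x\<in>p. S ((g (Sup (snd x)) - g (Inf (snd x))) *\<^sub>C R T (g (fst x)) u))"
      unfolding rs_op_def case_prod_unfold
      by (rule linear_op_sum[OF op_on_linear[OF S(1)]]) (intro V_scale R_V)
    also have "\<dots> = (\<Sum>x\<in>p. (g (Sup (snd x)) - g (Inf (snd x))) *\<^sub>C R T (g (fst x)) (S u))"
      by (intro sum.cong refl)
        (simp add: linear_op_scale[OF op_on_linear[OF S(1)] R_V] comm[OF path_in[OF tag] u])
    finally have SX: "S (rs_op T p u) = rs_op T p (S u)"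
      by (simp add: rs_op_def case_prod_unfold)
    have "nrm (S (?J u) - ?J (S u)) \<le> nrm (S (?J u) - S (rs_op T p u)) + nrm (rs_op T p (S u) - ?J
        (S u))"
      using nrm_diff_triangle[OF in_V(3,2) X(2)] by (simp add: SX)
    also have "S (?J u) - S (rs_op T p u) = S (?J u - rs_op T p u)"
      by (rule linear_op_diff[OF op_on_linear[OF S(1)] in_V(1) X(1), symmetric])
    also have "nrm (S (?J u - rs_op T p u)) \<le> \<bar>B\<bar> * nrm (rs_op T p u - ?J u)"
    proof -
      have "nrm (S (?J u - rs_op T p u)) \<le> B * nrm (?J u - rs_op T p u)"
        by (rule S(2)[OF V_diff[OF in_V(1) X(1)]])
      also have "\<dots> \<le> \<bar>B\<bar> * nrm (?J u - rs_op T p u)"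
        by (intro mult_right_mono nrm_nonneg V_diff in_V X) simp
      finally show ?thesis using nrm_diff_commute[OF in_V(1) X(1)] by simp
    qed
    also have "\<bar>B\<bar> * nrm (rs_op T p u - ?J u) \<le> \<bar>B\<bar> * (e' * nrm u)"
      by (intro mult_left_mono d(2) p u) simp
    also have "nrm (rs_op T p (S u) - ?J (S u)) \<le> e' * nrm (S u)"
      by (rule d(2)[OF p Su])
    also have "\<bar>B\<bar> * (e' * nrm u) + e' * nrm (S u) = e' * K" by (simp add: K_def algebra_simps)
    finally show "nrm (S (?J u) - ?J (S u)) \<le> 0 + e" using e'(2) by simp
  qed
  then have "S (?J u) - ?J (S u) = 0"
    by (intro nrm_eq_0D V_diff in_V)
  then show ?thesis
    unfolding riesz_projection_def using linear_op_scale[OF op_on_linear[OF S(1)] in_V(1)] by simp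
qed

text \<open>On an eigenvector the resolvent acts as the scalar \<open>1 / (z - \<mu>)\<close>, whose integral is a winding
  number.\<close>

lemma P_eigenvector:
  assumes T: "op_on T" and spec: "path_image g \<subseteq> res T"
    and x: "x \<in> V" "T x = \<mu> *\<^sub>C x" "x \<noteq> 0"
  shows "P T x = winding_number g \<mu> *\<^sub>C x"
proof -
  obtain h where h: "valid_path h" "path_image h \<subseteq> res T" "\<And>w. w \<notin> res T \<Longrightarrow> winding_number h w
      = winding_number g w"
    and ipP: "\<And>u w. u \<in> V \<Longrightarrow> w \<in> V \<Longrightarrow> ip (P T u) w = contour_integral h (\<lambda>z. ip (R T z u) w) / two_pi_i"
    using smooth_contour_P[OF T open_res[OF T] spec order_refl] by metis
  have \<mu>: "\<mu> \<notin> res T"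
  proof
    assume "\<mu> \<in> res T"
    from R_left[OF this x(1)] have "x = R T \<mu> 0" using x(2) by simp
    also have "\<dots> = 0" using linear_op_zero[OF op_on_linear[OF op_on_R[OF T \<open>\<mu> \<in> res T\<close>]]] .
    finally show False using x(3) by simp
  qed
  have Rx: "R T z x = (1 / (z - \<mu>)) *\<^sub>C x" if z: "z \<in> res T" for z
  proof (rule R_unique[OF z V_scale[OF x(1)]])
    have "z - \<mu> \<noteq> 0" using z \<mu> by auto
    then have "z * (1 / (z - \<mu>)) - (1 / (z - \<mu>)) * \<mu> = 1"
      by (simp add: diff_divide_distrib[symmetric])
    then show "z *\<^sub>C (1 / (z - \<mu>)) *\<^sub>C x - T ((1 / (z - \<mu>)) *\<^sub>C x) = x"
      using linear_op_scale[OF op_on_linear[OF T] x(1)] x(2)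
      by (simp add: complex_vector.scale_left_diff_distrib[symmetric])
  qed
  have "\<mu> \<notin> path_image h" using \<mu> h(2) by blast
  from has_contour_integral_winding_number[OF h(1) this]
  have wn: "((\<lambda>z. 1 / (z - \<mu>)) has_contour_integral two_pi_i * winding_number g \<mu>) h"
    using h(3)[OF \<mu>] by simp
  have cancel: "a * (c * b) / c = b * a" if "c \<noteq> 0" for a b c :: complex
    using that by simp
  have in_V: "P T x \<in> V" "winding_number g \<mu> *\<^sub>C x \<in> V" using P_in[OF T spec] V_scale x(1) by auto
  have "ip (P T x - winding_number g \<mu> *\<^sub>C x) w = 0" if w: "w \<in> V" for w
  proof -
    have "contour_integral h (\<lambda>z. ip (R T z x) w) = contour_integral h (\<lambda>z. ip x w * (1 / (z - \<mu>)))"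
    proof (rule contour_integral_eq)
      fix z assume "z \<in> path_image h"
      then have "R T z x = (1 / (z - \<mu>)) *\<^sub>C x" using Rx h(2) by blast
      then show "ip (R T z x) w = ip x w * (1 / (z - \<mu>))"
        using ip_scale_left[OF x(1) w] by simp
    qed
    also have "\<dots> = ip x w * (two_pi_i * winding_number g \<mu>)"
      by (intro contour_integral_unique has_contour_integral_lmul wn)
    finally have "ip (P T x) w = winding_number g \<mu> * ip x w"
      unfolding ipP[OF x(1) w] using cancel[of two_pi_i] by simp
    then show ?thesis by (simp add: ip_diff_left[OF in_V w] ip_scale_left[OF x(1) w])
  qed
  then have "P T x - winding_number g \<mu> *\<^sub>C x = 0"
    by (intro eq_0_by_duality V_diff in_V)
  then show ?thesis by simp
qed

text \<open>Cauchy's theorem, for vectors \<open>u\<close> on which the resolvent continues analytically, as \<open>F\<close>, to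
  everything that \<open>g\<close> encircles.\<close>

lemma P_eq_0_by_continuation:
  assumes T: "op_on T" and spec: "path_image g \<subseteq> res T" and u: "u \<in> V"
    and W: "open W" "path_image g \<subseteq> W" "\<And>\<zeta>. \<zeta> \<notin> W \<Longrightarrow> winding_number g \<zeta> = 0"
    and F: "\<And>w. w \<in> V \<Longrightarrow> F w holomorphic_on W"
      "\<And>w z. w \<in> V \<Longrightarrow> z \<in> W \<Longrightarrow> z \<in> res T \<Longrightarrow> F w z = ip (R T z u) w"
  shows "P T u = 0"
proof -
  have U: "open (W \<inter> res T)" "path_image g \<subseteq> W \<inter> res T" "W \<inter> res T \<subseteq> res T"
    using W spec open_res[OF T] by auto
  obtain h where h: "valid_path h" "pathfinish h = pathstart h" "path_image h \<subseteq> W \<inter> res T"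
    "\<And>w. w \<notin> W \<inter> res T \<Longrightarrow> winding_number h w = winding_number g w"
    and ipP: "\<And>u w. u \<in> V \<Longrightarrow> w \<in> V \<Longrightarrow> ip (P T u) w = contour_integral h (\<lambda>z. ip (R T z u) w) / two_pi_i"
    using smooth_contour_P[OF T U] by metis
  have "ip (P T u) w = 0" if w: "w \<in> V" for w
  proof -
    have "contour_integral h (\<lambda>z. ip (R T z u) w) = contour_integral h (F w)"
      by (rule contour_integral_eq) (use F(2)[OF w] h(3) in fastforce)
    also have "(F w has_contour_integral 0) h"
      by (rule Cauchy_theorem_global[OF W(1) F(1)[OF w] h(1,2)]) (use h(3,4) W(3) in auto)
    then have "contour_integral h (F w) = 0" by (rule contour_integral_unique)
    finally show ?thesis by (simp add: ipP[OF u w])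
  qed
  then show ?thesis by (intro eq_0_by_duality P_in[OF T spec u])
qed

text \<open>The continuation is often the resolvent of an operator \<open>T'\<close> with less spectrum.\<close>

lemma P_eq_0_by_operator:
  assumes T: "op_on T" and spec: "path_image g \<subseteq> res T" and u: "u \<in> V"
    and T': "op_on T'" "path_image g \<subseteq> res T'" "\<And>\<zeta>. \<zeta> \<notin> res T' \<Longrightarrow> winding_number g \<zeta> = 0"
    and eq: "\<And>z. z \<in> res T \<Longrightarrow> z \<in> res T' \<Longrightarrow> R T z u = R T' z u"
  shows "P T u = 0"
  by (rule P_eq_0_by_continuation[OF T spec u open_res[OF T'(1)] T'(2,3), of "\<lambda>w z. ip (R T' z u) w"])
    (use holomorphic_resolvent[OF T'(1) u] eq in auto)

lemma resolvent_commute: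
  assumes T: "op_on T" and z: "z \<in> res T" "z' \<in> res T" and u: "u \<in> V"
  shows "R T z (R T z' u) = R T z' (R T z u)"
proof (cases "z = z'")
  case False
  have "(z - z') *\<^sub>C R T z' (R T z u) = (z - z') *\<^sub>C R T z (R T z' u)"
    using resolvent_identity[OF T z u] resolvent_identity[OF T z(2,1) u]
    by (metis complex_vector.scale_minus_left minus_diff_eq)
  then show ?thesis using False by simp
qed simp

lemma cauchy_transform_holomorphic:
  assumes h: "polynomial_function h" "open S" "S \<inter> path_image h = {}"
    and U: "open U" "path_image h \<subseteq> U" and k: "k holomorphic_on U"
  shows "(\<lambda>\<zeta>. contour_integral h (\<lambda>z. k z / (z - \<zeta>))) holomorphic_on S"
proof -
  have vh: "valid_path h" using h(1) by (rule valid_path_polynomial_function)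
  obtain M where M: "\<And>t. t \<in> {0..1} \<Longrightarrow> norm (vector_derivative h (at t)) \<le> M"
    using polynomial_path_derivative_bounded[OF h(1)] by metis
  have int: "((\<lambda>z. k z / (z - \<zeta>) ^ 1) has_contour_integral contour_integral h (\<lambda>z. k z / (z - \<zeta>))) h"
    if "\<zeta> \<in> S - path_image h" for \<zeta>
  proof -
    have "(\<lambda>z. k z / (z - \<zeta>)) holomorphic_on U - {\<zeta>}"
      by (intro holomorphic_intros holomorphic_on_subset[OF k]) auto
    then have "(\<lambda>z. k z / (z - \<zeta>)) contour_integrable_on h"
      by (rule contour_integrable_holomorphic_simple) (use U vh that in auto)
    then show ?thesis by (simp add: has_contour_integral_integral)
  qed
  have "(\<lambda>\<zeta>. contour_integral h (\<lambda>z. k z / (z - \<zeta>))) field_differentiable (at \<zeta>)" if "\<zeta> \<in> S" for \<zeta>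
    using Cauchy_next_derivative(2)[OF holomorphic_on_imp_continuous_on[OF holomorphic_on_subset[OF
        k U(2)]]
        M int _ h(2) vh, of \<zeta>] that h(3)
    by (auto simp: field_differentiable_def)
  then show ?thesis
    by (simp add: holomorphic_on_def field_differentiable_at_within)
qed

end

locale jordan_contour = contour +
  assumes winding: "\<And>\<zeta>. \<zeta> \<in> inside (path_image g) \<Longrightarrow> winding_number g \<zeta> = 1"
begin

lemma winding_outside: "\<zeta> \<notin> inside (path_image g) \<Longrightarrow> \<zeta> \<notin> path_image g \<Longrightarrow> winding_number g \<zeta> = 0"
  using winding_number_zero_in_outside[OF path closed] inside_Un_outside by blast

lemma open_inside_g: "open (inside (path_image g))"
  by (intro open_inside closed_path_image path)

text \<open>For \<open>\<zeta>\<close> inside the contour and in the resolvent set, integrate the resolvent identity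
  \<open>R(z) R(\<zeta>) u = (R(\<zeta>) u - R(z) u) / (z - \<zeta>)\<close> over \<open>z\<close>.  The left side gives \<open>2 \<pi> \<i> P R(\<zeta>) u = 2 \<pi> \<i> R(\<zeta>) P u\<close>,
  so that \<open>R(\<zeta>) (u - P u)\<close> is \<open>1 / (2 \<pi> \<i>)\<close> times the Cauchy transform of \<open>R(z) u\<close> at \<open>\<zeta>\<close>.  The latter
  is holomorphic in the whole interior.  Hence \<open>P (u - P u) = 0\<close> by continuation.  This replaces the usual
  double integral over two nested contours.\<close>

lemma P_idempotent:
  assumes T: "op_on T" and spec: "path_image g \<subseteq> res T" and u: "u \<in> V"
  shows "P T (P T u) = P T u"
proof -
  let ?in = "inside (path_image g)"
  let ?v = "u - P T u"
  have Pu: "P T u \<in> V" by (rule P_in[OF T spec u])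
  have v: "?v \<in> V" by (intro V_diff u Pu)
  \<comment> \<open>the Cauchy transform along \<open>g\<close> itself, as the smooth loop \<open>h\<close> below depends on the point \<open>\<zeta>0\<close>\<close>
  define c where "c w \<zeta> = lim (\<lambda>n. rs_sum g (\<lambda>z. ip (R T z u) w / (z - \<zeta>)) (div_seq n))" for w \<zeta>
  define F where "F w \<zeta> = (if \<zeta> \<in> res T then ip (R T \<zeta> ?v) w else c w \<zeta> / two_pi_i)" for w \<zeta>
  have local: "\<exists>\<epsilon>>0. ball \<zeta>0 \<epsilon> \<subseteq> ?in \<and> F w holomorphic_on ball \<zeta>0 \<epsilon>"
    if \<zeta>0: "\<zeta>0 \<in> ?in" and w: "w \<in> V" for \<zeta>0 w
  proof -
    obtain \<epsilon> where \<epsilon>: "0 < \<epsilon>" "cball \<zeta>0 \<epsilon> \<subseteq> ?in"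
      using open_inside_g \<zeta>0 open_contains_cball by blast
    define U where "U = res T - cball \<zeta>0 \<epsilon>"
    have U: "open U" "path_image g \<subseteq> U" "U \<subseteq> res T"
    proof -
      show "open U" unfolding U_def by (intro open_Diff open_res T closed_cball)
      show "path_image g \<subseteq> U"
        using spec \<epsilon>(2) inside_no_overlap[of "path_image g"] unfolding U_def by blast
    qed (auto simp: U_def)
    obtain h where h: "polynomial_function h" "valid_path h" "path_image h \<subseteq> U"
      "\<And>w. w \<notin> U \<Longrightarrow> winding_number h w = winding_number g w"
      "\<And>k. k holomorphic_on U \<Longrightarrow> (\<lambda>n. rs_sum g k (div_seq n)) \<longlonglongrightarrow> contour_integral h k"
      and ipP: "\<And>u w. u \<in> V \<Longrightarrow> w \<in> V \<Longrightarrow> ip (P T u) w = contour_integral h (\<lambda>z.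
          ip (R T z u) w) / two_pi_i"
      using smooth_contour_P[OF T U] by metis
    define G where "G \<zeta> = contour_integral h (\<lambda>z. ip (R T z u) w / (z - \<zeta>))" for \<zeta>
    have hol: "(\<lambda>z. ip (R T z u) w) holomorphic_on U"
      by (rule holomorphic_on_subset[OF holomorphic_resolvent[OF T u w] U(3)])
    have holq: "(\<lambda>z. ip (R T z u) w / (z - \<zeta>)) holomorphic_on U" if "\<zeta> \<in> ball \<zeta>0 \<epsilon>" for \<zeta>
      using that by (intro holomorphic_intros hol) (auto simp: U_def)
    have G_hol: "G holomorphic_on ball \<zeta>0 \<epsilon>"
      unfolding G_def
      by (rule cauchy_transform_holomorphic[OF h(1) open_ball _ U(1) h(3) hol])
        (use h(3) in \<open>auto simp: U_def\<close>)
    have F_eq: "F w \<zeta> = G \<zeta> / two_pi_i" if \<zeta>: "\<zeta> \<in> ball \<zeta>0 \<epsilon>" for \<zeta>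
    proof (cases "\<zeta> \<in> res T")
      case False
      have "c w \<zeta> = G \<zeta>" unfolding c_def G_def by (intro limI h(5) holq \<zeta>)
      with False show ?thesis by (simp add: F_def)
    next
      case True
      let ?x = "R T \<zeta> u"
      have x: "?x \<in> V" by (rule R_in[OF True u])
      obtain B where B: "res_bound T \<zeta> B" using ex_res_bound[OF True] by blast
      have "\<zeta> \<in> ?in" "\<zeta> \<notin> U" using \<zeta> \<epsilon>(2) by (auto simp: U_def)
      then have wn: "winding_number h \<zeta> = 1" using h(4) winding by simp
      have "\<zeta> \<notin> path_image h" using \<open>\<zeta> \<notin> U\<close> h(3) by blast
      from has_contour_integral_winding_number[OF h(2) this]
      have one: "((\<lambda>z. 1 / (z - \<zeta>)) has_contour_integral two_pi_i) h" by (simp add: wn)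
      have G: "((\<lambda>z. ip (R T z u) w / (z - \<zeta>)) has_contour_integral G \<zeta>) h"
        unfolding G_def
        by (intro has_contour_integral_integral contour_integrable_holomorphic_simple[OF holq[OF \<zeta>]
            U(1) h(2,3)])
      have "contour_integral h (\<lambda>z. ip (R T z ?x) w)
          = contour_integral h (\<lambda>z. ip ?x w * (1 / (z - \<zeta>)) - ip (R T z u) w / (z - \<zeta>))"
      proof (rule contour_integral_eq)
        fix z assume "z \<in> path_image h"
        then have z: "z \<in> res T" "z \<noteq> \<zeta>" using h(3) \<open>\<zeta> \<notin> U\<close> U(3) by auto
        have Rz: "R T z u \<in> V" "R T z ?x \<in> V" using R_in[OF z(1)] u x by auto
        have "ip (R T z u) w - ip ?x w = ip ((\<zeta> - z) *\<^sub>C R T z ?x) w"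
          using resolvent_identity[OF T True z(1) u] ip_diff_left[OF Rz(1) x w] by simp
        also have "\<dots> = (\<zeta> - z) * ip (R T z ?x) w" by (rule ip_scale_left[OF Rz(2) w])
        finally have "ip (R T z ?x) w * (z - \<zeta>) = ip ?x w - ip (R T z u) w"
          by (simp add: algebra_simps)
        then have "ip (R T z ?x) w = (ip ?x w - ip (R T z u) w) / (z - \<zeta>)"
          using z(2) by (simp add: eq_divide_eq)
        then show "ip (R T z ?x) w = ip ?x w * (1 / (z - \<zeta>)) - ip (R T z u) w / (z - \<zeta>)"
          by (simp add: diff_divide_distrib)
      qed
      also have "\<dots> = ip ?x w * two_pi_i - G \<zeta>"
        by (intro contour_integral_unique has_contour_integral_diff has_contour_integral_lmul one G)
      finally have "ip (P T ?x) w = ip ?x w - G \<zeta> / two_pi_i"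
        unfolding ipP[OF x w] by (simp add: diff_divide_distrib)
      moreover have "R T \<zeta> (P T u) = P T ?x"
        by (rule P_commute[OF T spec op_on_R[OF T True] res_boundD[OF B] _ u])
          (auto intro: resolvent_commute[OF T True] subsetD[OF spec])
      moreover have "R T \<zeta> ?v = ?x - R T \<zeta> (P T u)"
        by (rule linear_op_diff[OF op_on_linear[OF op_on_R[OF T True]] u Pu])
      ultimately show ?thesis
        using True ip_diff_left[OF x P_in[OF T spec x] w] by (simp add: F_def)
    qed
    have "F w holomorphic_on ball \<zeta>0 \<epsilon>"
      by (rule holomorphic_transform[of "\<lambda>\<zeta>. G \<zeta> / two_pi_i"])
        (auto intro!: holomorphic_intros G_hol simp: F_eq)
    moreover have "ball \<zeta>0 \<epsilon> \<subseteq> ?in" using \<epsilon>(2) ball_subset_cball by blast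
    ultimately show ?thesis using \<epsilon>(1) by blast
  qed
  have F_hol: "F w holomorphic_on res T \<union> ?in" if w: "w \<in> V" for w
  proof -
    have "F w holomorphic_on res T"
      by (rule holomorphic_transform[OF holomorphic_resolvent[OF T v w]]) (simp add: F_def)
    moreover have "F w holomorphic_on ?in"
    proof -
      have "F w field_differentiable (at \<zeta>)" if \<zeta>: "\<zeta> \<in> ?in" for \<zeta>
      proof -
        obtain \<epsilon> where "0 < \<epsilon>" "F w holomorphic_on ball \<zeta> \<epsilon>" using local[OF \<zeta> w] by blast
        then show ?thesis
          using holomorphic_on_imp_differentiable_at[of "F w" "ball \<zeta> \<epsilon>" \<zeta>] by simp
      qed
      then show ?thesis by (simp add: holomorphic_on_def field_differentiable_at_within)
    qed
    ultimately show ?thesis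
      by (rule holomorphic_on_Un[OF _ _ open_res[OF T] open_inside_g])
  qed
  have "P T ?v = 0"
  proof (rule P_eq_0_by_continuation[OF T spec v, where F = F])
    show "open (res T \<union> ?in)" by (intro open_Un open_res T open_inside_g)
    show "path_image g \<subseteq> res T \<union> ?in" using spec by blast
    show "winding_number g \<zeta> = 0" if "\<zeta> \<notin> res T \<union> ?in" for \<zeta>
      using winding_outside[of \<zeta>] that spec by blast
  qed (use F_hol in \<open>auto simp: F_def\<close>)
  moreover have "P T ?v = P T u - P T (P T u)"
    by (rule linear_op_diff[OF op_on_linear[OF op_on_P[OF T spec]] u Pu])
  ultimately show ?thesis by simp
qed

end

context contour
begin

text \<open>Bound the difference of the Riemann-Stieltjes sums for \<open>T\<close> and \<open>T'\<close> along a common division by the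
  length \<open>L\<close> times the uniform distance of the two resolvents on the curve.\<close>

lemma P_perturbation:
  assumes T: "op_on T" and spec: "path_image g \<subseteq> res T" and "0 < e"
  obtains \<eta> where "0 < \<eta>"
    "\<And>T'. op_on T' \<Longrightarrow> (\<And>u. u \<in> V \<Longrightarrow> nrm (T' u - T u) \<le> \<eta> * nrm u) \<Longrightarrow> path_image g \<subseteq> res T'"
    "\<And>T' u. op_on T' \<Longrightarrow> (\<And>u. u \<in> V \<Longrightarrow> nrm (T' u - T u) \<le> \<eta> * nrm u) \<Longrightarrow> u \<in> V \<Longrightarrow>
      nrm (P T' u - P T u) \<le> e * nrm u"
proof -
  obtain B where B: "0 < B" "\<And>z. z \<in> path_image g \<Longrightarrow> res_bound T z B"
    using compact_res_bound[OF T compact_path_image[OF path] spec] by metis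
  \<comment> \<open>the first bound keeps the resolvents bounded by \<open>2 B\<close>, hence at distance at most \<open>2 B\<^sup>2 \<eta>\<close>\<close>
  define \<eta> where "\<eta> = min (1 / (2 * B)) (e / (2 * B\<^sup>2 * (L + 1)))"
  have \<eta>: "0 < \<eta>" "B * \<eta> \<le> 1 / 2" "2 * B\<^sup>2 * \<eta> * L \<le> e"
  proof -
    show "0 < \<eta>" using B(1) \<open>0 < e\<close> L_nonneg by (simp add: \<eta>_def)
    have "B * \<eta> \<le> B * (1 / (2 * B))" using B(1) by (intro mult_left_mono) (auto simp: \<eta>_def)
    then show "B * \<eta> \<le> 1 / 2" using B(1) by simp
    have "2 * B\<^sup>2 * \<eta> \<le> 2 * B\<^sup>2 * (e / (2 * B\<^sup>2 * (L + 1)))"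
      using B(1) by (intro mult_left_mono) (auto simp: \<eta>_def)
    also have "\<dots> = e / (L + 1)"
      by (subst times_divide_eq_right, subst mult_divide_mult_cancel_left) (use B(1) in auto)
    finally have "2 * B\<^sup>2 * \<eta> * L \<le> e / (L + 1) * L" using L_nonneg by (rule mult_right_mono)
    also have "\<dots> \<le> e" using L_nonneg \<open>0 < e\<close> by (simp add: field_simps)
    finally show "2 * B\<^sup>2 * \<eta> * L \<le> e" .
  qed
  have main: "path_image g \<subseteq> res T' \<and> (\<forall>u\<in>V. nrm (P T' u - P T u) \<le> e * nrm u)"
    if T': "op_on T'" and near: "\<And>u. u \<in> V \<Longrightarrow> nrm (T' u - T u) \<le> \<eta> * nrm u" for T'
  proof -
    have close: "nrm ((z *\<^sub>C u - T' u) - (z *\<^sub>C u - T u)) \<le> \<eta> * nrm u" if "u \<in> V" for u z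
      using near[OF that] nrm_diff_commute[OF op_on_in[OF T' that] op_on_in[OF T that]] by simp
    have lt: "B * \<eta> < 1" using \<eta>(2) by simp
    have le: "B / (1 - B * \<eta>) \<le> 2 * B"
    proof -
      have "B * 1 \<le> B * (2 * (1 - B * \<eta>))" using \<eta>(2) B(1) by (intro mult_left_mono) auto
      then show ?thesis using \<eta>(2) by (simp add: divide_le_eq mult_ac)
    qed
    have res': "z \<in> res T'" if z: "z \<in> path_image g" for z
    proof -
      have "res_bound T' z (B / (1 - B * \<eta>))"
        by (rule resolvent_perturbation(1)[OF T B(2)[OF z] less_imp_le[OF B(1)] T' less_imp_le[OF
            \<eta>(1)] lt])
          (rule close)
      then show ?thesis by (simp add: res_bound_def)
    qed
    have diff: "nrm (R T' z u - R T z u) \<le> 2 * B\<^sup>2 * \<eta> * nrm u" if z: "z \<in> path_image g"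
        and u: "u \<in> V" for z u
    proof -
      have "nrm (R T' z u - R T z u) \<le> B * \<eta> * (B / (1 - B * \<eta>)) * nrm u"
        by (rule resolvent_perturbation(2)[OF T B(2)[OF z] less_imp_le[OF B(1)] T' less_imp_le[OF
            \<eta>(1)] lt _ u])
          (rule close)
      also have "\<dots> \<le> B * \<eta> * (2 * B) * nrm u"
        using le B(1) \<eta>(1) nrm_nonneg[OF u] by (intro mult_right_mono mult_left_mono) auto
      finally show ?thesis by (simp add: power2_eq_square mult_ac)
    qed
    have spec': "path_image g \<subseteq> res T'" using res' by blast
    have "nrm (P T' u - P T u) \<le> e * nrm u" if u: "u \<in> V" for u
    proof -
      let ?J = "op_contour_integral V nrm (R T) g" and ?J' = "op_contour_integral V nrm (R T') g"
      have in_V: "?J u \<in> V" "?J' u \<in> V" using J_in[OF T spec u] J_in[OF T' spec' u] by auto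
      have "nrm (?J' u - ?J u) \<le> e * nrm u"
      proof (rule field_le_epsilon)
        fix \<epsilon> :: real assume "0 < \<epsilon>"
        define \<epsilon>' where "\<epsilon>' = \<epsilon> / (2 * nrm u + 1)"
        have \<epsilon>': "0 < \<epsilon>'" "2 * (\<epsilon>' * nrm u) \<le> \<epsilon>"
          using \<open>0 < \<epsilon>\<close> nrm_nonneg[OF u] by (auto simp: \<epsilon>'_def field_simps)
        obtain d1 where d1: "0 < d1" "\<And>p u. fine_div d1 p \<Longrightarrow> u \<in> V \<Longrightarrow> nrm (rs_op T p u - ?J u)
            \<le> \<epsilon>' * nrm u"
          using rs_op_near_J[OF T spec \<epsilon>'(1)] by blast
        obtain d2 where d2: "0 < d2" "\<And>p u. fine_div d2 p \<Longrightarrow> u \<in> V \<Longrightarrow> nrm (rs_op T' p u - ?J' u)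
            \<le> \<epsilon>' * nrm u"
          using rs_op_near_J[OF T' spec' \<epsilon>'(1)] by blast
        obtain p where p: "fine_div (min d1 d2) p" using fine_div_exists[of "min d1 d2"] d1 d2 by auto
        have p12: "fine_div d1 p" "fine_div d2 p" by (rule fine_div_mono[OF p], simp)+
        have X: "rs_op T p u \<in> V" "rs_op T' p u \<in> V"
          using rs_op_in[OF T spec p u] rs_op_in[OF T' spec' p u] by auto
        have tag: "fst x \<in> {0..1}" if "x \<in> p" for x
          using fine_div_tag[OF p] that by (metis prod.collapse)
        have RV: "R T (g (fst x)) u \<in> V" "R T' (g (fst x)) u \<in> V" if "x \<in> p" for x
          using R_in[OF g_res[OF T spec tag[OF that]] u] R_in[OF g_res[OF T' spec' tag[OF that]] u]
              by auto
        have "rs_op T' p u - rs_op T p u = (\<Sum>x\<in>p. (g (Sup (snd x)) - g (Inf (snd x))) *\<^sub>C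
            (R T' (g (fst x)) u - R T (g (fst x)) u))"
          by (simp add: rs_op_def case_prod_unfold sum_subtractf
              complex_vector.scale_right_diff_distrib)
        also have "nrm \<dots> \<le> (\<Sum>x\<in>p. nrm ((g (Sup (snd x)) - g (Inf (snd x))) *\<^sub>C
            (R T' (g (fst x)) u - R T (g (fst x)) u)))"
          by (intro nrm_sum V_scale V_diff RV)
        also have "\<dots> \<le> (\<Sum>x\<in>p. cmod (g (Sup (snd x)) - g (Inf (snd x))) * (2 * B\<^sup>2 * \<eta> * nrm u))"
        proof (rule sum_mono)
          fix x assume x: "x \<in> p"
          show "nrm ((g (Sup (snd x)) - g (Inf (snd x))) *\<^sub>C (R T' (g (fst x)) u - R T (g (fst x)) u))
              \<le> cmod (g (Sup (snd x)) - g (Inf (snd x))) * (2 * B\<^sup>2 * \<eta> * nrm u)"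
            unfolding nrm_scale[OF V_diff[OF RV(2)[OF x] RV(1)[OF x]]]
            by (intro mult_left_mono diff path_in tag x u) simp
        qed
        also have "\<dots> = (\<Sum>(t, K)\<in>p. cmod (g (Sup K) - g (Inf K))) * (2 * B\<^sup>2 * \<eta> * nrm u)"
          by (simp add: sum_distrib_right case_prod_unfold)
        also have "\<dots> \<le> L * (2 * B\<^sup>2 * \<eta> * nrm u)"
          using variation_le_tagged[OF var] p nrm_nonneg[OF u] \<eta>(1)
          by (intro mult_right_mono) (auto simp: fine_div_def)
        also have "\<dots> = (2 * B\<^sup>2 * \<eta> * L) * nrm u" by simp
        also have "\<dots> \<le> e * nrm u" by (intro mult_right_mono \<eta>(3) nrm_nonneg u)
        finally have mid: "nrm (rs_op T' p u - rs_op T p u) \<le> e * nrm u" .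
        have "nrm (?J' u - ?J u) \<le> nrm (?J' u - rs_op T' p u) + nrm (rs_op T' p u - ?J u)"
          by (intro nrm_diff_triangle in_V X)
        also have "nrm (rs_op T' p u - ?J u) \<le> nrm (rs_op T' p u - rs_op T p u) + nrm (rs_op T p u -
            ?J u)"
          by (intro nrm_diff_triangle in_V X)
        also have "nrm (?J' u - rs_op T' p u) = nrm (rs_op T' p u - ?J' u)"
          by (rule nrm_diff_commute[OF in_V(2) X(2)])
        finally show "nrm (?J' u - ?J u) \<le> e * nrm u + \<epsilon>"
          using mid d1(2)[OF p12(1) u] d2(2)[OF p12(2) u] \<epsilon>'(2) by simp
      qed
      moreover have "nrm (P T' u - P T u) = cmod (1 / two_pi_i) * nrm (?J' u - ?J u)"
        unfolding riesz_projection_def complex_vector.scale_right_diff_distrib[symmetric]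
        by (rule nrm_scale[OF V_diff[OF in_V(2,1)]])
      moreover have "cmod (1 / two_pi_i) \<le> 1"
        using pi_gt3 by (simp add: norm_divide norm_mult)
      ultimately show ?thesis
        using mult_right_mono[of "cmod (1 / two_pi_i)" 1 "nrm (?J' u - ?J u)"]
            nrm_nonneg[OF V_diff[OF in_V(2,1)]]
        by simp
    qed
    with spec' show ?thesis by blast
  qed
  show thesis by (rule that[OF \<eta>(1)]) (use main in blast)+
qed

end

section \<open>The Fredholm alternative for limits of finite-rank operators\<close>

lemma linear_op_subset:
  assumes "linear_op F T" "complex_vector.subspace W" "W \<subseteq> F"
  shows "linear_op W T"
  using assms unfolding linear_op_def by blast

lemma findim_subspace_join:
  assumes "findim_subspace W" "findim_subspace E" "complex_vector.subspace V" "W \<subseteq> V" "E \<subseteq> V"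
  obtains W' where "findim_subspace W'" "W \<subseteq> W'" "E \<subseteq> W'" "W' \<subseteq> V"
proof -
  obtain A B where A: "finite A" "W = complex_vector.span A" and B: "finite B" "E
      = complex_vector.span B"
    using assms by (auto simp: findim_subspace_def)
  have "findim_subspace (complex_vector.span (A \<union> B))"
    using A B by (auto simp: findim_subspace_def)
  moreover have "W \<subseteq> complex_vector.span (A \<union> B)" "E \<subseteq> complex_vector.span (A \<union> B)"
    unfolding A B by (auto intro!: complex_vector.span_mono)
  moreover have "complex_vector.span (A \<union> B) \<subseteq> V"
  proof (rule complex_vector.span_minimal[OF _ assms(3)])
    show "A \<union> B \<subseteq> V"
      using assms(4,5) complex_vector.span_superset[of A] complex_vector.span_superset[of B] A B
          by blast
  qed
  ultimately show thesis by (rule that)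
qed

context hilbert_on
begin

lemma large_in_res:
  assumes G: "op_on G" "\<And>u. u \<in> V \<Longrightarrow> nrm (G u) \<le> b * nrm u" and "0 \<le> b" "b < cmod c"
  shows "res_bound G c (1 / (cmod c - b))"
proof (rule res_boundI[OF G(1)])
  have c: "c \<noteq> 0" using assms(3,4) by auto
  fix y assume y: "y \<in> V"
  define K where "K u = (1 / c) *\<^sub>C G u" for u
  have K1: "linear_op V K"
    using linear_op_add[OF op_on_linear[OF G(1)]] linear_op_scale[OF op_on_linear[OF G(1)]] subspace_V
    by (simp add: linear_op_def K_def scaleC_add_right mult.commute)
  have K2: "K u \<in> V" if "u \<in> V" for u
    unfolding K_def by (intro V_scale op_on_in[OF G(1)] that)
  have K3: "nrm (K u) \<le> (b / cmod c) * nrm u" if u: "u \<in> V" for u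
    unfolding K_def nrm_scale[OF op_on_in[OF G(1) u]]
    using G(2)[OF u] c by (simp add: norm_divide divide_right_mono)
  have q: "0 \<le> b / cmod c" "b / cmod c < 1" using assms(3,4) c by (auto simp: divide_less_eq)
  obtain x where x: "x \<in> V" "x - K x = (1 / c) *\<^sub>C y"
    using neumann[OF K1 K2 K3 q V_scale[OF y]] by metis
  have "c *\<^sub>C x - G x = c *\<^sub>C (x - K x)"
    using c by (simp add: K_def complex_vector.scale_right_diff_distrib)
  also have "\<dots> = y" unfolding x(2) using c by simp
  finally show "\<exists>x\<in>V. c *\<^sub>C x - G x = y" using x(1) by blast
next
  fix x assume x: "x \<in> V"
  have Gx: "G x \<in> V" "c *\<^sub>C x \<in> V" using op_on_in[OF G(1) x] V_scale[OF x] by auto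
  have "cmod c * nrm x = nrm ((c *\<^sub>C x - G x) + G x)" by (simp add: nrm_scale[OF x])
  also have "\<dots> \<le> nrm (c *\<^sub>C x - G x) + nrm (G x)"
    by (intro nrm_triangle V_diff Gx)
  finally have "(cmod c - b) * nrm x \<le> nrm (c *\<^sub>C x - G x)"
    using G(2)[OF x] by (simp add: algebra_simps)
  then show "nrm x \<le> 1 / (cmod c - b) * nrm (c *\<^sub>C x - G x)"
    using assms(4) by (simp add: pos_le_divide_eq mult.commute)
qed

text \<open>The compact operators on \<open>V\<close>, described by what a discretization provides.\<close>

definition finite_rank_limit :: "('a \<Rightarrow> 'a) \<Rightarrow> bool" where
  "finite_rank_limit Q \<longleftrightarrow> op_on Q \<and> (\<forall>e>0. \<exists>F W B. op_on F \<and> findim_subspace W \<and> W \<subseteq> V \<and>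
     (\<forall>u\<in>V. F u \<in> W \<and> nrm (F u) \<le> B * nrm u \<and> nrm (Q u - F u) \<le> e * nrm u))"

text \<open>If \<open>F\<close> has finite rank and is close to \<open>Q\<close>, then \<open>c - (Q - F)\<close> has a bounded inverse \<open>H\<close>, and
  \<open>H (c - Q) = 1 - H F\<close> differs from the identity by an operator of finite rank.\<close>

lemma finite_rank_reduction:
  assumes Q: "finite_rank_limit Q" and c: "c \<noteq> 0"
  obtains H F W b where "op_on H" "op_on F" "findim_subspace W" "W \<subseteq> V"
    "\<And>u. u \<in> V \<Longrightarrow> H (F u) \<in> W" "0 \<le> b" "\<And>u. u \<in> V \<Longrightarrow> nrm (H u) \<le> b * nrm u"
    "\<And>u. u \<in> V \<Longrightarrow> nrm (H (F u)) \<le> b * nrm u"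
    "\<And>x y. x \<in> V \<Longrightarrow> y \<in> V \<Longrightarrow> c *\<^sub>C x - Q x = y \<longleftrightarrow> x - H (F x) = H y"
proof -
  have opQ: "op_on Q" using Q by (simp add: finite_rank_limit_def)
  have "0 < cmod c / 2" using c by simp
  with Q obtain F W B where F: "op_on F" "findim_subspace W" "W \<subseteq> V" "\<And>u. u \<in> V \<Longrightarrow> F u \<in> W"
    "\<And>u. u \<in> V \<Longrightarrow> nrm (F u) \<le> B * nrm u" "\<And>u. u \<in> V \<Longrightarrow> nrm (Q u - F u) \<le> cmod c / 2 * nrm u"
    unfolding finite_rank_limit_def by metis
  define G where "G u = Q u - F u" for u
  have G: "op_on G"
    using linear_op_add[OF op_on_linear[OF opQ]] linear_op_add[OF op_on_linear[OF F(1)]]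
      linear_op_scale[OF op_on_linear[OF opQ]] linear_op_scale[OF op_on_linear[OF F(1)]] subspace_V
      V_diff[OF op_on_in[OF opQ] op_on_in[OF F(1)]]
    by (simp add: op_on_def linear_op_def G_def complex_vector.scale_right_diff_distrib)
  have G_le: "nrm (G u) \<le> cmod c / 2 * nrm u" if "u \<in> V" for u
    unfolding G_def by (rule F(6)[OF that])
  have rb: "res_bound G c (1 / (cmod c - cmod c / 2))"
    by (rule large_in_res[OF G G_le]) (use c in auto)
  then have cG: "c \<in> res G" by (simp add: res_bound_def)
  define H where "H = R G c"
  have H: "op_on H" unfolding H_def by (rule op_on_R[OF G cG])
  have H_le: "nrm (H u) \<le> 2 / cmod c * nrm u" if "u \<in> V" for u
    using res_boundD[OF rb that] by (simp add: H_def)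
  define b where "b = max (2 / cmod c) (2 / cmod c * \<bar>B\<bar>)"
  have b: "0 \<le> b" "2 / cmod c \<le> b" "2 / cmod c * \<bar>B\<bar> \<le> b"
    using c by (auto simp: b_def le_max_iff_disj)
  have FV: "F u \<in> V" if "u \<in> V" for u by (rule op_on_in[OF F(1) that])
  have WH: "findim_subspace (H ` W)"
    by (rule findim_subspace_image[OF F(2) linear_op_subset[OF op_on_linear[OF H]
        findim_subspaceD[OF F(2)] F(3)]])
  have HV: "H ` W \<subseteq> V" using op_on_in[OF H] F(3) by blast
  have HFW: "H (F u) \<in> H ` W" if "u \<in> V" for u using F(4)[OF that] by blast
  have Hb: "nrm (H u) \<le> b * nrm u" if u: "u \<in> V" for u
    using H_le[OF u] mult_right_mono[OF b(2) nrm_nonneg[OF u]] by linarith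
  have HFb: "nrm (H (F u)) \<le> b * nrm u" if u: "u \<in> V" for u
  proof -
    have "nrm (F u) \<le> \<bar>B\<bar> * nrm u"
      using F(5)[OF u] mult_right_mono[OF abs_ge_self nrm_nonneg[OF u], of B] by linarith
    then have "2 / cmod c * nrm (F u) \<le> 2 / cmod c * (\<bar>B\<bar> * nrm u)"
      by (rule mult_left_mono) simp
    also have "\<dots> \<le> b * nrm u"
      using mult_right_mono[OF b(3) nrm_nonneg[OF u]] by (simp add: mult.assoc)
    finally show ?thesis using H_le[OF FV[OF u]] by linarith
  qed
  have iff: "c *\<^sub>C x - Q x = y \<longleftrightarrow> x - H (F x) = H y" if x: "x \<in> V" and y: "y \<in> V" for x y
  proof -
    have eq: "c *\<^sub>C x - Q x = (c *\<^sub>C x - G x) - F x" by (simp add: G_def)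
    have Gx: "c *\<^sub>C x - G x \<in> V" by (intro V_diff V_scale x op_on_in[OF G])
    show ?thesis
    proof
      assume "c *\<^sub>C x - Q x = y"
      then have "H y = H (c *\<^sub>C x - G x) - H (F x)"
        using linear_op_diff[OF op_on_linear[OF H] Gx FV[OF x]] eq by simp
      then show "x - H (F x) = H y" using R_left[OF cG x] by (simp add: H_def)
    next
      assume "x - H (F x) = H y"
      then have "x = H y + H (F x)" by (metis diff_add_cancel)
      then have "x = H (y + F x)"
        using linear_op_add[OF op_on_linear[OF H] y FV[OF x]] by simp
      then have "c *\<^sub>C x - G x = y + F x"
        using R_right[OF cG V_add[OF y FV[OF x]]] by (simp add: H_def)
      then show "c *\<^sub>C x - Q x = y" using eq by simp
    qed
  qed
  show thesis by (rule that[OF H F(1) WH HV HFW b(1) Hb HFb iff])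
qed

text \<open>Eigenvectors satisfy \<open>x = H F x\<close>, so they lie in the range of an operator of finite rank.\<close>

lemma findim_eigenspace:
  assumes Q: "finite_rank_limit Q" and c: "c \<noteq> 0"
  shows "findim_subspace {x\<in>V. Q x = c *\<^sub>C x}"
proof -
  obtain H F W where H: "op_on H" "findim_subspace W" "\<And>u. u \<in> V \<Longrightarrow> H (F u) \<in> W"
    and eq: "\<And>x y. x \<in> V \<Longrightarrow> y \<in> V \<Longrightarrow> c *\<^sub>C x - Q x = y \<longleftrightarrow> x - H (F x) = H y"
    using finite_rank_reduction[OF Q c] by metis
  have Qlin: "linear_op V Q" using Q by (simp add: finite_rank_limit_def op_on_def)
  show ?thesis
  proof (rule findim_subspace_subset[OF H(2)])
    show "complex_vector.subspace {x \<in> V. Q x = c *\<^sub>C x}"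
      using V_zero V_add V_scale linear_op_zero[OF Qlin] linear_op_add[OF Qlin] linear_op_scale[OF
          Qlin]
      by (auto simp: complex_vector.subspace_def scaleC_add_right mult.commute)
    show "{x \<in> V. Q x = c *\<^sub>C x} \<subseteq> W"
    proof
      fix x assume x: "x \<in> {x \<in> V. Q x = c *\<^sub>C x}"
      then have "x - H (F x) = H 0" using eq[of x 0] V_zero by simp
      then have "x = H (F x)" using linear_op_zero[OF op_on_linear[OF H(1)]] by simp
      then show "x \<in> W" using H(3) x by (metis (no_types, lifting) mem_Collect_eq)
    qed
  qed
qed

text \<open>The equation \<open>(1 - H F) x = H y\<close> reduces to the finite-dimensional space \<open>W\<close>, which contains the
  range of \<open>H F\<close>: put \<open>x = H y + v\<close> and solve \<open>(1 - H F) v = H F H y\<close> in \<open>W\<close>.  There injectivity gives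
  solvability and a bound.\<close>

lemma fredholm_alternative:
  assumes Q: "finite_rank_limit Q" and c: "c \<noteq> 0"
    and inj: "\<And>x. x \<in> V \<Longrightarrow> Q x = c *\<^sub>C x \<Longrightarrow> x = 0"
  shows "c \<in> res Q"
proof -
  obtain H F W b where H: "op_on H" "op_on F" "findim_subspace W" "W \<subseteq> V"
    "\<And>u. u \<in> V \<Longrightarrow> H (F u) \<in> W" "0 \<le> b" "\<And>u. u \<in> V \<Longrightarrow> nrm (H u) \<le> b * nrm u"
    "\<And>u. u \<in> V \<Longrightarrow> nrm (H (F u)) \<le> b * nrm u"
    and eq: "\<And>x y. x \<in> V \<Longrightarrow> y \<in> V \<Longrightarrow> c *\<^sub>C x - Q x = y \<longleftrightarrow> x - H (F x) = H y"
    by (rule finite_rank_reduction[OF Q c]) (rule that)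
  have opQ: "op_on Q" using Q by (simp add: finite_rank_limit_def)
  have HV: "H u \<in> V" "H (F u) \<in> V" if "u \<in> V" for u
    using that op_on_in[OF H(1)] op_on_in[OF H(2)] by auto
  have subW: "complex_vector.subspace W" by (rule findim_subspaceD[OF H(3)])
  define M where "M x = x - H (F x)" for x
  have M_add: "M (x + y) = M x + M y" if "x \<in> V" "y \<in> V" for x y
    using that linear_op_add[OF op_on_linear[OF H(1)]] linear_op_add[OF op_on_linear[OF H(2)]]
      op_on_in[OF H(2)] by (simp add: M_def)
  have M_scale: "M (k *\<^sub>C x) = k *\<^sub>C M x" if "x \<in> V" for x k
    using that linear_op_scale[OF op_on_linear[OF H(1)]] linear_op_scale[OF op_on_linear[OF H(2)]]
      op_on_in[OF H(2)] by (simp add: M_def complex_vector.scale_right_diff_distrib)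
  have M: "linear_op W M"
    unfolding linear_op_def using subW M_add M_scale H(4) by blast
  have MW: "M x \<in> W" if "x \<in> W" for x
    unfolding M_def using that H(4,5) complex_vector.subspace_diff[OF subW] by blast
  have ker: "x = 0" if x: "x \<in> W" "M x = 0" for x
  proof -
    have "x \<in> V" using x H(4) by blast
    then have "c *\<^sub>C x - Q x = 0"
      using eq[of x 0] V_zero x(2) linear_op_zero[OF op_on_linear[OF H(1)]] by (simp add: M_def)
    then show ?thesis using inj[OF \<open>x \<in> V\<close>] by simp
  qed
  have surj: "M ` W = W" by (rule findim_inj_imp_surj[OF H(3) M MW ker])
  have bij: "bij_betw M W W" using inj_on_linear_op[OF M ker] surj by (simp add: bij_betw_def)
  have inv: "linear_op W (the_inv_into W M)" by (rule linear_op_the_inv_into[OF M bij subW])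
  have inv_in: "the_inv_into W M x \<in> W" if "x \<in> W" for x
    using the_inv_into_into[of M W x W] bij that by (simp add: bij_betw_def)
  have inv_add: "nrm (the_inv_into W M (x + y)) \<le> nrm (the_inv_into W M x) + nrm (the_inv_into W M y)"
    if "x \<in> W" "y \<in> W" for x y
    unfolding linear_op_add[OF inv that] using inv_in that H(4) by (intro nrm_triangle) auto
  have inv_scale: "nrm (the_inv_into W M (a *\<^sub>C x)) = cmod a * nrm (the_inv_into W M x)"
    if "x \<in> W" for a x
    unfolding linear_op_scale[OF inv that] using inv_in that H(4) by (intro nrm_scale) auto
  obtain k where k: "0 < k" "\<And>x. x \<in> W \<Longrightarrow> nrm (the_inv_into W M x) \<le> k * norm x"
    using findim_seminorm_bound[OF H(3) inv_add inv_scale] by metis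
  have "res_bound Q c (b + k * C * b * b)"
  proof (rule res_boundI[OF opQ])
    fix y assume y: "y \<in> V"
    have "H (F (H y)) \<in> W" using H(5) HV(1)[OF y] by blast
    then obtain x where x: "x \<in> W" "M x = H (F (H y))" using surj by (metis imageE)
    have xV: "x \<in> V" using x H(4) by blast
    have "M (H y + x) = H y" unfolding M_add[OF HV(1)[OF y] xV] x(2) by (simp add: M_def)
    then have "c *\<^sub>C (H y + x) - Q (H y + x) = y"
      using eq[OF V_add[OF HV(1)[OF y] xV] y] by (simp add: M_def)
    then show "\<exists>x\<in>V. c *\<^sub>C x - Q x = y" using V_add[OF HV(1)[OF y] xV] by blast
  next
    fix x assume x: "x \<in> V"
    define y where "y = c *\<^sub>C x - Q x"
    have y: "y \<in> V" unfolding y_def by (intro V_diff V_scale x op_on_in[OF opQ])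
    have Mx: "M x = H y" using eq[OF x y] by (simp add: M_def y_def)
    define v where "v = H (F x)"
    have v: "v \<in> W" unfolding v_def by (rule H(5)[OF x])
    then have vV: "v \<in> V" using H(4) by blast
    have xv: "x = H y + v" using Mx unfolding M_def v_def by (metis diff_add_cancel)
    have HFH: "H (F (H y)) \<in> W" using H(5) HV(1)[OF y] by blast
    have "M v = H (F x) - H (F v)" by (simp add: M_def v_def)
    also have "\<dots> = H (F (H y))"
      using xv linear_op_add[OF op_on_linear[OF H(2)] HV(1)[OF y] vV]
        linear_op_add[OF op_on_linear[OF H(1)] op_on_in[OF H(2) HV(1)[OF y]] op_on_in[OF H(2) vV]]
            by simp
    finally have "v = the_inv_into W M (H (F (H y)))"
      using the_inv_into_f_f[of M W v] bij v by (simp add: bij_betw_def)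
    then have "nrm v \<le> k * norm (H (F (H y)))" using k(2)[OF HFH] by simp
    also have "\<dots> \<le> k * (C * nrm (H (F (H y))))"
      using k(1) embedding[OF HV(2)[OF HV(1)[OF y]]] by (intro mult_left_mono) auto
    also have "\<dots> \<le> k * (C * (b * (b * nrm y)))"
    proof -
      have "nrm (H (F (H y))) \<le> b * nrm (H y)" by (rule H(8)[OF HV(1)[OF y]])
      also have "\<dots> \<le> b * (b * nrm y)" by (intro mult_left_mono H(7) y H(6))
      finally show ?thesis using k(1) C_pos by (intro mult_left_mono) auto
    qed
    finally have "nrm v \<le> k * C * b * b * nrm y" by (simp add: mult.assoc)
    moreover have "nrm x \<le> nrm (H y) + nrm v"
      unfolding xv by (intro nrm_triangle HV(1) y vV)
    ultimately show "nrm x \<le> (b + k * C * b * b) * nrm (c *\<^sub>C x - Q x)"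
      using H(7)[OF y] by (simp add: y_def[symmetric] distrib_right)
  qed
  then show ?thesis by (simp add: res_bound_def)
qed

end

section \<open>Resolvents and rational filters of a selfadjoint operator\<close>

locale eigen_cluster =
  fixes domA :: "'a::complex_hilbert_space set" and A :: "'a \<Rightarrow> 'a" and \<Lambda> :: "complex set"
      and E :: "'a set"
  assumes selfadjoint: "selfadjoint_op domA A"
    and real: "\<Lambda> \<subseteq> range complex_of_real"
    and E_span: "E = complex_vector.span (\<Union>c\<in>\<Lambda>. eigenspace domA A c - {0})"
    and findim_E: "findim_subspace E"
begin

abbreviation "RA \<equiv> resolvent domA A"
abbreviation "S \<equiv> orth_proj E"

lemma linear_A: "linear_op domA A"
  using selfadjoint by (simp add: selfadjoint_op_def)

lemma sym_A: "x \<in> domA \<Longrightarrow> y \<in> domA \<Longrightarrow> cinner (A x) y = cinner x (A y)"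
  using selfadjoint by (simp add: selfadjoint_op_def)

lemma subspace_E: "complex_vector.subspace E"
  by (rule findim_subspaceD[OF findim_E])

lemma linear_S: "complex_linear S"
  by (rule orth_proj_linear[OF findim_E])

lemma
  shows S_add: "S (x + y) = S x + S y" and S_diff: "S (x - y) = S x - S y"
    and S_scale: "S (c *\<^sub>C x) = c *\<^sub>C S x" and S_zero: "S 0 = 0" 
proof -
  interpret S: Vector_Spaces.linear scaleC scaleC S by (rule linear_S)
  show "S (x + y) = S x + S y" "S (x - y) = S x - S y" "S (c *\<^sub>C x) = c *\<^sub>C S x" "S 0 = 0"
    by (simp_all add: S.add S.diff S.scale S.zero)
qed

lemmas S_in = orth_proj_in[OF findim_E] and S_id = orth_proj_id[OF findim_E]
  and S_orth = orth_proj_orth[OF findim_E] and norm_S_le = norm_orth_proj_le[OF findim_E]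

lemma S_eq_0_iff: "S x = 0 \<longleftrightarrow> (\<forall>e\<in>E. cinner x e = 0)"
proof
  assume "S x = 0"
  then show "\<forall>e\<in>E. cinner x e = 0" using S_orth[of _ x] by simp
next
  assume "\<forall>e\<in>E. cinner x e = 0"
  then show "S x = 0"
    by (intro orth_proj_unique subspace_E complex_vector.subspace_0) auto
qed

lemma S_compl: "S (x - S x) = 0"
  by (simp add: S_diff S_id S_in)

lemma E_induct [consumes 1, case_names zero eigenvector add]:
  assumes "x \<in> E" "Q 0"
    and eig: "\<And>x l. x \<in> domA \<Longrightarrow> x \<noteq> 0 \<Longrightarrow> A x = complex_of_real l *\<^sub>C x \<Longrightarrow> complex_of_real l \<in> \<Lambda> \<Longrightarrow>
      x \<in> E \<Longrightarrow> Q x"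
    and add: "\<And>x y. x \<in> E \<Longrightarrow> y \<in> E \<Longrightarrow> Q x \<Longrightarrow> Q y \<Longrightarrow> Q (x + y)"
  shows "Q x"
proof -
  have "x \<in> complex_vector.span (\<Union>c\<in>\<Lambda>. eigenspace domA A c - {0})" using assms(1) E_span by simp
  then have "x \<in> E \<and> Q x"
  proof (induction rule: complex_vector.span_induct_alt)
    case base
    show ?case using complex_vector.subspace_0[OF subspace_E] assms(2) by simp
  next
    case (step k x y)
    then obtain c where c: "c \<in> \<Lambda>" "x \<in> domA" "A x = c *\<^sub>C x" "x \<noteq> 0"
      by (auto simp: eigenspace_def)
    obtain l where l: "c = complex_of_real l" using real c(1) by blast
    have "x \<in> E" unfolding E_span by (rule complex_vector.span_base) (use step in auto)
    then have kx: "k *\<^sub>C x \<in> E" by (rule complex_vector.subspace_scale[OF subspace_E])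
    have "Q (k *\<^sub>C x)"
    proof (cases "k = 0")
      case False
      show ?thesis
      proof (rule eig)
        show "k *\<^sub>C x \<in> domA"
          by (rule complex_vector.subspace_scale[OF linear_op_subspace[OF linear_A] c(2)])
        show "A (k *\<^sub>C x) = complex_of_real l *\<^sub>C k *\<^sub>C x"
          using linear_op_scale[OF linear_A c(2)] c(3) l by (simp add: mult.commute)
      qed (use False c l kx in auto)
    qed (use assms(2) in simp)
    then show ?case using step.IH kx add complex_vector.subspace_add[OF subspace_E] by blast
  qed
  then show ?thesis by simp
qed

lemma E_domA: "x \<in> E \<Longrightarrow> x \<in> domA"
  by (induction rule: E_induct)
    (use complex_vector.subspace_0[OF linear_op_subspace[OF linear_A]]
      complex_vector.subspace_add[OF linear_op_subspace[OF linear_A]] in auto)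

lemma A_E: "x \<in> E \<Longrightarrow> A x \<in> E"
proof (induction rule: E_induct)
  case zero
  then show ?case using linear_op_zero[OF linear_A] complex_vector.subspace_0[OF subspace_E] by simp
next
  case (eigenvector x l)
  then show ?case using complex_vector.subspace_scale[OF subspace_E] by simp
next
  case (add x y)
  then show ?case
    using linear_op_add[OF linear_A E_domA E_domA] complex_vector.subspace_add[OF subspace_E] by simp
qed

lemma
  assumes z: "\<zeta> \<in> resolvent_set domA A"
  shows RA_dom: "RA \<zeta> u \<in> domA"
    and RA_right: "\<zeta> *\<^sub>C RA \<zeta> u - A (RA \<zeta> u) = u"
    and RA_left: "x \<in> domA \<Longrightarrow> RA \<zeta> (\<zeta> *\<^sub>C x - A x) = x"
    and linear_RA: "linear_op UNIV (RA \<zeta>)"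
proof -
  have bij: "bij_betw (\<lambda>x. \<zeta> *\<^sub>C x - A x) domA UNIV"
    using z by (simp add: resolvent_set_in_def)
  then have inj: "inj_on (\<lambda>x. \<zeta> *\<^sub>C x - A x) domA" and img: "(\<lambda>x. \<zeta> *\<^sub>C x - A x) ` domA = UNIV"
    by (auto simp: bij_betw_def)
  show "RA \<zeta> u \<in> domA"
    unfolding resolvent_def by (rule the_inv_into_into[OF inj _ subset_refl]) (simp add: img)
  show "\<zeta> *\<^sub>C RA \<zeta> u - A (RA \<zeta> u) = u"
    unfolding resolvent_def by (rule f_the_inv_into_f[OF inj]) (simp add: img)
  show "x \<in> domA \<Longrightarrow> RA \<zeta> (\<zeta> *\<^sub>C x - A x) = x"
    unfolding resolvent_def by (rule the_inv_into_f_f[OF inj])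
  show "linear_op UNIV (RA \<zeta>)"
    unfolding resolvent_def
    by (intro linear_op_the_inv_into[OF linear_op_shift[OF linear_A] bij]
        complex_vector.subspace_UNIV)
qed

lemma eigenvalue_not_in_resolvent_set:
  assumes "x \<in> domA" "x \<noteq> 0" "A x = c *\<^sub>C x"
  shows "c \<notin> resolvent_set domA A"
proof
  assume c: "c \<in> resolvent_set domA A"
  have "x = RA c (c *\<^sub>C x - A x)" by (rule RA_left[OF c assms(1), symmetric])
  also have "\<dots> = 0" using assms(3) linear_op_zero[OF linear_RA[OF c]] by simp
  finally show False using assms(2) by simp
qed

lemma RA_eigenvector:
  assumes z: "\<zeta> \<in> resolvent_set domA A" and x: "x \<in> domA" "A x = c *\<^sub>C x" "x \<noteq> 0"
  shows "RA \<zeta> x = inverse (\<zeta> - c) *\<^sub>C x"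
proof -
  have ne: "\<zeta> - c \<noteq> 0" using eigenvalue_not_in_resolvent_set[OF x(1,3,2)] z by auto
  have "x = RA \<zeta> ((\<zeta> - c) *\<^sub>C x)"
    using RA_left[OF z x(1)] x(2) by (simp add: complex_vector.scale_left_diff_distrib)
  also have "\<dots> = (\<zeta> - c) *\<^sub>C RA \<zeta> x" using linear_op_scale[OF linear_RA[OF z]] by simp
  finally have "inverse (\<zeta> - c) *\<^sub>C x = inverse (\<zeta> - c) *\<^sub>C (\<zeta> - c) *\<^sub>C RA \<zeta> x" by simp
  then show ?thesis using ne by simp
qed

lemma RA_commute:
  assumes z: "\<zeta> \<in> resolvent_set domA A" "\<xi> \<in> resolvent_set domA A"
  shows "RA \<zeta> (RA \<xi> u) = RA \<xi> (RA \<zeta> u)"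
proof (cases "\<zeta> = \<xi>")
  case False
  have id: "RA \<zeta> u - RA \<xi> u = (\<xi> - \<zeta>) *\<^sub>C RA \<zeta> (RA \<xi> u)" if z: "\<zeta> \<in> resolvent_set domA A"
      "\<xi> \<in> resolvent_set domA A" for \<zeta> \<xi>
  proof -
    have "u = (\<zeta> *\<^sub>C RA \<xi> u - A (RA \<xi> u)) + (\<xi> - \<zeta>) *\<^sub>C RA \<xi> u"
      using RA_right[OF z(2), of u] by (simp add: complex_vector.scale_left_diff_distrib)
    then have "RA \<zeta> u = RA \<zeta> (\<zeta> *\<^sub>C RA \<xi> u - A (RA \<xi> u)) + RA \<zeta> ((\<xi> - \<zeta>) *\<^sub>C RA \<xi> u)"
      using linear_op_add[OF linear_RA[OF z(1)] UNIV_I UNIV_I] by metis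
    also have "\<dots> = RA \<xi> u + (\<xi> - \<zeta>) *\<^sub>C RA \<zeta> (RA \<xi> u)"
      using RA_left[OF z(1) RA_dom[OF z(2)]] linear_op_scale[OF linear_RA[OF z(1)] UNIV_I] by simp
    finally show ?thesis by simp
  qed
  have "(\<xi> - \<zeta>) *\<^sub>C RA \<zeta> (RA \<xi> u) = (\<xi> - \<zeta>) *\<^sub>C RA \<xi> (RA \<zeta> u)"
    using id[OF z] id[OF z(2,1)] by (metis complex_vector.scale_minus_left minus_diff_eq)
  then show ?thesis using False by simp
qed simp

lemma RA_E: assumes z: "\<zeta> \<in> resolvent_set domA A" and "x \<in> E" shows "RA \<zeta> x \<in> E"
  using assms(2)
proof (induction rule: E_induct)
  case zero
  then show ?case using linear_op_zero[OF linear_RA[OF z]] complex_vector.subspace_0[OF subspace_E]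
      by simp
next
  case (eigenvector x l)
  then show ?case
    using RA_eigenvector[OF z eigenvector(1,3,2)] complex_vector.subspace_scale[OF subspace_E] by simp
next
  case (add x y)
  then show ?case
    using linear_op_add[OF linear_RA[OF z]] complex_vector.subspace_add[OF subspace_E] by simp
qed

lemma RA_perp: assumes z: "\<zeta> \<in> resolvent_set domA A" and u: "S u = 0" shows "S (RA \<zeta> u) = 0"
proof -
  have "cinner (RA \<zeta> u) e = 0" if "e \<in> E" for e
    using that
  proof (induction rule: E_induct)
    case (eigenvector e l)
    have "\<zeta> \<noteq> complex_of_real l"
      using eigenvalue_not_in_resolvent_set[OF eigenvector(1-3)] z by auto
    have "0 = cinner (\<zeta> *\<^sub>C RA \<zeta> u - A (RA \<zeta> u)) e"
      using u eigenvector(5) unfolding RA_right[OF z] S_eq_0_iff by simp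
    also have "\<dots> = (\<zeta> - complex_of_real l) * cinner (RA \<zeta> u) e"
      using sym_A[OF RA_dom[OF z] eigenvector(1)] eigenvector(3)
      by (simp add: cinner_algebra left_diff_distrib)
    finally show ?case using \<open>\<zeta> \<noteq> complex_of_real l\<close> by simp
  qed (auto simp: cinner_add_right)
  then show ?thesis by (simp add: S_eq_0_iff)
qed

end

locale filtered_cluster = eigen_cluster +
  fixes N :: nat and w z :: "nat \<Rightarrow> complex"
  assumes poles: "\<And>k. k < N \<Longrightarrow> z k \<in> resolvent_set domA A"
begin

abbreviation "T \<equiv> filter_op N w z RA"
abbreviation "r \<equiv> rat_filter N w z"

lemma linear_T: "linear_op UNIV T"
  unfolding linear_op_def filter_op_def
  by (auto simp: linear_op_add[OF linear_RA[OF poles]] linear_op_scale[OF linear_RA[OF poles]]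
      scaleC_add_right sum.distrib complex_vector.scale_sum_right mult.commute mult.left_commute)

lemma T_eigenvector:
  assumes "x \<in> domA" "A x = c *\<^sub>C x" "x \<noteq> 0"
  shows "T x = r c *\<^sub>C x"
  unfolding filter_op_def rat_filter_def
  by (simp add: RA_eigenvector[OF poles assms] complex_vector.scale_left_distrib
      complex_vector.scale_sum_left)

lemma T_E: "x \<in> E \<Longrightarrow> T x \<in> E"
  unfolding filter_op_def
  by (intro complex_vector.subspace_add complex_vector.subspace_sum complex_vector.subspace_scale
      subspace_E RA_E poles) auto

lemma S_sum: "S (sum f I) = (\<Sum>i\<in>I. S (f i))"
  by (induction I rule: infinite_finite_induct) (simp_all add: S_zero S_add)

lemma T_perp: "S u = 0 \<Longrightarrow> S (T u) = 0"
  unfolding filter_op_def by (simp add: S_add S_scale S_sum RA_perp[OF poles])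

lemma S_T: "S (T u) = T (S u)"
proof -
  have "T u = T (S u) + T (u - S u)"
    using linear_op_add[OF linear_T UNIV_I UNIV_I, of "S u" "u - S u"] by simp
  then have "S (T u) = S (T (S u)) + S (T (u - S u))" by (metis S_add)
  then show ?thesis using T_perp[OF S_compl, of u] S_id[OF T_E[OF S_in]] by simp
qed

lemma T_RA_commute:
  assumes "\<zeta> \<in> resolvent_set domA A" shows "T (RA \<zeta> u) = RA \<zeta> (T u)"
proof -
  note lin = linear_RA[OF assms]
  have "RA \<zeta> (T u) = w N *\<^sub>C RA \<zeta> u + (\<Sum>k<N. w k *\<^sub>C RA \<zeta> (RA (z k) u))"
    unfolding filter_op_def
    by (simp add: linear_op_add[OF lin UNIV_I UNIV_I] linear_op_scale[OF lin UNIV_I]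
        linear_op_sum[OF lin])
  also have "\<dots> = T (RA \<zeta> u)"
    unfolding filter_op_def by (simp add: RA_commute[OF assms poles])
  finally show ?thesis ..
qed

text \<open>If the resolvent leaves a finite-dimensional space \<open>M\<close> invariant, then it is bijective there, \<open>M\<close> lies
  in the domain of \<open>A\<close>, and \<open>A\<close> is diagonalizable on \<open>M\<close>.  An eigenvector for \<open>l\<close> has \<open>r(l) = \<mu>\<close>.  This takes
  the place of the spectral mapping theorem.\<close>

lemma filter_eigenvector_in_E:
  assumes N: "0 < N" and M: "findim_subspace M" "\<And>x. x \<in> M \<Longrightarrow> T x = \<mu> *\<^sub>C x"
    "\<And>x. x \<in> M \<Longrightarrow> RA (z 0) x \<in> M"
    and other: "\<And>l. complex_of_real l \<notin> resolvent_set domA A \<Longrightarrow> r (complex_of_real l) = \<mu> \<Longrightarrow>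
        complex_of_real l \<in> \<Lambda>"
  shows "M \<subseteq> E"
proof -
  note z0 = poles[OF N]
  have subM: "complex_vector.subspace M" by (rule findim_subspaceD[OF M(1)])
  have RA_eq_0: "x = 0" if "RA (z 0) x = 0" for x
    using RA_right[OF z0, of x] that linear_op_zero[OF linear_A] by simp
  have surj: "RA (z 0) ` M = M"
    by (rule findim_inj_imp_surj[OF M(1) linear_op_subset[OF linear_RA[OF z0] subM] M(3)])
      (use RA_eq_0 in auto)
  have dom: "x \<in> domA" and AM: "A x \<in> M" if x: "x \<in> M" for x
  proof -
    obtain u where u: "u \<in> M" "x = RA (z 0) u" using surj x by blast
    show "x \<in> domA" using RA_dom[OF z0] u by simp
    have "A x = z 0 *\<^sub>C x - (z 0 *\<^sub>C x - A x)" by simp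
    also have "z 0 *\<^sub>C x - A x = u" using RA_right[OF z0, of u] u(2) by simp
    finally show "A x \<in> M"
      using complex_vector.subspace_diff[OF subM complex_vector.subspace_scale[OF subM x] u(1)]
          by simp
  qed
  have "hermitian_form_on M (\<lambda>x y. cinner (A x) y)"
    unfolding hermitian_form_on_def
  proof (intro conjI ballI allI)
    fix x y assume "x \<in> M" "y \<in> M"
    then show "cinner (A x) y = cnj (cinner (A y) x)"
      using sym_A[OF dom dom] cinner_commute[of "A y" x] by simp
  qed (simp_all add: dom linear_op_add[OF linear_A] linear_op_scale[OF linear_A] cinner_algebra)
  then obtain B and c :: "'a \<Rightarrow> real" where B: "finite B" "orthonormal B" "complex_vector.span B = M"
    and c: "\<And>b y. b \<in> B \<Longrightarrow> y \<in> M \<Longrightarrow> cinner (A b) y = complex_of_real (c b) * cinner b y"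
    using hermitian_form_diagonalization[OF M(1)] by metis
  have "b \<in> E" if b: "b \<in> B" for b
  proof -
    have bM: "b \<in> M" using complex_vector.span_base[OF b] B(3) by simp
    have "b \<noteq> 0" using B(2) b by (force simp: orthonormal_def)
    have "A b - complex_of_real (c b) *\<^sub>C b \<in> M"
      by (intro complex_vector.subspace_diff complex_vector.subspace_scale subM AM bM)
    from c[OF b this] have "cinner (A b - complex_of_real (c b) *\<^sub>C b) (A b - complex_of_real (c b)
        *\<^sub>C b) = 0"
      by (simp add: cinner_diff_left cinner_scaleC_left)
    then have Ab: "A b = complex_of_real (c b) *\<^sub>C b" by simp
    have "r (complex_of_real (c b)) *\<^sub>C b = \<mu> *\<^sub>C b"
      using T_eigenvector[OF dom[OF bM] Ab \<open>b \<noteq> 0\<close>] M(2)[OF bM] by metis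
    then have "r (complex_of_real (c b)) = \<mu>" using \<open>b \<noteq> 0\<close> by simp
    then have "complex_of_real (c b) \<in> \<Lambda>"
      by (intro other eigenvalue_not_in_resolvent_set[OF dom[OF bM] \<open>b \<noteq> 0\<close> Ab])
    then show ?thesis
      unfolding E_span using dom[OF bM] Ab \<open>b \<noteq> 0\<close>
      by (intro complex_vector.span_base) (auto simp: eigenspace_def)
  qed
  then show ?thesis
    unfolding B(3)[symmetric] by (intro complex_vector.span_minimal subspace_E) auto
qed

end

section \<open>Separation by the filter\<close>

lemma rat_filter_at_infinity: "((\<lambda>x. rat_filter N w z (complex_of_real x)) \<longlongrightarrow> w N) at_top"
proof -
  have "((\<lambda>x. inverse (z k - complex_of_real x)) \<longlongrightarrow> 0) at_top" for k
  proof -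
    have "filterlim (\<lambda>x::real. - z k + complex_of_real x) at_infinity at_top"
      by (intro tendsto_add_filterlim_at_infinity[OF tendsto_const] filterlim_of_real_at_infinity)
    then have "((\<lambda>x. - inverse (- z k + complex_of_real x)) \<longlongrightarrow> - 0) at_top"
      by (intro tendsto_minus filterlim_compose[OF tendsto_inverse_0])
    then show ?thesis by (simp flip: inverse_minus_eq)
  qed
  then have "((\<lambda>x. w N + (\<Sum>k<N. w k * inverse (z k - complex_of_real x))) \<longlongrightarrow> w N + (\<Sum>k<N.
      w k * 0)) at_top"
    by (intro tendsto_intros)
  then show ?thesis by (simp add: rat_filter_def)
qed

text \<open>The value \<open>w N\<close> is the limit of \<open>r(x)\<close> for \<open>x\<close> tending to infinity, so its modulus is bounded by the
  supremum over the outer set, too.  This is what separates \<open>w N\<close>, which may be an element of the essential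
  spectrum of the filter, from the cluster.\<close>

lemma filter_separation:
  fixes N :: nat and w z :: "nat \<Rightarrow> complex"
  defines "r \<equiv> rat_filter N w z" and "Z \<equiv> z ` {..<N}"
  assumes "0 < filter_inf r Z (I_set y \<gamma>)" "kappa_hat N w z y \<delta> \<gamma> < 1"
    and l: "l \<in> I_set y \<gamma>" "complex_of_real l \<notin> Z"
  shows "x \<in> O_set y \<delta> \<gamma> \<Longrightarrow> complex_of_real x \<notin> Z \<Longrightarrow> cmod (r (complex_of_real x)) < cmod (r
      (complex_of_real l))"
    and "cmod (w N) < cmod (r (complex_of_real l))"
proof -
  let ?s = "filter_sup r Z (O_set y \<delta> \<gamma>)" and ?i = "filter_inf r Z (I_set y \<gamma>)"
  have i_le: "?i \<le> ereal (cmod (r (complex_of_real l)))"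
    unfolding filter_inf_def by (rule INF_lower) (use l in auto)
  have kappa: "?s / ?i < 1" using assms(4) by (simp add: kappa_hat_def r_def Z_def)
  obtain b where b: "?i = ereal b" "0 < b"
    using assms(3) i_le by (cases ?i) auto
  have s_lt: "?s < ?i"
    using kappa b by (cases ?s) (auto simp: divide_less_eq)
  have le_s: "ereal (cmod (r (complex_of_real x))) \<le> ?s"
      if "x \<in> O_set y \<delta> \<gamma>" "complex_of_real x \<notin> Z" for x
    unfolding filter_sup_def by (rule SUP_upper) (use that in auto)
  show lt: "cmod (r (complex_of_real x)) < cmod (r (complex_of_real l))"
    if "x \<in> O_set y \<delta> \<gamma>" "complex_of_real x \<notin> Z" for x
    using le_s[OF that] s_lt i_le by (metis ereal_less_eq(3) less_ereal.simps(1) order_le_less_trans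
        order_less_le_trans)
  have "\<forall>\<^sub>F x in at_top. x \<in> O_set y \<delta> \<gamma> \<and> complex_of_real x \<notin> Z"
  proof (rule eventually_conj)
    show "\<forall>\<^sub>F x in at_top. x \<in> O_set y \<delta> \<gamma>"
      using eventually_ge_at_top[of "y + (1 + \<delta>) * \<gamma>"]
      by eventually_elim (auto simp: O_set_def)
    have "\<forall>\<^sub>F x in at_top. complex_of_real x \<noteq> z k" for k
      using eventually_gt_at_top[of "Re (z k)"]
      by eventually_elim (metis Re_complex_of_real less_irrefl)
    then show "\<forall>\<^sub>F x in at_top. complex_of_real x \<notin> Z"
      unfolding Z_def using eventually_ball_finite[of "{..<N}" "\<lambda>x k. complex_of_real x \<noteq> z k" at_top]
      by (auto simp: image_iff elim!: eventually_mono)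
  qed
  then have ev: "\<forall>\<^sub>F x in at_top. cmod (r (complex_of_real x)) \<le> real_of_ereal ?s"
  proof eventually_elim
    case (elim x)
    then have "ereal (cmod (r (complex_of_real x))) \<le> ?s" by (intro le_s) auto
    then show ?case using s_lt b by (cases ?s) auto
  qed
  have "\<exists>x. x \<in> O_set y \<delta> \<gamma> \<and> complex_of_real x \<notin> Z"
    using \<open>\<forall>\<^sub>F x in at_top. x \<in> O_set y \<delta> \<gamma> \<and> complex_of_real x \<notin> Z\<close> eventually_happens by fastforce
  then have s: "?s = ereal (real_of_ereal ?s)" using le_s s_lt b by (cases ?s) auto
  have "((\<lambda>x. cmod (r (complex_of_real x))) \<longlongrightarrow> cmod (w N)) at_top"
    unfolding r_def by (intro tendsto_norm rat_filter_at_infinity)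
  from tendsto_upperbound[OF this ev] have "cmod (w N) \<le> real_of_ereal ?s" by simp
  then have "ereal (cmod (w N)) \<le> ?s" by (subst s) simp
  then show "cmod (w N) < cmod (r (complex_of_real l))"
    using s_lt i_le by (metis ereal_less_eq(3) less_ereal.simps(1) order_le_less_trans
        order_less_le_trans)
qed

section \<open>Approximate eigenspaces\<close>

lemma (in hilbert_on) op_norm_on_bound:
  assumes "bounded_op_on V nrm T" "u \<in> V"
  shows "nrm (T u) \<le> op_norm_on V nrm T * nrm u"
proof (cases "u = 0")
  case True
  obtain B where "\<forall>u\<in>V. T u \<in> V \<and> nrm (T u) \<le> B * nrm u"
    using assms(1) by (auto simp: bounded_op_on_def)
  with True assms(2) show ?thesis by fastforce
next
  case False
  obtain B where B: "\<forall>u\<in>V. nrm (T u) \<le> B * nrm u"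
    using assms(1) by (auto simp: bounded_op_on_def)
  have pos: "0 < nrm u" by (rule nrm_pos[OF assms(2) False])
  have "nrm (T v) / nrm v \<le> \<bar>B\<bar>" if v: "v \<in> V" for v
  proof (cases "v = 0")
    case False
    have "nrm (T v) \<le> \<bar>B\<bar> * nrm v"
      using B v mult_right_mono[OF abs_ge_self nrm_nonneg[OF v], of B] by fastforce
    then show ?thesis using nrm_pos[OF v False] by (simp add: divide_le_eq)
  qed simp
  then have "bdd_above ((\<lambda>u. nrm (T u) / nrm u) ` V)" by (intro bdd_aboveI2)
  then have "nrm (T u) / nrm u \<le> op_norm_on V nrm T"
    unfolding op_norm_on_def by (rule cSUP_upper[OF assms(2)])
  then show ?thesis using pos by (simp add: divide_le_eq)
qed

text \<open>As \<open>T - w N\<close> is compact and \<open>w N\<close> is not one of the values \<open>r c\<close> with \<open>c\<close> in \<open>\<Lambda>\<close>, these can only be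
  isolated eigenvalues of finite multiplicity; \<open>separated\<close> says that \<open>r\<close> takes no value \<open>r c\<close> at other points of the
  spectrum of \<open>A\<close>.\<close>

locale cluster_contour = jordan_contour V ip C g L + filtered_cluster domA A \<Lambda> E N w z
  for V :: "'a::complex_hilbert_space set" and ip C g L and domA :: "'a set" and A \<Lambda> E N w z +
  assumes E_V: "E \<subseteq> V"
    and RA_V: "\<And>k u. k < N \<Longrightarrow> u \<in> V \<Longrightarrow> RA (z k) u \<in> V"
    and N_pos: "0 < N"
    and K_limit: "finite_rank_limit (\<lambda>u. \<Sum>k<N. w k *\<^sub>C RA (z k) u)"
    and spec: "path_image g \<subseteq> res T"
    and inside_spec: "\<And>\<zeta>. \<zeta> \<in> inside (path_image g) \<Longrightarrow> \<zeta> \<notin> res T \<Longrightarrow> \<zeta> \<in> r ` \<Lambda>"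
    and cluster_inside: "r ` \<Lambda> \<subseteq> inside (path_image g)"
    and zero_outside: "0 \<notin> inside (path_image g)" "0 \<notin> path_image g"
    and w_N: "w N \<notin> r ` \<Lambda>"
    and separated: "\<And>l c. complex_of_real l \<notin> resolvent_set domA A \<Longrightarrow> c \<in> \<Lambda> \<Longrightarrow>
      r (complex_of_real l) = r c \<Longrightarrow> complex_of_real l \<in> \<Lambda>"
begin

abbreviation "K \<equiv> \<lambda>u. \<Sum>k<N. w k *\<^sub>C RA (z k) u"

lemma T_eq: "T u = w N *\<^sub>C u + K u"
  by (simp add: filter_op_def)

lemma op_on_T: "op_on T"
  unfolding op_on_def
proof (intro conjI ballI)
  show "linear_op V T" by (rule linear_op_subset[OF linear_T subspace_V]) simp
  show "T u \<in> V" if "u \<in> V" for u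
    unfolding T_eq by (intro V_add V_scale V_sum RA_V that) auto
qed

lemma S_V: "S u \<in> V"
  using S_in E_V by blast

lemma S_compl_V: "u \<in> V \<Longrightarrow> u - S u \<in> V"
  by (intro V_diff S_V)

lemma E_norm_equivalence:
  obtains c where "0 < c" "\<And>x. x \<in> E \<Longrightarrow> nrm x \<le> c * norm x"
proof -
  have "nrm (x + y) \<le> nrm x + nrm y" if "x \<in> E" "y \<in> E" for x y
    using that E_V by (intro nrm_triangle) auto
  moreover have "nrm (k *\<^sub>C x) = cmod k * nrm x" if "x \<in> E" for k x
    using that E_V by (intro nrm_scale) auto
  ultimately show thesis using findim_seminorm_bound[OF findim_E, of nrm] that by metis
qed

lemma S_bounded:
  obtains c where "0 < c" "\<And>u. u \<in> V \<Longrightarrow> nrm (S u) \<le> c * nrm u"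
proof -
  obtain c where c: "0 < c" "\<And>x. x \<in> E \<Longrightarrow> nrm x \<le> c * norm x" using E_norm_equivalence by metis
  have "nrm (S u) \<le> (c * C) * nrm u" if u: "u \<in> V" for u
  proof -
    have "nrm (S u) \<le> c * norm (S u)" by (rule c(2)[OF S_in])
    also have "\<dots> \<le> c * (C * nrm u)"
      using norm_S_le[of u] embedding[OF u] c(1) by (intro mult_left_mono) auto
    finally show ?thesis by (simp add: mult.assoc)
  qed
  then show thesis using that[of "c * C"] c(1) C_pos by simp
qed

text \<open>The filter with the cluster removed: on \<open>E\<close> it is \<open>0\<close>, and \<open>0\<close> is outside the curve.\<close>

definition T1 :: "'a \<Rightarrow> 'a" where
  "T1 u = T (u - S u)"

lemma op_on_T1: "op_on T1"
proof -
  have "T (u + v - S (u + v)) = T (u - S u) + T (v - S v)" for u v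
  proof -
    have "u + v - S (u + v) = (u - S u) + (v - S v)" by (simp add: S_add)
    then show ?thesis by (simp only: linear_op_add[OF linear_T UNIV_I UNIV_I])
  qed
  moreover have "T (c *\<^sub>C u - S (c *\<^sub>C u)) = c *\<^sub>C T (u - S u)" for c u
    using linear_op_scale[OF linear_T UNIV_I, of c "u - S u"]
    by (simp add: S_scale complex_vector.scale_right_diff_distrib)
  ultimately show ?thesis
    using subspace_V op_on_in[OF op_on_T S_compl_V] by (simp add: op_on_def linear_op_def T1_def)
qed

lemma S_T1: "S (T1 u) = 0"
  unfolding T1_def by (rule T_perp[OF S_compl])

text \<open>\<open>T1 - w N\<close> is the compact operator \<open>(T - w N) (1 - S)\<close> minus \<open>w N S\<close>, which has finite rank.\<close>

lemma finite_rank_limit_T1: "finite_rank_limit (\<lambda>u. T1 u - w N *\<^sub>C u)"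
  unfolding finite_rank_limit_def
proof (intro conjI allI impI)
  show "op_on (\<lambda>u. T1 u - w N *\<^sub>C u)"
    using linear_op_add[OF op_on_linear[OF op_on_T1]] linear_op_scale[OF op_on_linear[OF op_on_T1]]
      subspace_V V_diff[OF op_on_in[OF op_on_T1] V_scale]
    by (simp add: op_on_def linear_op_def scaleC_add_right complex_vector.scale_right_diff_distrib
        mult.commute)
  fix e :: real assume "0 < e"
  obtain c where c: "0 < c" "\<And>u. u \<in> V \<Longrightarrow> nrm (S u) \<le> c * nrm u" using S_bounded by metis
  have compl_le: "nrm (u - S u) \<le> (1 + c) * nrm u" if "u \<in> V" for u
    using nrm_diff_le[OF that S_V, of u] c(2)[OF that] by (simp add: distrib_right)
  have "0 < e / (1 + c)" using \<open>0 < e\<close> c(1) by simp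
  from K_limit[unfolded finite_rank_limit_def, THEN conjunct2, rule_format, OF this]
  obtain F W B where F: "op_on F" "findim_subspace W" "W \<subseteq> V" "\<And>u. u \<in> V \<Longrightarrow> F u \<in> W"
    "\<And>u. u \<in> V \<Longrightarrow> nrm (F u) \<le> B * nrm u" "\<And>u. u \<in> V \<Longrightarrow> nrm (K u - F u) \<le> e / (1 + c) * nrm u"
    by blast
  obtain W' where W': "findim_subspace W'" "W \<subseteq> W'" "E \<subseteq> W'" "W' \<subseteq> V"
    by (rule findim_subspace_join[OF F(2) findim_E subspace_V F(3) E_V])
  define F' where "F' u = F (u - S u) - w N *\<^sub>C S u" for u
  have F_V: "F u \<in> V" if "u \<in> V" for u by (rule op_on_in[OF F(1) that])
  have F'_V: "F' u \<in> V" if "u \<in> V" for u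
    unfolding F'_def by (intro V_diff V_scale F_V S_compl_V S_V that)
  have "F' (u + v) = F' u + F' v" if "u \<in> V" "v \<in> V" for u v
  proof -
    have "F (u + v - S (u + v)) = F (u - S u) + F (v - S v)"
    proof -
      have "u + v - S (u + v) = (u - S u) + (v - S v)" by (simp add: S_add)
      then show ?thesis
        by (simp only: linear_op_add[OF op_on_linear[OF F(1)] S_compl_V[OF that(1)]
            S_compl_V[OF that(2)]])
    qed
    then show ?thesis by (simp add: F'_def S_add scaleC_add_right)
  qed
  moreover have "F' (k *\<^sub>C u) = k *\<^sub>C F' u" if "u \<in> V" for k u
  proof -
    have "F (k *\<^sub>C u - S (k *\<^sub>C u)) = k *\<^sub>C F (u - S u)"
      using linear_op_scale[OF op_on_linear[OF F(1)] S_compl_V[OF that], of k]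
      by (simp add: S_scale complex_vector.scale_right_diff_distrib)
    then show ?thesis
      by (simp add: F'_def S_scale complex_vector.scale_right_diff_distrib mult.commute)
  qed
  ultimately have "op_on F'" using subspace_V F'_V by (simp add: op_on_def linear_op_def)
  moreover have "F' u \<in> W'" if "u \<in> V" for u
  proof -
    have "F (u - S u) \<in> W'" "S u \<in> W'" using F(4)[OF S_compl_V[OF that]] S_in W' by auto
    then show ?thesis
      unfolding F'_def using findim_subspaceD[OF W'(1)]
      by (intro complex_vector.subspace_diff complex_vector.subspace_scale)
  qed
  moreover have "nrm (F' u) \<le> (\<bar>B\<bar> * (1 + c) + cmod (w N) * c) * nrm u" if u: "u \<in> V" for u
  proof -
    have "nrm (F' u) \<le> nrm (F (u - S u)) + nrm (w N *\<^sub>C S u)"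
      unfolding F'_def by (intro nrm_diff_le F_V S_compl_V u V_scale S_V)
    also have "nrm (F (u - S u)) \<le> \<bar>B\<bar> * nrm (u - S u)"
      using F(5)[OF S_compl_V[OF u]] mult_right_mono[OF abs_ge_self nrm_nonneg[OF S_compl_V[OF u]],
          of B]
      by linarith
    also have "\<bar>B\<bar> * nrm (u - S u) \<le> \<bar>B\<bar> * ((1 + c) * nrm u)"
      by (intro mult_left_mono compl_le u) simp
    also have "nrm (w N *\<^sub>C S u) \<le> cmod (w N) * (c * nrm u)"
      unfolding nrm_scale[OF S_V] by (intro mult_left_mono c(2) u) simp
    finally show ?thesis by (simp add: algebra_simps)
  qed
  moreover have "nrm (T1 u - w N *\<^sub>C u - F' u) \<le> e * nrm u" if u: "u \<in> V" for u
  proof -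
    have "T1 u - w N *\<^sub>C u - F' u = K (u - S u) - F (u - S u)"
      unfolding T1_def T_eq F'_def by (simp add: complex_vector.scale_right_diff_distrib)
    then have "nrm (T1 u - w N *\<^sub>C u - F' u) \<le> e / (1 + c) * nrm (u - S u)"
      using F(6)[OF S_compl_V[OF u]] by simp
    also have "\<dots> \<le> e / (1 + c) * ((1 + c) * nrm u)"
      using \<open>0 < e\<close> c(1) by (intro mult_left_mono compl_le u) simp
    also have "\<dots> = e * nrm u" using c(1) by simp
    finally show ?thesis .
  qed
  ultimately show "\<exists>F W B. op_on F \<and> findim_subspace W \<and> W \<subseteq> V \<and>
     (\<forall>u\<in>V. F u \<in> W \<and> nrm (F u) \<le> B * nrm u \<and> nrm (T1 u - w N *\<^sub>C u - F u) \<le> e * nrm u)"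
    using W'(1,4) by blast
qed

text \<open>With respect to the decomposition of \<open>V\<close> into \<open>E\<close> and its orthogonal complement, \<open>\<zeta> - T1\<close> is \<open>\<zeta>\<close>
  on the first and \<open>\<zeta> - T\<close> on the second part.\<close>

lemma res_T1_of_res_T:
  assumes z: "\<zeta> \<in> res T" "\<zeta> \<noteq> 0"
  shows "\<zeta> \<in> res T1"
proof -
  obtain c where c: "0 < c" "\<And>u. u \<in> V \<Longrightarrow> nrm (S u) \<le> c * nrm u" using S_bounded by metis
  obtain B where B: "0 < B" "res_bound T \<zeta> B" using ex_res_bound[OF z(1)] by metis
  have "res_bound T1 \<zeta> (B * (1 + c) + c / cmod \<zeta>)"
  proof (rule res_boundI[OF op_on_T1])
    fix y assume y: "y \<in> V"
    let ?v = "R T \<zeta> (y - S y)"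
    have v: "?v \<in> V" by (rule R_in[OF z(1) S_compl_V[OF y]])
    have "\<zeta> *\<^sub>C S ?v - T (S ?v) = 0"
      using arg_cong[OF R_right[OF z(1) S_compl_V[OF y]], of S]
          by (simp add: S_diff S_scale S_T S_id S_in)
    then have "S ?v = R T \<zeta> 0" using R_left[OF z(1) S_V[of ?v]] by simp
    then have Sv: "S ?v = 0" using linear_op_zero[OF op_on_linear[OF op_on_R[OF op_on_T z(1)]]]
        by simp
    define x where "x = ?v + (1 / \<zeta>) *\<^sub>C S y"
    have "S x = (1 / \<zeta>) *\<^sub>C S y" by (simp add: x_def S_add S_scale Sv S_id S_in)
    then have "T1 x = T ?v" by (simp add: T1_def x_def)
    then have "\<zeta> *\<^sub>C x - T1 x = (\<zeta> *\<^sub>C ?v - T ?v) + S y"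
      using z(2) by (simp add: x_def scaleC_add_right)
    also have "\<dots> = y" using R_right[OF z(1) S_compl_V[OF y]] by simp
    finally have "\<zeta> *\<^sub>C x - T1 x = y" .
    moreover have "x \<in> V" unfolding x_def by (intro V_add v V_scale S_V)
    ultimately show "\<exists>x\<in>V. \<zeta> *\<^sub>C x - T1 x = y" by blast
  next
    fix x assume x: "x \<in> V"
    define y where "y = \<zeta> *\<^sub>C x - T1 x"
    have y: "y \<in> V" unfolding y_def by (intro V_diff V_scale x op_on_in[OF op_on_T1])
    have Sy: "S y = \<zeta> *\<^sub>C S x" by (simp add: y_def S_diff S_scale S_T1)
    have "y - S y = \<zeta> *\<^sub>C (x - S x) - T (x - S x)"
      unfolding Sy by (simp add: y_def T1_def complex_vector.scale_right_diff_distrib)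
    then have "x - S x = R T \<zeta> (y - S y)" using R_left[OF z(1) S_compl_V[OF x]] by simp
    then have "nrm (x - S x) \<le> B * nrm (y - S y)"
      using res_boundD[OF B(2) S_compl_V[OF y]] by simp
    also have "\<dots> \<le> B * ((1 + c) * nrm y)"
      using nrm_diff_le[OF y S_V, of y] c(2)[OF y] B(1)
          by (intro mult_left_mono) (simp_all add: distrib_right)
    finally have 1: "nrm (x - S x) \<le> B * (1 + c) * nrm y" by (simp add: mult.assoc)
    have "cmod \<zeta> * nrm (S x) = nrm (S y)" unfolding Sy by (simp add: nrm_scale[OF S_V])
    then have "nrm (S x) = nrm (S y) / cmod \<zeta>" using z(2) by (simp add: eq_divide_eq mult.commute)
    also have "\<dots> \<le> c * nrm y / cmod \<zeta>" by (intro divide_right_mono c(2) y) simp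
    finally have 2: "nrm (S x) \<le> c / cmod \<zeta> * nrm y" by simp
    have "nrm x \<le> nrm (x - S x) + nrm (S x)" using nrm_triangle[OF S_compl_V[OF x] S_V, of x] by simp
    then show "nrm x \<le> (B * (1 + c) + c / cmod \<zeta>) * nrm (\<zeta> *\<^sub>C x - T1 x)"
      using 1 2 by (simp add: y_def[symmetric] distrib_right)
  qed
  then show ?thesis by (simp add: res_bound_def)
qed

text \<open>By the Fredholm alternative a spectral point would be an eigenvalue.  As the range of \<open>T1\<close> is
  orthogonal to \<open>E\<close>, the eigenvector would be one of \<open>T\<close> orthogonal to \<open>E\<close>, but those
  for this value lie in \<open>E\<close>.\<close>

lemma res_T1_cluster:
  assumes c: "c \<in> \<Lambda>"
  shows "r c \<in> res T1"
proof -
  let ?\<mu> = "r c" and ?Q = "\<lambda>u. T1 u - w N *\<^sub>C u"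
  have ne: "?\<mu> - w N \<noteq> 0" using w_N c by (metis eq_iff_diff_eq_0 imageI)
  have \<mu>0: "?\<mu> \<noteq> 0" using cluster_inside zero_outside c by auto
  have shift: "(?\<mu> - w N) *\<^sub>C x - ?Q x = ?\<mu> *\<^sub>C x - T1 x" for x
    by (simp add: complex_vector.scale_left_diff_distrib)
  define M where "M = {x\<in>V. K x = (?\<mu> - w N) *\<^sub>C x}"
  have M_iff: "x \<in> M \<longleftrightarrow> x \<in> V \<and> T x = ?\<mu> *\<^sub>C x" for x
    by (simp add: M_def T_eq complex_vector.scale_left_diff_distrib eq_diff_eq add.commute)
  have ME: "M \<subseteq> E"
  proof (rule filter_eigenvector_in_E[OF N_pos])
    show "findim_subspace M" unfolding M_def by (rule findim_eigenspace[OF K_limit ne])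
    show "T x = ?\<mu> *\<^sub>C x" if "x \<in> M" for x using that M_iff by simp
    show "RA (z 0) x \<in> M" if "x \<in> M" for x
      using that RA_V[OF N_pos] T_RA_commute[OF poles[OF N_pos]]
        linear_op_scale[OF linear_RA[OF poles[OF N_pos]]] by (simp add: M_iff)
    show "complex_of_real l \<in> \<Lambda>"
      if "complex_of_real l \<notin> resolvent_set domA A" "r (complex_of_real l) = r c" for l
      by (rule separated[OF that(1) c that(2)])
  qed
  have "?\<mu> - w N \<in> res ?Q"
  proof (rule fredholm_alternative[OF finite_rank_limit_T1 ne])
    fix x assume x: "x \<in> V" "?Q x = (?\<mu> - w N) *\<^sub>C x"
    then have T1x: "T1 x = ?\<mu> *\<^sub>C x" using shift[of x] by simp
    then have "?\<mu> *\<^sub>C S x = 0" using S_T1[of x] by (simp add: S_scale)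
    then have Sx: "S x = 0" using \<mu>0 by simp
    then have "x \<in> M" using x(1) T1x by (simp add: M_iff T1_def)
    then have "x = S x" using ME S_id by auto
    then show "x = 0" using Sx by simp
  qed
  then show ?thesis
    unfolding resolvent_set_in_def resolvent_def by (simp only: mem_Collect_eq shift)
qed

lemma res_T1:
  assumes "\<zeta> \<in> inside (path_image g) \<union> path_image g"
  shows "\<zeta> \<in> res T1"
proof (cases "\<zeta> \<in> res T")
  case True
  then show ?thesis using res_T1_of_res_T assms zero_outside by auto
next
  case False
  then show ?thesis using assms spec inside_spec res_T1_cluster by blast
qed

text \<open>On \<open>E\<close>, by the eigenvectors.  On vectors orthogonal to \<open>E\<close> the resolvents of \<open>T\<close> and \<open>T1\<close> agree, and
  the latter is holomorphic inside the curve.\<close>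

lemma riesz_projection_eq: assumes u: "u \<in> V" shows "P T u = S u"
proof -
  have lin: "linear_op V (P T)" by (rule op_on_linear[OF op_on_P[OF op_on_T spec]])
  have PE: "P T e = e" if "e \<in> E" for e
    using that
  proof (induction rule: E_induct)
    case zero
    show ?case by (rule linear_op_zero[OF lin])
  next
    case (eigenvector x l)
    have "r (complex_of_real l) \<in> inside (path_image g)" using cluster_inside eigenvector(4) by blast
    then have "winding_number g (r (complex_of_real l)) = 1" by (rule winding)
    moreover have "P T x = winding_number g (r (complex_of_real l)) *\<^sub>C x"
      by (rule P_eigenvector[OF op_on_T spec _ T_eigenvector[OF eigenvector(1,3,2)] eigenvector(2)])
        (use eigenvector(5) E_V in blast)
    ultimately show ?case by simp
  next
    case (add x y)
    have "x \<in> V" "y \<in> V" using add(1,2) E_V by auto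
    with add show ?case by (simp add: linear_op_add[OF lin])
  qed
  have PS: "P T (S u) = S u" by (rule PE[OF S_in])
  have "P T (u - S u) = 0"
  proof (rule P_eq_0_by_operator[OF op_on_T spec S_compl_V[OF u] op_on_T1])
    show "path_image g \<subseteq> res T1" using res_T1 by blast
    show "winding_number g \<zeta> = 0" if "\<zeta> \<notin> res T1" for \<zeta>
      using that res_T1[of \<zeta>] winding_outside[of \<zeta>] by blast
    fix \<zeta> assume z: "\<zeta> \<in> res T" "\<zeta> \<in> res T1"
    let ?v = "u - S u"
    let ?x = "R T \<zeta> ?v"
    have v: "?v \<in> V" by (rule S_compl_V[OF u])
    have x: "?x \<in> V" by (rule R_in[OF z(1) v])
    have "\<zeta> *\<^sub>C S ?x - T (S ?x) = 0"
      using arg_cong[OF R_right[OF z(1) v], of S] by (simp add: S_diff S_scale S_T S_id S_in)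
    then have "S ?x = R T \<zeta> 0" using R_left[OF z(1) S_V[of ?x]] by simp
    then have "S ?x = 0" using linear_op_zero[OF op_on_linear[OF op_on_R[OF op_on_T z(1)]]] by simp
    then have "\<zeta> *\<^sub>C ?x - T1 ?x = ?v" using R_right[OF z(1) v] by (simp add: T1_def)
    then show "?x = R T1 \<zeta> ?v" using R_unique[OF z(2) x] by simp
  qed
  moreover have "P T u = P T (S u) + P T (u - S u)"
    using linear_op_add[OF lin S_V S_compl_V[OF u], of u] by simp
  ultimately show ?thesis using PS by simp
qed

text \<open>The perturbed projection \<open>P'\<close> fixes its range \<open>F\<close> and is close to \<open>S\<close>, so \<open>\<parallel>v - S v\<parallel> \<le> \<parallel>v\<parallel> / 2\<close> on
  \<open>F\<close>; hence \<open>S\<close> is injective on \<open>F\<close>, and \<open>F\<close> is finite-dimensional.  For surjectivity, a vector \<open>d\<close> of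
  \<open>E\<close> orthogonal to \<open>S F\<close> is orthogonal to \<open>F\<close>, in particular to \<open>P' d\<close>, so that
  \<open>\<parallel>d\<parallel> \<le> \<parallel>d - P' d\<parallel> \<le> \<parallel>d\<parallel> / 4\<close>.

  To see that \<open>F\<close> is contained in \<open>W\<close>, note that \<open>K' = T' - w N\<close> maps \<open>F\<close> to itself.  It is injective
  there: an \<open>x\<close> with \<open>K' x = 0\<close> is an eigenvector of \<open>T'\<close> for \<open>w N\<close>, and \<open>w N\<close> is not enclosed by the
  curve unless it is in the resolvent set of \<open>T\<close>, hence in that of \<open>T'\<close>; so \<open>x = P' x = 0\<close>.  Thus \<open>F\<close> is in
  the range of \<open>K'\<close>.\<close>

lemma approximate_eigenspace:
  shows "\<exists>\<eta>>0. \<forall>K' W F. op_on K' \<and> (\<forall>u\<in>V. K' u \<in> W \<and> nrm (K' u - K u) \<le> \<eta> * nrm u) \<and>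
      F = P (\<lambda>u. w N *\<^sub>C u + K' u) ` V \<longrightarrow>
      findim_subspace F \<and> F \<subseteq> W \<and> (\<forall>v\<in>F. S v = 0 \<longrightarrow> v = 0) \<and> E \<subseteq> S ` F"
proof -
  obtain c where c: "0 < c" "\<And>x. x \<in> E \<Longrightarrow> nrm x \<le> c * norm x" using E_norm_equivalence by metis
  \<comment> \<open>\<open>c\<close> and \<open>C\<close> translate between the two norms; the bounds yield the factors \<open>1 / 2\<close> and \<open>1 / 4\<close> below\<close>
  define e where "e = min (1 / 2) (1 / (4 * C * c))"
  have e: "0 < e" "e \<le> 1 / 2" "C * e * c \<le> 1 / 4"
  proof -
    show "0 < e" "e \<le> 1 / 2" using c(1) C_pos by (auto simp: e_def)
    have "C * e * c = e * (C * c)" by simp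
    also have "\<dots> \<le> 1 / (4 * C * c) * (C * c)" using c(1) C_pos
        by (intro mult_right_mono) (auto simp: e_def)
    also have "\<dots> = 1 / 4" using c(1) C_pos by simp
    finally show "C * e * c \<le> 1 / 4" .
  qed
  obtain \<eta>1 where \<eta>1: "0 < \<eta>1"
    "\<And>T'. op_on T' \<Longrightarrow> (\<And>u. u \<in> V \<Longrightarrow> nrm (T' u - T u) \<le> \<eta>1 * nrm u) \<Longrightarrow> path_image g \<subseteq> res T'"
    "\<And>T' u. op_on T' \<Longrightarrow> (\<And>u. u \<in> V \<Longrightarrow> nrm (T' u - T u) \<le> \<eta>1 * nrm u) \<Longrightarrow> u \<in> V \<Longrightarrow>
      nrm (P T' u - P T u) \<le> e * nrm u"
    using P_perturbation[OF op_on_T spec e(1)] by metis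
  \<comment> \<open>so close that \<open>w N\<close> remains in the resolvent set, in case it is in that of \<open>T\<close>\<close>
  obtain \<eta>2 where \<eta>2: "0 < \<eta>2" "\<And>B. w N \<in> res T \<Longrightarrow> \<exists>B>0. res_bound T (w N) B \<and> B * \<eta>2 < 1"
  proof (cases "w N \<in> res T")
    case True
    then obtain B where "0 < B" "res_bound T (w N) B" using ex_res_bound by metis
    then show thesis by (intro that[of "1 / (2 * B)"]) auto
  qed (use that[of 1] in auto)
  define \<eta> where "\<eta> = min \<eta>1 \<eta>2"
  have "0 < \<eta>" using \<eta>1 \<eta>2 by (simp add: \<eta>_def)
  obtain BK where BK: "\<And>u. u \<in> V \<Longrightarrow> nrm (K u) \<le> BK * nrm u"
  proof -
    from K_limit[unfolded finite_rank_limit_def, THEN conjunct2, rule_format, OF zero_less_one]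
    obtain F B where FB: "\<And>u. u \<in> V \<Longrightarrow> F u \<in> V \<and> nrm (F u) \<le> B * nrm u \<and> nrm (K u - F u) \<le> 1 * nrm u"
      by blast
    have K_V: "K u \<in> V" if "u \<in> V" for u using K_limit that
        by (simp add: finite_rank_limit_def op_on_def)
    have "nrm (K u) \<le> (B + 1) * nrm u" if u: "u \<in> V" for u
    proof -
      have "nrm ((K u - F u) + F u) \<le> nrm (K u - F u) + nrm (F u)"
        by (intro nrm_triangle V_diff K_V u) (use FB[OF u] in auto)
      then show ?thesis using FB[OF u] by (simp add: distrib_right)
    qed
    then show thesis by (rule that)
  qed
  show ?thesis
  proof (rule exI[of _ \<eta>], rule conjI[OF \<open>0 < \<eta>\<close>], intro allI impI, elim conjE)
    fix K' W F
    assume opK': "op_on K'" and K'_near: "\<forall>u\<in>V. K' u \<in> W \<and> nrm (K' u - K u) \<le> \<eta> * nrm u"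
      and F_def: "F = P (\<lambda>u. w N *\<^sub>C u + K' u) ` V"
    note K' = opK' K'_near[rule_format, THEN conjunct1] K'_near[rule_format, THEN conjunct2]
    define T' where "T' u = w N *\<^sub>C u + K' u" for u
    have FT': "F = P T' ` V" by (simp add: F_def T'_def[abs_def])
    have T': "op_on T'"
      using linear_op_add[OF op_on_linear[OF K'(1)]] linear_op_scale[OF op_on_linear[OF K'(1)]]
        subspace_V V_add[OF V_scale op_on_in[OF K'(1)]]
      by (simp add: op_on_def linear_op_def T'_def scaleC_add_right mult.commute)
    have near: "nrm (T' u - T u) \<le> \<eta> * nrm u" if "u \<in> V" for u
      using K'(3)[OF that] by (simp add: T'_def T_eq)
    have near1: "nrm (T' u - T u) \<le> \<eta>1 * nrm u" if "u \<in> V" for u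
      using near[OF that] mult_right_mono[of \<eta> \<eta>1, OF _ nrm_nonneg[OF that]] by (simp add: \<eta>_def)
    have spec': "path_image g \<subseteq> res T'" by (rule \<eta>1(2)[OF T' near1])
    have PP: "nrm (P T' u - S u) \<le> e * nrm u" if "u \<in> V" for u
      using \<eta>1(3)[OF T' near1 that] riesz_projection_eq[OF that] by simp
    have P'V: "P T' u \<in> V" if "u \<in> V" for u by (rule P_in[OF T' spec' that])
    have linP': "linear_op V (P T')" by (rule op_on_linear[OF op_on_P[OF T' spec']])
    have FV: "F \<subseteq> V" using P'V FT' by blast
    have fix_F: "P T' x = x" if "x \<in> F" for x
      using that P_idempotent[OF T' spec'] FT' by auto
    have sub_F: "complex_vector.subspace F"
      unfolding complex_vector.subspace_def
    proof (intro conjI ballI allI)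
      show "0 \<in> F" using linear_op_zero[OF linP'] V_zero FT' by (metis imageI)
      show "x + y \<in> F" if "x \<in> F" "y \<in> F" for x y
        using linear_op_add[OF linP', of x y] fix_F[OF that(1)] fix_F[OF that(2)] that FV V_add FT'
        by (metis image_eqI subsetD)
      show "k *\<^sub>C x \<in> F" if "x \<in> F" for k x
        using linear_op_scale[OF linP', of x k] fix_F[OF that] that FV V_scale FT'
        by (metis image_eqI subsetD)
    qed
    have close: "norm (x - S x) \<le> 1 / 2 * norm x" if x: "x \<in> F" for x
    proof -
      have xV: "x \<in> V" using x FV by blast
      have "nrm (x - S x) \<le> e * nrm x" using PP[OF xV] fix_F[OF x] by simp
      moreover have "nrm x \<le> nrm (x - S x) + nrm (S x)"
        using nrm_triangle[OF S_compl_V[OF xV] S_V, of x] by simp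
      moreover have "e * nrm x \<le> 1 / 2 * nrm x" by (intro mult_right_mono e(2) nrm_nonneg xV)
      ultimately have "nrm x \<le> 2 * nrm (S x)" by simp
      also have "\<dots> \<le> 2 * (c * norm x)"
      proof (rule mult_left_mono)
        have "nrm (S x) \<le> c * norm (S x)" by (rule c(2)[OF S_in])
        also have "\<dots> \<le> c * norm x" using c(1) by (intro mult_left_mono norm_S_le) simp
        finally show "nrm (S x) \<le> c * norm x" .
      qed simp
      finally have nrm_x: "nrm x \<le> 2 * (c * norm x)" .
      have "norm (x - S x) \<le> C * nrm (x - S x)" by (rule embedding[OF S_compl_V[OF xV]])
      also have "\<dots> \<le> C * (e * nrm x)"
        using \<open>nrm (x - S x) \<le> e * nrm x\<close> C_pos by (intro mult_left_mono) auto
      also have "\<dots> \<le> C * (e * (2 * (c * norm x)))"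
        using nrm_x C_pos e(1) by (intro mult_left_mono) auto
      also have "\<dots> = 2 * (C * e * c) * norm x" by simp
      also have "\<dots> \<le> 1 / 2 * norm x" using e(3) by (intro mult_right_mono) auto
      finally show ?thesis .
    qed
    have inj: "v = 0" if "v \<in> F" "S v = 0" for v using close[OF that(1)] that(2) by simp
    have linS: "linear_op F S" using sub_F by (simp add: linear_op_def S_add S_scale)
    have findim: "findim_subspace F"
      by (rule findim_subspace_inj[OF linS inj linear_S _ findim_E]) (use S_in in auto)
    have "E \<subseteq> S ` F"
    proof
      fix x assume x: "x \<in> E"
      have fSF: "findim_subspace (S ` F)" by (rule findim_subspace_image[OF findim linS])
      define d where "d = x - orth_proj (S ` F) x"
      have "orth_proj (S ` F) x \<in> E" using orth_proj_in[OF fSF, of x] S_in by auto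
      then have dE: "d \<in> E" unfolding d_def by (intro complex_vector.subspace_diff subspace_E x)
      then have dV: "d \<in> V" using E_V by blast
      have "cinner d v = 0" if v: "v \<in> F" for v
      proof -
        have "cinner d v = cinner d (S v)"
          using orth_proj_symmetric[OF findim_E, of d v] S_id[OF dE] by simp
        also have "\<dots> = 0" unfolding d_def by (rule orth_proj_orth[OF fSF]) (use v in blast)
        finally show ?thesis .
      qed
      then have "cinner d (- P T' d) = 0" using dV FT' by simp
      from pythagoras[OF this] have "(norm d)\<^sup>2 \<le> (norm (d - P T' d))\<^sup>2" by simp
      then have "norm d \<le> norm (d - P T' d)" by (rule power2_le_imp_le) simp
      also have "\<dots> \<le> C * nrm (d - P T' d)" by (intro embedding V_diff dV P'V)
      also have "nrm (d - P T' d) = nrm (P T' d - S d)"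
        using nrm_diff_commute[OF dV P'V[OF dV]] S_id[OF dE] by simp
      also have "C * nrm (P T' d - S d) \<le> C * (e * (c * norm d))"
      proof (rule mult_left_mono)
        have "nrm (P T' d - S d) \<le> e * nrm d" by (rule PP[OF dV])
        also have "\<dots> \<le> e * (c * norm d)" using c(2)[OF dE] e(1) by (intro mult_left_mono) auto
        finally show "nrm (P T' d - S d) \<le> e * (c * norm d)" .
      qed (use C_pos in simp)
      also have "\<dots> = (C * e * c) * norm d" by simp
      also have "\<dots> \<le> 1 / 4 * norm d" by (intro mult_right_mono e(3)) simp
      finally have "d = 0" by simp
      then show "x \<in> S ` F" using orth_proj_in[OF fSF, of x] by (simp add: d_def)
    qed
    moreover have "F \<subseteq> W"
    proof -
      have K'_inj: "x = 0" if x: "x \<in> F" "K' x = 0" for x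
      proof (rule ccontr)
        assume "x \<noteq> 0"
        have xV: "x \<in> V" using x FV by blast
        have T'x: "T' x = w N *\<^sub>C x" using x(2) by (simp add: T'_def)
        have "w N \<notin> res T'"
        proof
          assume wr: "w N \<in> res T'"
          have "x = R T' (w N) (w N *\<^sub>C x - T' x)" using R_left[OF wr xV] by simp
          also have "\<dots> = 0" using T'x linear_op_zero[OF op_on_linear[OF op_on_R[OF T' wr]]] by simp
          finally show False using \<open>x \<noteq> 0\<close> by simp
        qed
        then have not_path: "w N \<notin> path_image g" using spec' by blast
        have not_res: "w N \<notin> res T"
        proof
          assume "w N \<in> res T"
          then obtain B where B: "0 < B" "res_bound T (w N) B" "B * \<eta>2 < 1" using \<eta>2(2) by blast
          have "nrm ((w N *\<^sub>C u - T' u) - (w N *\<^sub>C u - T u)) \<le> \<eta>2 * nrm u" if u: "u \<in> V" for u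
          proof -
            have "nrm ((w N *\<^sub>C u - T' u) - (w N *\<^sub>C u - T u)) = nrm (T' u - T u)"
              using nrm_diff_commute[OF op_on_in[OF T' u] op_on_in[OF op_on_T u]] by simp
            also have "\<dots> \<le> \<eta>2 * nrm u"
              using near[OF u] mult_right_mono[of \<eta> \<eta>2, OF _ nrm_nonneg[OF u]] by (simp add: \<eta>_def)
            finally show ?thesis .
          qed
          from resolvent_perturbation(1)[OF op_on_T B(2) less_imp_le[OF B(1)] T' less_imp_le[OF
              \<eta>2(1)] B(3) this]
          show False using \<open>w N \<notin> res T'\<close> by (simp add: res_bound_def)
        qed
        have "w N \<notin> inside (path_image g)" using inside_spec not_res w_N by blast
        then have "winding_number g (w N) = 0" using not_path by (rule winding_outside)
        then have "P T' x = 0" using P_eigenvector[OF T' spec' xV T'x \<open>x \<noteq> 0\<close>] by simp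
        then show False using fix_F[OF x(1)] \<open>x \<noteq> 0\<close> by simp
      qed
      have T'_le: "nrm (T' u) \<le> (cmod (w N) + BK + \<eta>) * nrm u" if u: "u \<in> V" for u
      proof -
        have K_V: "K u \<in> V" using K_limit u by (simp add: finite_rank_limit_def op_on_def)
        have K'_V: "K' u \<in> V" by (rule op_on_in[OF K'(1) u])
        have "nrm (T' u) \<le> nrm (w N *\<^sub>C u) + nrm (K' u)"
          unfolding T'_def by (intro nrm_triangle V_scale u K'_V)
        also have "nrm (K' u) \<le> nrm (K' u - K u) + nrm (K u)"
          using nrm_triangle[OF V_diff[OF K'_V K_V] K_V] by simp
        finally show ?thesis
          using K'(3)[OF u] BK[OF u] by (simp add: nrm_scale[OF u] distrib_right)
      qed
      have K'F: "K' x \<in> F" if x: "x \<in> F" for x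
      proof -
        have xV: "x \<in> V" using x FV by blast
        have "T' (P T' x) = P T' (T' x)"
        proof (rule P_commute[OF T' spec' T' T'_le _ xV])
          fix \<zeta> u assume z: "\<zeta> \<in> path_image g" and u: "u \<in> V"
          have zr: "\<zeta> \<in> res T'" using z spec' by blast
          note lin = op_on_linear[OF op_on_R[OF T' zr]]
          have "u = R T' \<zeta> (\<zeta> *\<^sub>C u - T' u)" using R_left[OF zr u] by simp
          also have "\<dots> = \<zeta> *\<^sub>C R T' \<zeta> u - R T' \<zeta> (T' u)"
            using linear_op_diff[OF lin V_scale[OF u] op_on_in[OF T' u]] linear_op_scale[OF lin u]
                by simp
          finally have "R T' \<zeta> (T' u) = \<zeta> *\<^sub>C R T' \<zeta> u - u"
              by (metis add_diff_cancel_left' diff_add_cancel)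
          also have "\<dots> = T' (R T' \<zeta> u)" using R_right[OF zr u]
              by (metis add_diff_cancel_left' diff_add_cancel)
          finally show "T' (R T' \<zeta> u) = R T' \<zeta> (T' u)" by simp
        qed
        then have "T' x = P T' (T' x)" using fix_F[OF x] by simp
        then have "T' x \<in> F" using op_on_in[OF T' xV] FT' by (metis imageI)
        then have "T' x - w N *\<^sub>C x \<in> F"
          by (intro complex_vector.subspace_diff complex_vector.subspace_scale sub_F x)
        then show ?thesis by (simp add: T'_def)
      qed
      have "K' ` F = F"
        by (rule findim_inj_imp_surj[OF findim linear_op_subset[OF op_on_linear[OF K'(1)] sub_F FV]
            K'F K'_inj])
      then have "x \<in> K' ` F" if "x \<in> F" for x using that by simp
      then show ?thesis using K'(2) FV by (metis imageE subsetD subsetI)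
    qed
    ultimately show "findim_subspace F \<and> F \<subseteq> W \<and> (\<forall>v\<in>F. S v = 0 \<longrightarrow> v = 0) \<and> E \<subseteq> S ` F"
      using findim inj by blast
  qed
qed

end

section \<open>The estimate\<close>

lemma findim_form_bound:
  assumes F: "findim_subspace F" and b: "hermitian_form_on F b"
  obtains c where "0 < c" "\<And>x. x \<in> F \<Longrightarrow> norm (compression b F x) \<le> c * norm x"
    "\<And>x. x \<in> F \<Longrightarrow> cmod (b x x) \<le> c * (norm x)\<^sup>2"
proof -
  note lin = linear_op_compression[OF F b]
  have "norm (compression b F (x + y)) \<le> norm (compression b F x) + norm (compression b F y)"
    if "x \<in> F" "y \<in> F" for x y
    unfolding linear_op_add[OF lin that] by (rule norm_triangle_ineq)
  moreover have "norm (compression b F (k *\<^sub>C x)) = cmod k * norm (compression b F x)" if "x \<in> F"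
      for k x
    unfolding linear_op_scale[OF lin that] by simp
  ultimately obtain c where c: "0 < c" "\<And>x. x \<in> F \<Longrightarrow> norm (compression b F x) \<le> c * norm x"
    using findim_seminorm_bound[OF F, of "\<lambda>x. norm (compression b F x)"] by metis
  have "cmod (b x x) \<le> c * (norm x)\<^sup>2" if x: "x \<in> F" for x
  proof -
    have "cmod (b x x) \<le> norm (compression b F x) * norm x"
      using cauchy_schwarz[of "compression b F x" x] cinner_compression[OF F b x x] by simp
    also have "\<dots> \<le> (c * norm x) * norm x" by (intro mult_right_mono c(2) x) simp
    finally show ?thesis by (simp add: power2_eq_square mult.assoc)
  qed
  with c show thesis by (rule that)
qed

lemma cmod_form_le_op_norm:
  assumes E: "findim_subspace E" and a: "hermitian_form_on E a" and e: "e \<in> E"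
  shows "cmod (a e e) \<le> op_norm_on E norm (compression a E) * (norm e)\<^sup>2"
proof -
  obtain c where c: "0 < c" "\<And>x. x \<in> E \<Longrightarrow> norm (compression a E x) \<le> c * norm x"
    using findim_form_bound[OF E a] by metis
  have "norm (compression a E x) / norm x \<le> c" if "x \<in> E" for x
    using c(2)[OF that] c(1) by (cases "x = 0") (auto simp: divide_le_eq)
  then have "bdd_above ((\<lambda>x. norm (compression a E x) / norm x) ` E)" by (intro bdd_aboveI2)
  then have le: "norm (compression a E e) / norm e \<le> op_norm_on E norm (compression a E)"
    unfolding op_norm_on_def by (rule cSUP_upper[OF e])
  have "norm (compression a E e) \<le> op_norm_on E norm (compression a E) * norm e"
  proof (cases "e = 0")
    case True
    then show ?thesis using c(2)[OF e] by simp
  next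
    case False
    then show ?thesis using le by (simp add: divide_le_eq)
  qed
  then have "norm (compression a E e) * norm e \<le> op_norm_on E norm (compression a E) * norm e * norm
      e"
    by (rule mult_right_mono) simp
  moreover have "cmod (a e e) \<le> norm (compression a E e) * norm e"
    using cauchy_schwarz[of "compression a E e" e] cinner_compression[OF E a e e] by simp
  ultimately show ?thesis by (simp add: power2_eq_square mult.assoc)
qed

lemma norm_minus_proj_le_gap:
  assumes E: "findim_subspace E" and F: "findim_subspace F" and v: "v \<in> F"
  shows "norm (v - orth_proj E v) \<le> gap E F * norm v"
proof (cases "v = 0")
  case True
  have "orth_proj E 0 \<in> E" "0 \<in> E" using orth_proj_in[OF E] complex_vector.subspace_0[OF
      findim_subspaceD[OF E]] by auto
  then show ?thesis using True orth_proj_id[OF E] by simp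
next
  case False
  define k where "k = complex_of_real (1 / norm v)"
  have "k *\<^sub>C v \<in> F" using complex_vector.subspace_scale[OF findim_subspaceD[OF F] v] .
  moreover have "norm (k *\<^sub>C v) = 1" using False by (simp add: k_def norm_divide)
  ultimately have u: "k *\<^sub>C v \<in> {x\<in>F. norm x = 1}" by simp
  have "infdist x E \<le> 1" if "x \<in> {x\<in>F. norm x = 1}" for x
    using infdist_le[OF complex_vector.subspace_0[OF findim_subspaceD[OF E]], of x] that
        by (simp add: dist_norm)
  then have "bdd_above ((\<lambda>x. infdist x E) ` {x\<in>F. norm x = 1})" by (rule bdd_aboveI2)
  then have "infdist (k *\<^sub>C v) E \<le> (SUP x\<in>{x\<in>F. norm x = 1}. infdist x E)"
    by (rule cSUP_upper[OF u])
  then have "infdist (k *\<^sub>C v) E \<le> gap E F"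
    unfolding gap_def by (rule max.coboundedI2)
  interpret S: Vector_Spaces.linear scaleC scaleC "orth_proj E" by (rule orth_proj_linear[OF E])
  have "infdist (k *\<^sub>C v) E = cmod k * norm (v - orth_proj E v)"
    unfolding infdist_findim[OF E] S.scale complex_vector.scale_right_diff_distrib[symmetric] by simp
  also have "cmod k = 1 / norm v" by (simp add: k_def norm_divide)
  finally have "norm (v - orth_proj E v) / norm v \<le> gap E F"
    using \<open>infdist (k *\<^sub>C v) E \<le> gap E F\<close> by simp
  then show ?thesis using False by (simp add: divide_le_eq)
qed

lemma gap_nonneg:
  assumes E: "findim_subspace E" and F: "findim_subspace F" "F \<noteq> {0}"
  shows "0 \<le> gap E F"
proof -
  obtain v where v: "v \<in> F" "v \<noteq> 0"
    using F(2) complex_vector.subspace_0[OF findim_subspaceD[OF F(1)]] by blast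
  have "0 \<le> gap E F * norm v" using norm_minus_proj_le_gap[OF E F(1) v(1)]
      by (meson norm_ge_zero order_trans)
  then show ?thesis using v(2) by (simp add: zero_le_mult_iff)
qed

text \<open>The supremum in the seminorm is finite because \<open>(x, y) \<mapsto> a(x - S x, y - S y)\<close> is a form on a
  finite-dimensional space.\<close>

lemma cmod_form_le_seminorm:
  assumes D: "hermitian_form_on D a" "complex_vector.subspace D" and E: "findim_subspace E" "E \<subseteq> D"
    and F: "findim_subspace F" "F \<subseteq> D" and v: "v \<in> F"
    and B: "\<And>v. v \<in> F \<Longrightarrow> B v = orth_proj E v - v"
  shows "cmod (a (v - orth_proj E v) (v - orth_proj E v)) \<le> (form_op_seminorm a F B)\<^sup>2 * (norm v)\<^sup>2"
proof -
  let ?S = "orth_proj E"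
  interpret S: Vector_Spaces.linear scaleC scaleC ?S by (rule orth_proj_linear[OF E(1)])
  have diff_D: "x - ?S x \<in> D" "?S x - x \<in> D" if "x \<in> F" for x
    using that F(2) E(2) orth_proj_in[OF E(1), of x] complex_vector.subspace_diff[OF D(2)] by blast+
  define b where "b x y = a (x - ?S x) (y - ?S y)" for x y
  have "hermitian_form_on F b"
    unfolding hermitian_form_on_def
  proof (intro conjI ballI allI)
    fix x y u assume xyu: "x \<in> F" "y \<in> F" "u \<in> F"
    have eq: "x + y - ?S (x + y) = (x - ?S x) + (y - ?S y)" by (simp add: S.add)
    show "b (x + y) u = b x u + b y u"
      unfolding b_def eq
      by (rule form_add_left[OF D diff_D(1)[OF xyu(1)] diff_D(1)[OF xyu(2)] diff_D(1)[OF xyu(3)]])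
  next
    fix c x y assume xy: "x \<in> F" "y \<in> F"
    have eq: "c *\<^sub>C x - ?S (c *\<^sub>C x) = c *\<^sub>C (x - ?S x)"
      by (simp add: S.scale complex_vector.scale_right_diff_distrib)
    show "b (c *\<^sub>C x) y = c * b x y"
      unfolding b_def eq by (rule form_scale_left[OF D diff_D(1)[OF xy(1)] diff_D(1)[OF xy(2)]])
  next
    fix x y assume xy: "x \<in> F" "y \<in> F"
    show "b x y = cnj (b y x)"
      unfolding b_def by (rule form_commute[OF D diff_D(1)[OF xy(1)] diff_D(1)[OF xy(2)]])
  qed
  from findim_form_bound[OF F(1) this] obtain c where c: "0 < c" "\<And>x. x \<in> F \<Longrightarrow> cmod (b x x)
      \<le> c * (norm x)\<^sup>2"
    by metis
  have sq: "(form_seminorm a (B x))\<^sup>2 = cmod (b x x)" if x: "x \<in> F" for x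
  proof -
    have "a (B x) (B x) = a ((-1) *\<^sub>C (x - ?S x)) ((-1) *\<^sub>C (x - ?S x))"
      by (simp add: B[OF x] scaleC_minus1)
    also have "\<dots> = b x x"
      unfolding b_def
      using form_scale_left[OF D diff_D(1)[OF x] complex_vector.subspace_scale[OF D(2) diff_D(1)[OF
          x]], of "-1" "-1"]
        form_scale_right[OF D diff_D(1)[OF x] diff_D(1)[OF x], of "-1"] by simp
    finally show ?thesis by (simp add: form_seminorm_def)
  qed
  show ?thesis
  proof (cases "v = 0")
    case True
    then show ?thesis using c(2)[OF v] by (simp add: b_def)
  next
    case False
    have "form_seminorm a (B x) / norm x \<le> sqrt c" if x: "x \<in> F - {0}" for x
    proof -
      have "(form_seminorm a (B x))\<^sup>2 \<le> (sqrt c * norm x)\<^sup>2"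
        using sq[of x] c x by (simp add: power_mult_distrib)
      then have "form_seminorm a (B x) \<le> sqrt c * norm x"
        by (rule power2_le_imp_le) (use c(1) in simp)
      then show ?thesis using x by (simp add: divide_le_eq)
    qed
    then have "bdd_above ((\<lambda>x. form_seminorm a (B x) / norm x) ` (F - {0}))" by (rule bdd_aboveI2)
    then have "form_seminorm a (B v) / norm v \<le> form_op_seminorm a F B"
      unfolding form_op_seminorm_def by (rule cSUP_upper[rotated]) (use v False in simp)
    then have "form_seminorm a (B v) \<le> form_op_seminorm a F B * norm v"
      using False by (simp add: divide_le_eq)
    moreover have "0 \<le> form_seminorm a (B v)" by (simp add: form_seminorm_def)
    ultimately have "(form_seminorm a (B v))\<^sup>2 \<le> (form_op_seminorm a F B * norm v)\<^sup>2"
      by (rule power_mono)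
    then show ?thesis using sq[OF v] by (simp add: b_def power_mult_distrib)
  qed
qed

text \<open>Extends from eigenvectors to their span; this is why the form couples \<open>E\<close> with nothing outside it.\<close>

lemma (in eigen_cluster) form_reduces:
  assumes D: "hermitian_form_on D a" "complex_vector.subspace D" "domA \<subseteq> D"
    and eig: "\<And>x y l. x \<in> domA \<Longrightarrow> A x = complex_of_real l *\<^sub>C x \<Longrightarrow> y \<in> D \<Longrightarrow> a x y
        = complex_of_real l * cinner x y"
    and x: "x \<in> E" and y: "y \<in> D"
  shows "a x y = cinner (A x) y"
  using x
proof (induction rule: E_induct)
  case zero
  have "a 0 y = 0" using form_scale_left[OF D(1,2) y y, of 0] by simp
  then show ?case using linear_op_zero[OF linear_A] by simp
next
  case (eigenvector x l)
  then show ?case using eig[OF eigenvector(1,3) y] by (simp add: cinner_scaleC_left)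
next
  case (add x u)
  have "x \<in> D" "u \<in> D" using E_domA add(1,2) D(3) by auto
  then show ?case
    using add linear_op_add[OF linear_A E_domA E_domA] form_add_left[OF D(1,2) _ _ y]
    by (simp add: cinner_add_left)
qed

lemma (in eigen_cluster) ritz_values_E:
  assumes D: "hermitian_form_on D a" "complex_vector.subspace D" "domA \<subseteq> D"
    and eig: "\<And>x y l. x \<in> domA \<Longrightarrow> A x = complex_of_real l *\<^sub>C x \<Longrightarrow> y \<in> D \<Longrightarrow> a x y
        = complex_of_real l * cinner x y"
    and nontrivial: "\<And>c. c \<in> \<Lambda> \<Longrightarrow> eigenspace domA A c \<noteq> {0}"
  shows "ritz_values a E = \<Lambda>"
proof (rule set_eqI)
  fix c
  have ED: "E \<subseteq> D" using E_domA D(3) by blast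
  have a_E: "a x y = cinner (A x) y" if "x \<in> E" "y \<in> E" for x y
    by (rule form_reduces[OF D eig that(1)]) (use that(2) ED in blast)+
  have ritz: "c \<in> ritz_values a E \<longleftrightarrow> (\<exists>x\<in>E. x \<noteq> 0 \<and> (\<forall>y\<in>E. a x y = c * cinner x y))"
    by (rule ritz_values_iff[OF findim_E hermitian_form_on_subset[OF D(1) ED]])
  show "c \<in> ritz_values a E \<longleftrightarrow> c \<in> \<Lambda>"
  proof
    assume "c \<in> ritz_values a E"
    then obtain x where x: "x \<in> E" "x \<noteq> 0" "\<forall>y\<in>E. a x y = c * cinner x y" using ritz by blast
    show "c \<in> \<Lambda>"
    proof (rule ccontr)
      assume c: "c \<notin> \<Lambda>"
      have "cinner x e = 0" if "e \<in> E" for e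
        using that
      proof (induction rule: E_induct)
        case (eigenvector e l)
        have "c * cinner x e = cinner (A x) e" using x(3) a_E[OF x(1) eigenvector(5)] eigenvector(5)
            by simp
        also have "\<dots> = complex_of_real l * cinner x e"
          using sym_A[OF E_domA[OF x(1)] eigenvector(1)] eigenvector(3)
              by (simp add: cinner_scaleC_right)
        finally show ?case using c eigenvector(4) by auto
      qed (auto simp: cinner_add_right)
      then have "cinner x x = 0" using x(1) by blast
      then show False using x(2) by simp
    qed
  next
    assume c: "c \<in> \<Lambda>"
    obtain l where l: "c = complex_of_real l" using real c by blast
    have "0 \<in> eigenspace domA A c"
      using complex_vector.subspace_0[OF linear_op_subspace[OF linear_A]] linear_op_zero[OF linear_A]
      by (simp add: eigenspace_def)
    then obtain x where x: "x \<in> domA" "A x = c *\<^sub>C x" "x \<noteq> 0"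
      using nontrivial[OF c] by (auto simp: eigenspace_def)
    have xE: "x \<in> E" unfolding E_span
      by (rule complex_vector.span_base) (use x c in \<open>auto simp: eigenspace_def\<close>)
    have "\<forall>y\<in>E. a x y = c * cinner x y" using eig[of x l] x l ED by auto
    then show "c \<in> ritz_values a E" using ritz xE x(3) by blast
  qed
qed

theorem theorem5p6:
  fixes domA :: "'h::complex_hilbert_space set" and A :: "'h \<Rightarrow> 'h"
    and \<Lambda> :: "complex set" and E :: "'h set" and S :: "'h \<Rightarrow> 'h"
    and N :: nat and w z :: "nat \<Rightarrow> complex" and r :: "complex \<Rightarrow> complex"
    and y \<delta> \<gamma> :: real
    and V :: "'h set" and ipV :: "'h \<Rightarrow> 'h \<Rightarrow> complex" and normV :: "'h \<Rightarrow> real" and C\<^sub>V :: real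
    and Vh :: "real \<Rightarrow> 'h set" and Rh :: "real \<Rightarrow> complex \<Rightarrow> 'h \<Rightarrow> 'h"
    and S\<^sub>N :: "'h \<Rightarrow> 'h" and S\<^sub>Nh :: "real \<Rightarrow> 'h \<Rightarrow> 'h"
    and \<Theta> :: "real \<Rightarrow> complex" and Eh :: "real \<Rightarrow> 'h set" and Qh :: "real \<Rightarrow> 'h \<Rightarrow> 'h"
    and U absA sqrtA :: "'h \<Rightarrow> 'h" and dom_a :: "'h set" and a :: "'h \<Rightarrow> 'h \<Rightarrow> complex"
    and \<Lambda>h :: "real \<Rightarrow> complex set"
  assumes A: "linear_op domA A" "closed_op domA A" "selfadjoint_op domA A"
    \<comment> \<open>the eigenvalue cluster and its eigenspace\<close>
    and \<Lambda>: "finite \<Lambda>" "\<Lambda> \<subseteq> spectrum domA A"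
      "\<And>c. c \<in> \<Lambda> \<Longrightarrow> eigenspace domA A c \<noteq> {0} \<and> findim_subspace (eigenspace domA A c)"
    and E: "E = complex_vector.span (\<Union>c\<in>\<Lambda>. eigenspace domA A c - {0})"
      "findim_subspace E" "1 \<le> complex_vector.dim E"
    and S: "S = orth_proj E"
    \<comment> \<open>Assumption 1\<close>
    and r: "r = rat_filter N w z"
    and separation: "0 < \<delta>" "0 < \<gamma>" "\<Lambda> \<subseteq> complex_of_real ` I_set y \<gamma>"
      "spectrum domA A - \<Lambda> \<subseteq> complex_of_real ` O_set y \<delta> \<gamma>"
    and poles: "\<And>k. k < N \<Longrightarrow> z k \<notin> closure (spectrum domA A)"
    and kappa: "0 < filter_inf r (z ` {..<N}) (I_set y \<gamma>)" "kappa_hat N w z y \<delta> \<gamma> < 1"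
    \<comment> \<open>Assumption 2\<close>
    and V: "hilbert_space_on V ipV" "normV = norm_of ipV" "E \<subseteq> V" "0 < C\<^sub>V"
      "\<And>u. u \<in> V \<Longrightarrow> norm u \<le> C\<^sub>V * normV u"
      "\<And>\<zeta> u. \<zeta> \<in> resolvent_set domA A \<Longrightarrow> u \<in> V \<Longrightarrow> resolvent domA A \<zeta> u \<in> V"
    \<comment> \<open>discretization\<close>
    and Vh: "\<And>h. 0 < h \<Longrightarrow> findim_subspace (Vh h) \<and> Vh h \<subseteq> V"
    and Rh: "\<And>h k. 0 < h \<Longrightarrow> k < N \<Longrightarrow> linear_op UNIV (Rh h (z k)) \<and> range (Rh h (z k)) \<subseteq> Vh h"
    \<comment> \<open>Assumption 3\<close>
    and R_bounded: "\<And>k. k < N \<Longrightarrow> bounded_op_on V normV (resolvent domA A (z k))"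
      "\<And>h k. 0 < h \<Longrightarrow> k < N \<Longrightarrow> bounded_op_on V normV (Rh h (z k))"
    and R_conv: "\<And>k. k < N \<Longrightarrow>
      ((\<lambda>h. op_norm_on V normV (\<lambda>u. Rh h (z k) u - resolvent domA A (z k) u)) \<longlongrightarrow> 0) (at_right 0)"
    \<comment> \<open>filter operators, contour and approximate eigenspaces\<close>
    and S\<^sub>N: "S\<^sub>N = filter_op N w z (resolvent domA A)"
    and S\<^sub>Nh: "\<And>h. S\<^sub>Nh h = filter_op N w z (Rh h)"
    and \<Theta>: "rectifiable_jordan_curve \<Theta>"
      "r ` \<Lambda> \<subseteq> inside (path_image \<Theta>)"
      "\<And>p. p \<in> path_image \<Theta> \<Longrightarrow> cmod p > sup_modulus (spectrum_in V normV V S\<^sub>N - r ` \<Lambda>)"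
      "spectrum_in V normV V S\<^sub>N \<inter> inside (path_image \<Theta>) \<subseteq> r ` \<Lambda>"
      "0 \<notin> inside (path_image \<Theta>)"
    and Eh: "\<And>h. Eh h = riesz_projection V normV (S\<^sub>Nh h) \<Theta> ` V"
    and Qh: "\<And>h. Qh h = orth_proj (Eh h)"
    \<comment> \<open>form, Ritz values and Assumption 4\<close>
    and form: "polar_decomposition domA A U absA" "sqrt_op domA absA dom_a sqrtA"
      "a = form_of U sqrtA"
    and Vh_dom: "\<And>h. 0 < h \<Longrightarrow> Vh h \<subseteq> dom_a"
    and \<Lambda>h: "\<And>h. \<Lambda>h h = ritz_values a (Eh h)"
  shows "\<exists>C\<^sub>0>0. \<exists>h\<^sub>0>0. \<forall>h. 0 < h \<and> h < h\<^sub>0 \<longrightarrow>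
           hausdorff_distance \<Lambda> (\<Lambda>h h)
             \<le> (form_op_seminorm a (Eh h) (\<lambda>v. S (Qh h v) - Qh h v))\<^sup>2
                 + C\<^sub>0 * op_norm_on E norm (compression a E) * (gap E (Eh h))\<^sup>2"
proof -
  let ?RA = "resolvent domA A" and ?n = "norm_of ipV" and ?S = "orth_proj E"
  interpret H: hilbert_on V ipV C\<^sub>V
    using V(1,4,5) unfolding V(2) by unfold_locales
  interpret EC: eigen_cluster domA A \<Lambda> E
    using A(3) separation(3) E(1,2) by unfold_locales auto
  have z_res: "z k \<in> resolvent_set domA A" if "k < N" for k
    using poles[OF that] closure_subset[of "spectrum domA A"] by (auto simp: spectrum_in_def)
  interpret FC: filtered_cluster domA A \<Lambda> E N w z
    by unfold_locales (rule z_res)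

  \<comment> \<open>the filter separates the cluster from the rest of the spectrum and from infinity\<close>
  have "\<Lambda> \<noteq> {}"
  proof
    assume "\<Lambda> = {}"
    then have "complex_vector.dim E \<le> card ({} :: 'h set)"
      unfolding E(1) by (intro complex_vector.dim_le_card) auto
    then show False using E(3) by simp
  qed
  have not_pole: "c \<notin> z ` {..<N}" if "c \<notin> resolvent_set domA A" for c
    using that z_res by auto
  have sep: "\<And>x. x \<in> O_set y \<delta> \<gamma> \<Longrightarrow> complex_of_real x \<notin> z ` {..<N} \<Longrightarrow>
      cmod (FC.r (complex_of_real x)) < cmod (FC.r c)"
    "cmod (w N) < cmod (FC.r c)" if c: "c \<in> \<Lambda>" for c
  proof -
    obtain l where l: "l \<in> I_set y \<gamma>" "c = complex_of_real l" using separation(3) c by blast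
    have "complex_of_real l \<notin> z ` {..<N}"
      using not_pole \<Lambda>(2) c l(2) by (auto simp: spectrum_in_def)
    note filter_separation[OF kappa(1)[unfolded r] kappa(2) l(1) this]
    then show "\<And>x. x \<in> O_set y \<delta> \<gamma> \<Longrightarrow> complex_of_real x \<notin> z ` {..<N} \<Longrightarrow>
      cmod (FC.r (complex_of_real x)) < cmod (FC.r c)" "cmod (w N) < cmod (FC.r c)"
      by (simp_all add: l(2))
  qed
  \<comment> \<open>without poles the filter would be constant and could not separate\<close>
  have N_pos: "0 < N"
  proof (rule ccontr)
    assume "\<not> 0 < N"
    then have "FC.r c = w N" for c by (simp add: rat_filter_def)
    then show False using sep(2) \<open>\<Lambda> \<noteq> {}\<close> by auto
  qed
  have w_N: "w N \<notin> FC.r ` \<Lambda>" using sep(2) by force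
  have separated: "complex_of_real l \<in> \<Lambda>"
    if "complex_of_real l \<notin> resolvent_set domA A" "c \<in> \<Lambda>" "FC.r (complex_of_real l) = FC.r c" for l c
  proof (rule ccontr)
    assume "complex_of_real l \<notin> \<Lambda>"
    then have "l \<in> O_set y \<delta> \<gamma>" using that(1) separation(4) by (auto simp: spectrum_in_def)
    from sep(1)[OF that(2) this not_pole[OF that(1)]] show False using that(3) by simp
  qed

  \<comment> \<open>convergence of the discretized filters in the operator norm of \<open>V\<close>\<close>
  have RA_V: "?RA (z k) u \<in> V" if "k < N" "u \<in> V" for k u
    using V(6)[OF z_res[OF that(1)] that(2)] .
  have Rh_V: "Rh h (z k) u \<in> Vh h" "Vh h \<subseteq> V" if "0 < h" "k < N" for h k u
    using Rh[OF that] Vh[OF that(1)] by auto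
  define K where "K u = (\<Sum>k<N. w k *\<^sub>C ?RA (z k) u)" for u
  define Kh where "Kh h u = (\<Sum>k<N. w k *\<^sub>C Rh h (z k) u)" for h u
  define dk where "dk h k = op_norm_on V ?n (\<lambda>u. Rh h (z k) u - ?RA (z k) u)" for h k
  have K_V: "K u \<in> V" if "u \<in> V" for u
    unfolding K_def by (intro H.V_sum H.V_scale RA_V that) auto
  have Kh_Vh: "Kh h u \<in> Vh h" if "0 < h" for h u
    unfolding Kh_def using Vh[OF that] findim_subspaceD
    by (intro complex_vector.subspace_sum complex_vector.subspace_scale Rh_V that) auto
  have Kh_V: "Kh h u \<in> V" if "0 < h" for h u
    using Kh_Vh[OF that] Vh[OF that] by blast
  have opK: "H.op_on K"
    using H.subspace_V K_V
    by (simp add: H.op_on_def linear_op_def K_def linear_op_add[OF EC.linear_RA[OF z_res]]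
        linear_op_scale[OF EC.linear_RA[OF z_res]] scaleC_add_right sum.distrib
        complex_vector.scale_sum_right mult.commute)
  have opKh: "H.op_on (Kh h)" if h: "0 < h" for h
  proof -
    have "linear_op UNIV (Rh h (z k))" if "k < N" for k using Rh[OF h that] by blast
    then show ?thesis
      using H.subspace_V Kh_V[OF h]
      by (simp add: H.op_on_def linear_op_def Kh_def scaleC_add_right sum.distrib
          complex_vector.scale_sum_right mult.commute)
  qed
  have dk: "?n (Rh h (z k) u - ?RA (z k) u) \<le> dk h k * ?n u" if h: "0 < h" and k: "k < N"
      and u: "u \<in> V" for h k u
    unfolding dk_def
  proof (rule H.op_norm_on_bound[OF _ u])
    obtain B1 where B1: "\<forall>u\<in>V. ?n (?RA (z k) u) \<le> B1 * ?n u"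
      using R_bounded(1)[OF k] by (auto simp: bounded_op_on_def V(2))
    obtain B2 where B2: "\<forall>u\<in>V. ?n (Rh h (z k) u) \<le> B2 * ?n u"
      using R_bounded(2)[OF h k] by (auto simp: bounded_op_on_def V(2))
    have in_V: "Rh h (z k) u \<in> V" for u using Rh_V[OF h k] by blast
    have "?n (Rh h (z k) u - ?RA (z k) u) \<le> (B2 + B1) * ?n u" if "u \<in> V" for u
    proof -
      have "?n (Rh h (z k) u - ?RA (z k) u) \<le> ?n (Rh h (z k) u) + ?n (?RA (z k) u)"
        by (rule H.nrm_diff_le[OF in_V RA_V[OF k that]])
      also have "\<dots> \<le> B2 * ?n u + B1 * ?n u"
        using bspec[OF B1 that] bspec[OF B2 that] by (rule add_mono[rotated])
      finally show ?thesis by (simp add: distrib_right)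
    qed
    then show "bounded_op_on V ?n (\<lambda>u. Rh h (z k) u - ?RA (z k) u)"
      unfolding bounded_op_on_def using H.V_diff[OF in_V RA_V[OF k]] by blast
  qed
  have close: "\<forall>\<^sub>F h in at_right 0. \<forall>u\<in>V. ?n (Kh h u - K u) \<le> \<eta> * ?n u" if "0 < \<eta>" for \<eta>
  proof -
    define W where "W = (\<Sum>k<N. cmod (w k))"
    have W: "0 \<le> W" by (simp add: W_def sum_nonneg)
    then have \<eta>': "0 < \<eta> / (W + 1)" "\<eta> / (W + 1) * W \<le> \<eta>"
      using that by (auto simp: field_simps)
    have "\<forall>\<^sub>F h in at_right 0. \<forall>k\<in>{..<N}. dk h k < \<eta> / (W + 1)"
    proof (intro eventually_ball_finite ballI)
      fix k assume "k \<in> {..<N}"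
      then have "((\<lambda>h. dk h k) \<longlongrightarrow> 0) (at_right 0)"
        using R_conv[of k] by (simp add: dk_def V(2))
      then show "\<forall>\<^sub>F h in at_right 0. dk h k < \<eta> / (W + 1)"
        using \<eta>'(1) by (rule order_tendstoD)
    qed simp
    with eventually_at_right_less[of "0::real"] show ?thesis
    proof eventually_elim
      case (elim h)
      show ?case
      proof
        fix u assume u: "u \<in> V"
        have in_V: "Rh h (z k) u - ?RA (z k) u \<in> V" if "k < N" for k
          using Rh_V[OF elim(1) that] RA_V[OF that u] H.V_diff by blast
        have "Kh h u - K u = (\<Sum>k<N. w k *\<^sub>C (Rh h (z k) u - ?RA (z k) u))"
          by (simp add: Kh_def K_def sum_subtractf complex_vector.scale_right_diff_distrib)
        also have "?n \<dots> \<le> (\<Sum>k<N. ?n (w k *\<^sub>C (Rh h (z k) u - ?RA (z k) u)))"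
          by (intro H.nrm_sum H.V_scale in_V) auto
        also have "\<dots> \<le> (\<Sum>k<N. cmod (w k) * (\<eta> / (W + 1) * ?n u))"
        proof (rule sum_mono)
          fix k assume "k \<in> {..<N}"
          then have k: "k < N" by simp
          have "?n (Rh h (z k) u - ?RA (z k) u) \<le> dk h k * ?n u" by (rule dk[OF elim(1) k u])
          also have "\<dots> \<le> \<eta> / (W + 1) * ?n u"
            using elim(2) k by (intro mult_right_mono H.nrm_nonneg u) (simp add: less_imp_le)
          finally show "?n (w k *\<^sub>C (Rh h (z k) u - ?RA (z k) u)) \<le> cmod (w k) * (\<eta> / (W + 1) * ?n u)"
            unfolding H.nrm_scale[OF in_V[OF k]] by (rule mult_left_mono) simp
        qed
        also have "\<dots> = W * (\<eta> / (W + 1) * ?n u)"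
          unfolding W_def by (rule sum_distrib_right[symmetric])
        also have "\<dots> = (\<eta> / (W + 1) * W) * ?n u" by simp
        also have "\<dots> \<le> \<eta> * ?n u" by (intro mult_right_mono \<eta>'(2) H.nrm_nonneg u)
        finally show "?n (Kh h u - K u) \<le> \<eta> * ?n u" .
      qed
    qed
  qed
  \<comment> \<open>the discretized operators are finite-rank approximations\<close>
  have K_limit: "H.finite_rank_limit K"
    unfolding H.finite_rank_limit_def
  proof (intro conjI allI impI opK)
    fix e :: real assume "0 < e"
    have "\<exists>h. 0 < h \<and> (\<forall>u\<in>V. ?n (Kh h u - K u) \<le> e * ?n u)"
      using eventually_happens[OF eventually_conj[OF eventually_at_right_less[of "0::real"]
          close[OF \<open>0 < e\<close>]]]
      by simp
    then obtain h where h: "0 < h" and near: "\<forall>u\<in>V. ?n (Kh h u - K u) \<le> e * ?n u" by blast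
    define B where "B = (\<Sum>k<N. cmod (w k) * op_norm_on V ?n (Rh h (z k)))"
    have in_V: "Rh h (z k) u \<in> V" if "k < N" for k u using Rh_V[OF h that] by blast
    have "?n (Kh h u) \<le> B * ?n u" if u: "u \<in> V" for u
    proof -
      have "?n (Kh h u) \<le> (\<Sum>k<N. ?n (w k *\<^sub>C Rh h (z k) u))"
        unfolding Kh_def by (intro H.nrm_sum H.V_scale in_V) auto
      also have "\<dots> \<le> (\<Sum>k<N. cmod (w k) * (op_norm_on V ?n (Rh h (z k)) * ?n u))"
      proof (rule sum_mono)
        fix k assume "k \<in> {..<N}"
        then have k: "k < N" by simp
        show "?n (w k *\<^sub>C Rh h (z k) u) \<le> cmod (w k) * (op_norm_on V ?n (Rh h (z k)) * ?n u)"
          unfolding H.nrm_scale[OF in_V[OF k]]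
          using H.op_norm_on_bound[OF R_bounded(2)[OF h k, unfolded V(2)] u]
              by (rule mult_left_mono) simp
      qed
      also have "\<dots> = B * ?n u" by (simp add: B_def sum_distrib_right mult.assoc)
      finally show ?thesis .
    qed
    moreover have "?n (K u - Kh h u) \<le> e * ?n u" if "u \<in> V" for u
      using bspec[OF near that] H.nrm_diff_commute[OF K_V[OF that] Kh_V[OF h]] by simp
    ultimately show "\<exists>F W B. H.op_on F \<and> findim_subspace W \<and> W \<subseteq> V \<and>
        (\<forall>u\<in>V. F u \<in> W \<and> ?n (F u) \<le> B * ?n u \<and> ?n (K u - F u) \<le> e * ?n u)"
      using opKh[OF h] Vh[OF h] Kh_Vh[OF h] by blast
  qed

  \<comment> \<open>the contour lies in the resolvent set of the filter operator\<close>
  have T_eq: "FC.T = (\<lambda>u. w N *\<^sub>C u + K u)" by (simp add: filter_op_def K_def fun_eq_iff)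
  have opT: "H.op_on FC.T"
    using opK H.subspace_V H.V_add[OF H.V_scale K_V]
    by (simp add: T_eq H.op_on_def linear_op_def scaleC_add_right mult.commute)
  define BT where "BT = cmod (w N) + (\<Sum>k<N. cmod (w k) * \<bar>op_norm_on V ?n (?RA (z k))\<bar>)"
  have BT: "0 \<le> BT" by (simp add: BT_def sum_nonneg)
  have T_le: "?n (FC.T u) \<le> BT * ?n u" if u: "u \<in> V" for u
  proof -
    have "?n (FC.T u) \<le> ?n (w N *\<^sub>C u) + ?n (K u)"
      unfolding T_eq by (intro H.nrm_triangle H.V_scale u K_V)
    also have "?n (K u) \<le> (\<Sum>k<N. ?n (w k *\<^sub>C ?RA (z k) u))"
      unfolding K_def by (intro H.nrm_sum H.V_scale RA_V u) auto
    also have "\<dots> \<le> (\<Sum>k<N. cmod (w k) * (\<bar>op_norm_on V ?n (?RA (z k))\<bar> * ?n u))"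
    proof (rule sum_mono)
      fix k assume "k \<in> {..<N}"
      then have k: "k < N" by simp
      have "?n (?RA (z k) u) \<le> op_norm_on V ?n (?RA (z k)) * ?n u"
        by (rule H.op_norm_on_bound[OF R_bounded(1)[OF k, unfolded V(2)] u])
      also have "\<dots> \<le> \<bar>op_norm_on V ?n (?RA (z k))\<bar> * ?n u"
        by (intro mult_right_mono H.nrm_nonneg u) simp
      finally show "?n (w k *\<^sub>C ?RA (z k) u) \<le> cmod (w k) * (\<bar>op_norm_on V ?n (?RA (z k))\<bar> * ?n u)"
        unfolding H.nrm_scale[OF RA_V[OF k u]] by (rule mult_left_mono) simp
    qed
    finally show ?thesis
      by (simp add: BT_def H.nrm_scale[OF u] distrib_right sum_distrib_right mult.assoc)
  qed
  let ?rest = "spectrum_in V ?n V FC.T - FC.r ` \<Lambda>"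
  \<comment> \<open>boundedness of the spectrum makes \<open>sup_modulus\<close> an upper bound\<close>
  have "cmod \<zeta> \<le> BT" if "\<zeta> \<notin> H.res FC.T" for \<zeta>
    using H.large_in_res[OF opT T_le BT, of \<zeta>] that by (force simp: H.res_bound_def)
  then have bdd: "bdd_above (insert 0 (cmod ` ?rest))"
    using BT by (intro bdd_aboveI[of _ BT]) (auto simp: spectrum_in_def)
  have \<Theta>_far: "sup_modulus ?rest < cmod p" if "p \<in> path_image \<Theta>" for p
    using \<Theta>(3)[OF that] by (simp add: S\<^sub>N V(2) r)
  have spec: "path_image \<Theta> \<subseteq> H.res FC.T"
  proof (rule ccontr)
    assume "\<not> ?thesis"
    then obtain p where p: "p \<in> path_image \<Theta>" "p \<notin> H.res FC.T" by blast
    have "p \<notin> FC.r ` \<Lambda>" using \<Theta>(2)[unfolded r] p(1) inside_no_overlap[of "path_image \<Theta>"] by blast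
    then have "cmod p \<in> insert 0 (cmod ` ?rest)" using p(2) by (simp add: spectrum_in_def)
    then have "cmod p \<le> sup_modulus ?rest" unfolding sup_modulus_def by (rule cSup_upper[OF _ bdd])
    then show False using \<Theta>_far[OF p(1)] by simp
  qed
  have zero: "0 \<notin> path_image \<Theta>"
  proof
    assume "0 \<in> path_image \<Theta>"
    moreover have "0 \<le> sup_modulus ?rest" unfolding sup_modulus_def
        by (rule cSup_upper[OF _ bdd]) simp
    ultimately show False using \<Theta>_far[of 0] by simp
  qed
  obtain L where L: "variation_le \<Theta> L"
    using \<Theta>(1) by (auto simp: rectifiable_jordan_curve_def rectifiable_path_def variation_le_def)
  interpret CC: cluster_contour V ipV C\<^sub>V \<Theta> L domA A \<Lambda> E N w z
  proof
    show "path \<Theta>" "pathfinish \<Theta> = pathstart \<Theta>" "variation_le \<Theta> L"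
      "\<And>\<zeta>. \<zeta> \<in> inside (path_image \<Theta>) \<Longrightarrow> winding_number \<Theta> \<zeta> = 1"
      using \<Theta>(1) L by (auto simp: rectifiable_jordan_curve_def simple_path_imp_path)
    show "H.finite_rank_limit (\<lambda>u. \<Sum>k<N. w k *\<^sub>C ?RA (z k) u)"
      using K_limit unfolding K_def[abs_def] .
    show "\<zeta> \<in> FC.r ` \<Lambda>" if "\<zeta> \<in> inside (path_image \<Theta>)" "\<zeta> \<notin> H.res FC.T" for \<zeta>
      using \<Theta>(4) that by (auto simp: spectrum_in_def S\<^sub>N V(2) r)
    show "FC.r ` \<Lambda> \<subseteq> inside (path_image \<Theta>)" using \<Theta>(2) by (simp add: r)
    show "E \<subseteq> V" "0 < N" "path_image \<Theta> \<subseteq> H.res FC.T"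
      "0 \<notin> inside (path_image \<Theta>)" "0 \<notin> path_image \<Theta>" "w N \<notin> FC.r ` \<Lambda>"
      by (fact V(3) N_pos spec \<Theta>(5) zero w_N)+
    show "?RA (z k) u \<in> V" if "k < N" "u \<in> V" for k u by (rule RA_V[OF that])
    show "complex_of_real l \<in> \<Lambda>" if "complex_of_real l \<notin> resolvent_set domA A" "c \<in> \<Lambda>"
      "FC.r (complex_of_real l) = FC.r c" for l c by (rule separated[OF that])
  qed

  \<comment> \<open>the form and the approximate eigenspaces\<close>
  obtain \<eta> where \<eta>: "0 < \<eta>"
    "\<forall>K' W F. H.op_on K' \<and> (\<forall>u\<in>V. K' u \<in> W \<and> ?n (K' u - (\<Sum>k<N. w k *\<^sub>C ?RA (z k) u)) \<le> \<eta> * ?n u) \<and>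
      F = riesz_projection V ?n (\<lambda>u. w N *\<^sub>C u + K' u) \<Theta> ` V \<longrightarrow>
      findim_subspace F \<and> F \<subseteq> W \<and> (\<forall>v\<in>F. ?S v = 0 \<longrightarrow> v = 0) \<and> E \<subseteq> ?S ` F"
    using CC.approximate_eigenspace by (elim exE conjE)
  obtain h\<^sub>0 where h\<^sub>0: "0 < h\<^sub>0" "\<And>h. 0 < h \<Longrightarrow> h < h\<^sub>0 \<Longrightarrow> \<forall>u\<in>V. ?n (Kh h u - K u) \<le> \<eta> * ?n u"
    using close[OF \<eta>(1)] unfolding eventually_at_right_field by auto
  have D: "hermitian_form_on dom_a a" unfolding form(3) by (rule hermitian_form_of[OF form(1,2)])
  have sub_D: "complex_vector.subspace dom_a"
    using form(2) by (auto simp: sqrt_op_def possemidef_op_def selfadjoint_op_def linear_op_def)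
  have dom_D: "domA \<subseteq> dom_a" using form(2) by (auto simp: sqrt_op_def)
  have ED: "E \<subseteq> dom_a" using EC.E_domA dom_D by blast
  have eig: "a x y = complex_of_real l * cinner x y"
    if "x \<in> domA" "A x = complex_of_real l *\<^sub>C x" "y \<in> dom_a" for x y l
    unfolding form(3) by (rule form_of_eigenvector[OF form(1,2) that])
  have ritz_E: "ritz_values a E = \<Lambda>"
    by (rule EC.ritz_values_E[OF D sub_D dom_D eig]) (use \<Lambda>(3) in auto)
  have "E \<noteq> {0}"
  proof
    assume "E = {0}"
    then have "complex_vector.dim E \<le> card ({} :: 'h set)"
      by (intro complex_vector.dim_le_card) auto
    then show False using E(3) by simp
  qed
  have "hausdorff_distance \<Lambda> (\<Lambda>h h)
      \<le> (form_op_seminorm a (Eh h) (\<lambda>v. S (Qh h v) - Qh h v))\<^sup>2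
        + 1 * op_norm_on E norm (compression a E) * (gap E (Eh h))\<^sup>2" if h: "0 < h" "h < h\<^sub>0" for h
  proof -
    let ?F = "Eh h"
    have "S\<^sub>Nh h = (\<lambda>u. w N *\<^sub>C u + Kh h u)" by (simp add: S\<^sub>Nh filter_op_def Kh_def fun_eq_iff)
    then have F_eq: "?F = riesz_projection V ?n (\<lambda>u. w N *\<^sub>C u + Kh h u) \<Theta> ` V" by (simp add: Eh V(2))
    have "\<forall>u\<in>V. Kh h u \<in> Vh h \<and> ?n (Kh h u - (\<Sum>k<N. w k *\<^sub>C ?RA (z k) u)) \<le> \<eta> * ?n u"
      using h\<^sub>0(2)[OF h] Kh_Vh[OF h(1)] unfolding K_def by blast
    with \<eta>(2)[rule_format, of "Kh h" "Vh h" ?F] opKh[OF h(1)] F_eq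
    have F: "findim_subspace ?F" "?F \<subseteq> Vh h" "\<And>v. v \<in> ?F \<Longrightarrow> ?S v = 0 \<Longrightarrow> v = 0" "E \<subseteq> ?S ` ?F"
      by auto
    have FD: "?F \<subseteq> dom_a" using F(2) Vh_dom[OF h(1)] by blast
    have Q: "S (Qh h v) - Qh h v = ?S v - v" if "v \<in> ?F" for v
      by (simp add: Qh orth_proj_id[OF F(1) that] S)
    have "?F \<noteq> {0}" using F(4) \<open>E \<noteq> {0}\<close> EC.S_zero complex_vector.subspace_0[OF EC.subspace_E] by auto
    have "hausdorff_distance (ritz_values a E) (ritz_values a ?F)
        \<le> (form_op_seminorm a ?F (\<lambda>v. S (Qh h v) - Qh h v))\<^sup>2
          + op_norm_on E norm (compression a E) * (gap E ?F)\<^sup>2"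
    proof (rule hausdorff_distance_ritz_values[OF D sub_D E(2) ED \<open>E \<noteq> {0}\<close> F(1) FD _ F(3,4)])
      show "\<exists>u\<in>E. \<forall>y\<in>dom_a. a x y = cinner u y" if "x \<in> E" for x
        using EC.form_reduces[OF D sub_D dom_D eig that] EC.A_E[OF that] by blast
      show "cmod (a e e) \<le> op_norm_on E norm (compression a E) * (norm e)\<^sup>2" if "e \<in> E" for e
        by (rule cmod_form_le_op_norm[OF E(2) hermitian_form_on_subset[OF D ED] that])
      show "norm (v - ?S v) \<le> gap E ?F * norm v" if "v \<in> ?F" for v
        by (rule norm_minus_proj_le_gap[OF E(2) F(1) that])
      show "0 \<le> gap E ?F" by (rule gap_nonneg[OF E(2) F(1) \<open>?F \<noteq> {0}\<close>])
      show "cmod (a (v - ?S v) (v - ?S v))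
          \<le> (form_op_seminorm a ?F (\<lambda>v. S (Qh h v) - Qh h v))\<^sup>2 * (norm v)\<^sup>2" if "v \<in> ?F" for v
        by (rule cmod_form_le_seminorm[OF D sub_D E(2) ED F(1) FD that Q])
    qed simp_all
    then show ?thesis by (simp add: ritz_E \<Lambda>h)
  qed
  then show ?thesis
    using h\<^sub>0(1) by (intro exI[of _ 1] conjI exI[of _ h\<^sub>0]) auto
qed

end
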